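(* Let $0<\lambda<1$. The maximal ideal space $\widetilde M_\lambda$ of the algebra $\mathcal B_\lambda$ consists of the snake-like continuum $M_\infty=\varprojlim([0,1],\alpha_\lambda)$ and a sequence of arcs $M_N$, $N\in\mathbb N$, such that $$\lim_{N\to\infty}M_N=M_\infty ,$$ where the limit is taken in the Hausdorff metric. In particular, $$\widetilde M_\lambda=\bigcup_{N\in\mathbb N}M_N\cup M_\infty=\overline{\bigcup_{N\in\mathbb N}M_N}.$$ The mapping $\widetilde\alpha_\lambda$ generated by $U_\lambda$ on $\widetilde M_\lambda$ carries the arc $M_N$ homeomorphically onto the arc $M_{N+1}$ for every $N\in\mathbb N$, and on the continuum $M_\infty=\varprojlim([0,1],\alpha_\lambda)$ it coincides with the homeomorphism induced by $\alpha_\lambda$.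
   Context: $\mathbb N=\{0,1,2,\dots\}$; $\{t\}$ is the fractional part of $t\in\mathbb R$. For $\lambda\in(0,1]$, $\alpha_\lambda:[0,1]\to[0,1]$, $\alpha_\lambda(x)=4\lambda x(1-x)$. $\mathcal A\subset L(L^2(\mathbb R))$ is the $C^*$-algebra of operators of multiplication by functions $a$ on $\mathbb R$ with $a(t+1)=a(t)$, $a|_{[0,1)}$ continuous, and $\lim_{t\to1^-}a(t)$ existing; $\mathcal A\cong C([0,1])$ and its spectrum is identified with $[0,1]$. Define $\gamma_\lambda(t)=4\lambda\{t\}(1-\{t\})+2k$ for $t\in[k,k+\frac12]$ and $\gamma_\lambda(t)=4\lambda\{t\}(1-\{t\})+2k+1$ for $t\in(k+\frac12,k+1)$, $k\in\mathbb Z$; $(U_\lambda f)(t)=\sqrt{|\gamma_\lambda'(t)|}f(\gamma_\lambda(t))$, $f\in L^2(\mathbb R)$ (a coisometry); $\mathcal B_\lambda=C^*\big(\bigcup_{n\in\mathbb N}U_\lambda^{*n}\mathcal AU_\lambda^n\big)$, a commutative unital $C^*$-algebra. For a character $\widetilde x$ of $\mathcal B_\lambda$ put $x_n(a)=\widetilde x(U_\lambda^{*n}aU_\lambda^n)$, $a\in\mathcal A$; each $x_n$ is a point of $[0,1]$ or the zero functional $\mathbf 0$ (not to be confused with the point $0\in[0,1]$), and $\widetilde x$ is identified with $(x_0,x_1,\dots)$. $M_N$ is the set of $\widetilde x\in\widetilde M_\lambda$ with $x_N\ne\mathbf 0$, $x_{N+1}=\mathbf 0$; $M_\infty$ is the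 set of $\widetilde x$ with all $x_n\neq\mathbf 0$. The map generated by $U_\lambda$ on $\widetilde M_\lambda$ is $\widetilde\alpha_\lambda(\widetilde x)(b)=\widetilde x(U_\lambda bU_\lambda^* )$, $b\in\mathcal B_\lambda$. $\varprojlim(M,\alpha)=\{(x_0,x_1,\dots)\in\prod_{n\in\mathbb N}M:\alpha(x_{n+1})=x_n\}$ with the product topology; the homeomorphism induced by $\alpha$ on it is $(x_0,x_1,\dots)\mapsto(\alpha(x_0),x_0,x_1,\dots)$. A continuum is a connected compact metric space; it is snake-like if it is homeomorphic to the inverse limit of an inverse sequence whose bonding maps are continuous maps of an interval. An arc is a space homeomorphic to a closed interval. *)

theory Defs
  imports "HOL-Analysis.Analysis"
begin

section \<open>The Hilbert space of square integrable functions on the real line\<close>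

definition sq_integrable :: "(real \<Rightarrow> complex) \<Rightarrow> bool" where
  "sq_integrable f \<longleftrightarrow> f \<in> borel_measurable lborel \<and> integrable lborel (\<lambda>t. (cmod (f t))\<^sup>2)"

definition eq_L2 :: "(real \<Rightarrow> complex) \<Rightarrow> (real \<Rightarrow> complex) \<Rightarrow> bool" where
  "eq_L2 f g \<longleftrightarrow> sq_integrable f \<and> sq_integrable g \<and> (AE t in lborel. f t = g t)"

lemma sq_integrable_measurable [measurable_dest]:
  "sq_integrable f \<Longrightarrow> f \<in> borel_measurable lborel"
  by (simp add: sq_integrable_def)

lemma borel_measurable_cnj:
  "f \<in> borel_measurable M \<Longrightarrow> (\<lambda>x. cnj (f x)) \<in> borel_measurable M"
  by (rule borel_measurable_continuous_on[where f = cnj]) (intro continuous_intros)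

lemma sq_integrable_zero: "sq_integrable (\<lambda>_. 0)"
  by (simp add: sq_integrable_def)

lemma part_equivp_eq_L2: "part_equivp eq_L2"
proof (rule part_equivpI)
  show "\<exists>f. eq_L2 f f"
    by (rule exI[of _ "\<lambda>_. 0"]) (simp add: eq_L2_def sq_integrable_zero)
  show "symp eq_L2"
    by (auto simp: symp_def eq_L2_def elim: eventually_mono)
  show "transp eq_L2"
    by (auto simp: transp_def eq_L2_def elim: eventually_elim2)
qed

quotient_type L2 = "real \<Rightarrow> complex" / partial: eq_L2
  morphisms rep_L2 L2_of
  by (rule part_equivp_eq_L2)

lemma sq_integrable_mult:
  assumes "sq_integrable f" "sq_integrable g"
  shows "integrable lborel (\<lambda>t. f t * cnj (g t))"
proof (rule Bochner_Integration.integrable_bound)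
  show "integrable lborel (\<lambda>t. (cmod (f t))\<^sup>2 + (cmod (g t))\<^sup>2)"
    using assms by (simp add: sq_integrable_def)
  show "(\<lambda>t. f t * cnj (g t)) \<in> borel_measurable lborel"
    using assms by (intro borel_measurable_times borel_measurable_cnj sq_integrable_measurable)
  have "cmod a * cmod b \<le> (cmod a)\<^sup>2 + (cmod b)\<^sup>2" for a b :: complex
    using sum_squares_bound[of "cmod a" "cmod b"] mult_nonneg_nonneg[of "cmod a" "cmod b"]
      norm_ge_zero[of a] norm_ge_zero[of b] by linarith
  then show "AE t in lborel. norm (f t * cnj (g t)) \<le> norm ((cmod (f t))\<^sup>2 + (cmod (g t))\<^sup>2)"
    by (simp add: norm_mult)
qed

lemma sq_integrable_add:
  assumes f: "sq_integrable f" and g: "sq_integrable g"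
  shows "sq_integrable (\<lambda>t. f t + g t)"
proof -
  have "integrable lborel (\<lambda>t. (cmod (f t + g t))\<^sup>2)"
  proof (rule Bochner_Integration.integrable_bound)
    show "integrable lborel (\<lambda>t. 2 * (cmod (f t))\<^sup>2 + 2 * (cmod (g t))\<^sup>2)"
      using f g by (simp add: sq_integrable_def)
    show "(\<lambda>t. (cmod (f t + g t))\<^sup>2) \<in> borel_measurable lborel"
      using f g by (auto simp: sq_integrable_def)
    have "(cmod (a + b))\<^sup>2 \<le> 2 * (cmod a)\<^sup>2 + 2 * (cmod b)\<^sup>2" for a b :: complex
    proof -
      have "(cmod (a + b))\<^sup>2 \<le> (cmod a + cmod b)\<^sup>2"
        by (intro power_mono norm_triangle_ineq) auto
      also have "\<dots> \<le> 2 * (cmod a)\<^sup>2 + 2 * (cmod b)\<^sup>2"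
        using sum_squares_bound[of "cmod a" "cmod b"] by (simp add: power2_sum)
      finally show ?thesis .
    qed
    then show "AE t in lborel. norm ((cmod (f t + g t))\<^sup>2)
        \<le> norm (2 * (cmod (f t))\<^sup>2 + 2 * (cmod (g t))\<^sup>2)"
      by (simp add: abs_of_nonneg)
  qed
  with f g show ?thesis by (auto simp: sq_integrable_def)
qed

lemma sq_integrable_cmult:
  "sq_integrable f \<Longrightarrow> sq_integrable (\<lambda>t. c * f t)"
  by (auto simp: sq_integrable_def norm_mult power_mult_distrib)

instantiation L2 :: real_vector
begin

lift_definition zero_L2 :: L2 is "\<lambda>_. 0"
  by (simp add: eq_L2_def sq_integrable_zero)

lift_definition plus_L2 :: "L2 \<Rightarrow> L2 \<Rightarrow> L2" is "\<lambda>f g t. f t + g t"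
  by (auto simp: eq_L2_def sq_integrable_add)

lift_definition uminus_L2 :: "L2 \<Rightarrow> L2" is "\<lambda>f t. - f t"
  using sq_integrable_cmult[of _ "-1"] by (auto simp: eq_L2_def)

lift_definition minus_L2 :: "L2 \<Rightarrow> L2 \<Rightarrow> L2" is "\<lambda>f g t. f t - g t"
proof -
  have *: "sq_integrable (\<lambda>t. f t - g t)" if "sq_integrable f" "sq_integrable g" for f g
    using sq_integrable_add[OF that(1) sq_integrable_cmult[OF that(2), of "-1"]] by simp
  show "\<And>f f' g g'. eq_L2 f f' \<Longrightarrow> eq_L2 g g' \<Longrightarrow> eq_L2 (\<lambda>t. f t - g t) (\<lambda>t. f' t - g' t)"
    by (auto simp: eq_L2_def *)
qed

lift_definition scaleR_L2 :: "real \<Rightarrow> L2 \<Rightarrow> L2" is "\<lambda>r f t. complex_of_real r * f t"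
  by (auto simp: eq_L2_def sq_integrable_cmult)

instance
proof
  fix a b c :: L2 and x y :: real
  show "a + b + c = a + (b + c)"
    by transfer (auto simp: eq_L2_def sq_integrable_add add.assoc)
  show "a + b = b + a"
    by transfer (auto simp: eq_L2_def sq_integrable_add add.commute)
  show "0 + a = a"
    by transfer (auto simp: eq_L2_def)
  show "- a + a = 0"
    by transfer (auto simp: eq_L2_def sq_integrable_zero)
  show "a - b = a + - b"
  proof transfer
    fix f g assume "eq_L2 f f" "eq_L2 g g"
    then have "sq_integrable (\<lambda>t. f t + -1 * g t)"
      by (intro sq_integrable_add sq_integrable_cmult) (auto simp: eq_L2_def)
    then show "eq_L2 (\<lambda>t. f t - g t) (\<lambda>t. f t + - g t)"
      by (simp add: eq_L2_def)
  qed
  show "x *\<^sub>R (a + b) = x *\<^sub>R a + x *\<^sub>R b"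
    by transfer (auto simp: eq_L2_def sq_integrable_add sq_integrable_cmult ring_distribs
        simp flip: distrib_left)
  show "(x + y) *\<^sub>R a = x *\<^sub>R a + y *\<^sub>R a"
    by transfer (auto simp: eq_L2_def sq_integrable_cmult simp flip: distrib_right of_real_add)
  show "x *\<^sub>R y *\<^sub>R a = (x * y) *\<^sub>R a"
    by transfer (auto simp: eq_L2_def sq_integrable_cmult simp flip: mult.assoc of_real_mult)
  show "1 *\<^sub>R a = a"
    by transfer (auto simp: eq_L2_def)
qed

end

lift_definition scaleC_L2 :: "complex \<Rightarrow> L2 \<Rightarrow> L2" is "\<lambda>c f t. c * f t"
  by (auto simp: eq_L2_def sq_integrable_cmult)

text \<open>Linear in the first argument.\<close>

lift_definition cinner_L2 :: "L2 \<Rightarrow> L2 \<Rightarrow> complex" is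
  "\<lambda>f g. \<integral>t. f t * cnj (g t) \<partial>lborel"
  by (intro Bochner_Integration.integral_cong_AE borel_measurable_times borel_measurable_cnj)
    (auto simp: eq_L2_def sq_integrable_def)

instantiation L2 :: real_inner
begin

definition inner_L2 :: "L2 \<Rightarrow> L2 \<Rightarrow> real" where "inner_L2 f g = Re (cinner_L2 f g)"
definition norm_L2 :: "L2 \<Rightarrow> real" where "norm_L2 f = sqrt (inner f f)"
definition sgn_L2 :: "L2 \<Rightarrow> L2" where "sgn_L2 f = f /\<^sub>R norm f"
definition dist_L2 :: "L2 \<Rightarrow> L2 \<Rightarrow> real" where "dist_L2 f g = norm (f - g)"
definition uniformity_L2 :: "(L2 \<times> L2) filter" where
  "uniformity_L2 = (INF e\<in>{0<..}. principal {(f, g). dist f g < e})"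
definition open_L2 :: "L2 set \<Rightarrow> bool" where
  "open_L2 S \<longleftrightarrow> (\<forall>f\<in>S. \<forall>\<^sub>F (f', g) in uniformity. f' = f \<longrightarrow> g \<in> S)"

lemma cinner_L2_self: "cinner_L2 f f = 0 \<longleftrightarrow> f = 0" "0 \<le> Re (cinner_L2 f f)"
  "Im (cinner_L2 f f) = 0"
proof -
  have *: "f t * cnj (f t) = complex_of_real ((cmod (f t))\<^sup>2)" for f :: "real \<Rightarrow> complex" and t
    by (simp add: complex_norm_square flip: of_real_power)
  show "cinner_L2 f f = 0 \<longleftrightarrow> f = 0"
    by transfer
      (auto simp: eq_L2_def * sq_integrable_zero sq_integrable_def
        integral_nonneg_eq_0_iff_AE simp del: of_real_power)
  show "0 \<le> Re (cinner_L2 f f)" "Im (cinner_L2 f f) = 0"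
    by (transfer, simp add: * del: of_real_power)+
qed

instance
proof
  fix a b c :: L2 and r :: real
  have "cinner_L2 b a = cnj (cinner_L2 a b)"
      proof transfer
    fix f g :: "real \<Rightarrow> complex"
    have "cnj (\<integral>t. f t * cnj (g t) \<partial>lborel) = (\<integral>t. cnj (f t * cnj (g t)) \<partial>lborel)"
      by (rule Bochner_Integration.integral_cnj[symmetric])
    then show "(\<integral>t. g t * cnj (f t) \<partial>lborel) = cnj (\<integral>t. f t * cnj (g t) \<partial>lborel)"
      by (simp add: mult.commute del: Bochner_Integration.integral_cnj)
  qed
  then show "inner a b = inner b a"
    by (simp add: inner_L2_def)
  have "cinner_L2 (a + b) c = cinner_L2 a c + cinner_L2 b c"
    by transfer (auto simp: eq_L2_def ring_distribs sq_integrable_mult)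
  then show "inner (a + b) c = inner a c + inner b c"
    by (simp add: inner_L2_def)
  have "cinner_L2 (r *\<^sub>R a) c = r * cinner_L2 a c"
    by transfer (auto simp: mult.assoc)
  then show "inner (r *\<^sub>R a) c = r * inner a c"
    by (simp add: inner_L2_def)
  show "0 \<le> inner a a"
    by (simp add: inner_L2_def cinner_L2_self)
  show "inner a a = 0 \<longleftrightarrow> a = 0"
    using cinner_L2_self[of a] by (auto simp: inner_L2_def complex_eq_iff)
  show "norm a = sqrt (inner a a)"
    by (rule norm_L2_def)
  show "sgn a = a /\<^sub>R norm a"
    by (rule sgn_L2_def)
  show "dist a b = norm (a - b)"
    by (rule dist_L2_def)
next
  show "uniformity = (INF e\<in>{0<..}. principal {(f, g::L2). dist f g < e})"
    by (rule uniformity_L2_def)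
next
  fix S :: "L2 set"
  show "open S \<longleftrightarrow> (\<forall>f\<in>S. \<forall>\<^sub>F (f', g) in uniformity. f' = f \<longrightarrow> g \<in> S)"
    by (rule open_L2_def)
qed

end


section \<open>Bounded operators and \<open>C\<^sup>*\<close>-algebras of operators\<close>

text \<open>A bounded operator is a bounded real linear map that is moreover complex linear.\<close>

type_synonym L2_op = "L2 \<Rightarrow>\<^sub>L L2"

definition bounded_operators :: "L2_op set" where
  "bounded_operators = {T. \<forall>c F. blinfun_apply T (scaleC_L2 c F) = scaleC_L2 c (blinfun_apply T F)}"

lemma bounded_linear_scaleC_L2: "bounded_linear (scaleC_L2 c)"
proof (rule bounded_linear_intro[where K = "cmod c"])
  fix F G :: L2 and r :: real
  show "scaleC_L2 c (F + G) = scaleC_L2 c F + scaleC_L2 c G"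
    by transfer (auto simp: eq_L2_def sq_integrable_add sq_integrable_cmult
        simp flip: distrib_left)
  show "scaleC_L2 c (r *\<^sub>R F) = r *\<^sub>R scaleC_L2 c F"
    by transfer (simp add: eq_L2_def sq_integrable_cmult mult.left_commute)
  have "cinner_L2 (scaleC_L2 c F) (scaleC_L2 c F) = complex_of_real ((cmod c)\<^sup>2) * cinner_L2 F F"
  proof transfer
    fix c and f :: "real \<Rightarrow> complex"
    have "c * f t * cnj (c * f t) = complex_of_real ((cmod c)\<^sup>2) * (f t * cnj (f t))" for t
      by (simp only: complex_norm_square complex_cnj_mult ac_simps)
    then show "(\<integral>t. c * f t * cnj (c * f t) \<partial>lborel)
        = complex_of_real ((cmod c)\<^sup>2) * (\<integral>t. f t * cnj (f t) \<partial>lborel)"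
      by (simp only: integral_mult_right_zero)
  qed
  then have "inner (scaleC_L2 c F) (scaleC_L2 c F) = (cmod c)\<^sup>2 * inner F F"
    by (simp add: inner_L2_def)
  then show "norm (scaleC_L2 c F) \<le> norm F * cmod c"
    by (simp add: norm_L2_def real_sqrt_mult)
qed

definition scaleC_op :: "complex \<Rightarrow> L2_op \<Rightarrow> L2_op" where
  "scaleC_op c T = Blinfun (scaleC_L2 c) o\<^sub>L T"

definition adj :: "L2_op \<Rightarrow> L2_op" where
  "adj T = (THE S. \<forall>F G. cinner_L2 (blinfun_apply T F) G = cinner_L2 F (blinfun_apply S G))"

primrec op_power :: "L2_op \<Rightarrow> nat \<Rightarrow> L2_op" where
  "op_power T 0 = id_blinfun"
| "op_power T (Suc n) = T o\<^sub>L op_power T n"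

definition cstar_subalgebra :: "L2_op set \<Rightarrow> bool" where
  "cstar_subalgebra B \<longleftrightarrow>
     B \<subseteq> bounded_operators \<and> closed B \<and> 0 \<in> B \<and>
     (\<forall>S\<in>B. \<forall>T\<in>B. S + T \<in> B) \<and>
     (\<forall>c. \<forall>T\<in>B. scaleC_op c T \<in> B) \<and>
     (\<forall>S\<in>B. \<forall>T\<in>B. S o\<^sub>L T \<in> B) \<and>
     (\<forall>T\<in>B. adj T \<in> B)"

definition cstar_generated :: "L2_op set \<Rightarrow> L2_op set" where
  "cstar_generated S = \<Inter> {B. cstar_subalgebra B \<and> S \<subseteq> B}"

text \<open>
  A character is a nonzero complex linear multiplicative functional on \<open>B\<close>, extended by \<open>0\<close> to all
  operators, so that distinct elements of \<open>characters B\<close> differ on \<open>B\<close>. The product topology of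
  the function space \<open>L2_op \<Rightarrow> complex\<close> then induces the weak-star topology on \<open>characters B\<close>.
\<close>

definition characters :: "L2_op set \<Rightarrow> (L2_op \<Rightarrow> complex) set" where
  "characters B = {\<xi>.
     (\<forall>T. T \<notin> B \<longrightarrow> \<xi> T = 0) \<and> (\<exists>T\<in>B. \<xi> T \<noteq> 0) \<and>
     (\<forall>S\<in>B. \<forall>T\<in>B. \<xi> (S + T) = \<xi> S + \<xi> T) \<and>
     (\<forall>c. \<forall>T\<in>B. \<xi> (scaleC_op c T) = c * \<xi> T) \<and>
     (\<forall>S\<in>B. \<forall>T\<in>B. \<xi> (S o\<^sub>L T) = \<xi> S * \<xi> T)}"

text \<open>The operator on \<open>L2\<close> that acts on representatives as \<open>\<Phi>\<close>.\<close>

definition op_of :: "((real \<Rightarrow> complex) \<Rightarrow> (real \<Rightarrow> complex)) \<Rightarrow> L2_op" where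
  "op_of \<Phi> = (THE T. \<forall>f. sq_integrable f \<longrightarrow>
     sq_integrable (\<Phi> f) \<and> blinfun_apply T (L2_of f) = L2_of (\<Phi> f))"

lemma op_of_eqI:
  assumes "\<And>f. sq_integrable f \<Longrightarrow>
    sq_integrable (\<Phi> f) \<and> blinfun_apply T (L2_of f) = L2_of (\<Phi> f)"
  shows "op_of \<Phi> = T"
  unfolding op_of_def
proof (rule the_equality)
  fix S assume S: "\<forall>f. sq_integrable f \<longrightarrow>
    sq_integrable (\<Phi> f) \<and> blinfun_apply S (L2_of f) = L2_of (\<Phi> f)"
  show "S = T"
  proof (rule blinfun_eqI)
    show "blinfun_apply S F = blinfun_apply T F" for F
      by (induct F rule: L2.abs_induct) (use S assms in \<open>simp add: eq_L2_def\<close>)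
  qed
qed (use assms in blast)

lemma adj_eqI:
  assumes "\<And>F G. cinner_L2 (blinfun_apply T F) G = cinner_L2 F (blinfun_apply S G)"
  shows "adj T = S"
  unfolding adj_def
proof (rule the_equality)
  fix S' assume "\<forall>F G. cinner_L2 (blinfun_apply T F) G = cinner_L2 F (blinfun_apply S' G)"
  then have *: "inner F (blinfun_apply S' G) = inner F (blinfun_apply S G)" for F G
    using assms by (simp add: inner_L2_def)
  have "blinfun_apply S' G = blinfun_apply S G" for G
    by (rule iffD1[OF vector_eq_ldot]) (simp add: *)
  then show "S' = S" by (rule blinfun_eqI)
qed (use assms in blast)

section \<open>The algebras \<open>\<A>\<close> and \<open>\<B>\<^sub>\<lambda>\<close>\<close>

definition symbol :: "(real \<Rightarrow> complex) \<Rightarrow> bool" where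
  "symbol a \<longleftrightarrow> (\<forall>t. a (t + 1) = a t) \<and> continuous_on {0..<1} a \<and>
     (\<exists>l. (a \<longlongrightarrow> l) (at_left 1))"

definition mult_op :: "(real \<Rightarrow> complex) \<Rightarrow> L2_op" where
  "mult_op a = op_of (\<lambda>f t. a t * f t)"

definition alg_A :: "L2_op set" where
  "alg_A = mult_op ` {a. symbol a}"

text \<open>The parameter \<open>\<lambda>\<close> is written \<open>\<mu>\<close>.\<close>

definition logistic :: "real \<Rightarrow> real \<Rightarrow> real" where
  "logistic \<mu> x = 4 * \<mu> * x * (1 - x)"

definition gam :: "real \<Rightarrow> real \<Rightarrow> real" where
  "gam \<mu> t = 4 * \<mu> * frac t * (1 - frac t) +
     (if frac t \<le> 1/2 then 2 * of_int \<lfloor>t\<rfloor> else 2 * of_int \<lfloor>t\<rfloor> + 1)"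

text \<open>
  \<open>gam \<mu>\<close> fails to be differentiable only at points of a countable set, where the (arbitrary)
  value of \<open>deriv\<close> is immaterial.
\<close>

definition U_op :: "real \<Rightarrow> L2_op" where
  "U_op \<mu> = op_of (\<lambda>f t. complex_of_real (sqrt \<bar>deriv (gam \<mu>) t\<bar>) * f (gam \<mu> t))"

definition conj_U :: "real \<Rightarrow> nat \<Rightarrow> L2_op \<Rightarrow> L2_op" where
  "conj_U \<mu> n T = op_power (adj (U_op \<mu>)) n o\<^sub>L T o\<^sub>L op_power (U_op \<mu>) n"

definition alg_B :: "real \<Rightarrow> L2_op set" where
  "alg_B \<mu> = cstar_generated (\<Union>n. conj_U \<mu> n ` alg_A)"

section \<open>The maximal ideal space of \<open>\<B>\<^sub>\<lambda>\<close>\<close>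

definition max_ideals :: "real \<Rightarrow> (L2_op \<Rightarrow> complex) set" where
  "max_ideals \<mu> = characters (alg_B \<mu>)"

text \<open>The functional \<open>x\<^sub>n\<close> on \<open>\<A>\<close> attached to a character.\<close>

definition component :: "real \<Rightarrow> (L2_op \<Rightarrow> complex) \<Rightarrow> nat \<Rightarrow> (L2_op \<Rightarrow> complex)" where
  "component \<mu> \<xi> n = (\<lambda>T. \<xi> (conj_U \<mu> n T))"

definition is_zero_functional :: "(L2_op \<Rightarrow> complex) \<Rightarrow> bool" where
  "is_zero_functional \<phi> \<longleftrightarrow> (\<forall>T\<in>alg_A. \<phi> T = 0)"

text \<open>
  The point \<open>x \<in> [0,1]\<close> as a functional on \<open>\<A>\<close>: evaluation at \<open>x\<close> of the continuous extension
  of \<open>a|\<^bsub>[0,1)\<^esub>\<close> to \<open>[0,1]\<close>.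
\<close>

definition symbol_value :: "(real \<Rightarrow> complex) \<Rightarrow> real \<Rightarrow> complex" where
  "symbol_value a x = (if x < 1 then a x else Lim (at_left 1) a)"

definition is_point :: "(L2_op \<Rightarrow> complex) \<Rightarrow> real \<Rightarrow> bool" where
  "is_point \<phi> x \<longleftrightarrow> x \<in> {0..1} \<and> (\<forall>a. symbol a \<longrightarrow> \<phi> (mult_op a) = symbol_value a x)"

definition coords :: "real \<Rightarrow> (L2_op \<Rightarrow> complex) \<Rightarrow> nat \<Rightarrow> real" where
  "coords \<mu> \<xi> n = (THE x. is_point (component \<mu> \<xi> n) x)"

definition M_fin :: "real \<Rightarrow> nat \<Rightarrow> (L2_op \<Rightarrow> complex) set" where
  "M_fin \<mu> N = {\<xi> \<in> max_ideals \<mu>. \<not> is_zero_functional (component \<mu> \<xi> N) \<and>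
     is_zero_functional (component \<mu> \<xi> (N + 1))}"

definition M_inf :: "real \<Rightarrow> (L2_op \<Rightarrow> complex) set" where
  "M_inf \<mu> = {\<xi> \<in> max_ideals \<mu>. \<forall>n. \<not> is_zero_functional (component \<mu> \<xi> n)}"

definition alpha_tilde :: "real \<Rightarrow> (L2_op \<Rightarrow> complex) \<Rightarrow> (L2_op \<Rightarrow> complex)" where
  "alpha_tilde \<mu> \<xi> =
     (\<lambda>T. if T \<in> alg_B \<mu> then \<xi> (U_op \<mu> o\<^sub>L T o\<^sub>L adj (U_op \<mu>)) else 0)"

section \<open>Inverse limits, continua and the Hausdorff metric\<close>

text \<open>As a set of sequences; its topology is induced by the product topology of \<open>nat \<Rightarrow> 'a\<close>.\<close>

definition inverse_limit :: "'a set \<Rightarrow> (nat \<Rightarrow> 'a \<Rightarrow> 'a) \<Rightarrow> (nat \<Rightarrow> 'a) set" where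
  "inverse_limit M f = {s. \<forall>n. s n \<in> M \<and> f n (s (Suc n)) = s n}"

definition induced_map :: "('a \<Rightarrow> 'a) \<Rightarrow> (nat \<Rightarrow> 'a) \<Rightarrow> (nat \<Rightarrow> 'a)" where
  "induced_map \<alpha> s = case_nat (\<alpha> (s 0)) s"

definition continuum :: "'a topology \<Rightarrow> bool" where
  "continuum X \<longleftrightarrow> connected_space X \<and> compact_space X \<and> metrizable_space X"

definition snake_like :: "'a topology \<Rightarrow> bool" where
  "snake_like X \<longleftrightarrow> continuum X \<and>
     (\<exists>f :: nat \<Rightarrow> real \<Rightarrow> real.
        (\<forall>n. continuous_on {0..1} (f n) \<and> f n ` {0..1} \<subseteq> {0..1}) \<and>
        X homeomorphic_space top_of_set (inverse_limit {0..1} f))"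

definition is_arc :: "'a topology \<Rightarrow> bool" where
  "is_arc X \<longleftrightarrow> X homeomorphic_space top_of_set {0..1::real}"

definition hausdorff_distance :: "('a \<Rightarrow> 'a \<Rightarrow> real) \<Rightarrow> 'a set \<Rightarrow> 'a set \<Rightarrow> real" where
  "hausdorff_distance d A B =
     max (SUP a\<in>A. INF b\<in>B. d a b) (SUP b\<in>B. INF a\<in>A. d a b)"

end

theory Submission
  imports Defs
begin

text \<open>
  Up to null sets, \<open>\<gamma>\<close> is a bijection of the line onto \<open>D = {t. frac t \<le> \<mu>}\<close>; let \<open>\<beta>\<close> be its
  inverse. As \<open>U\<close> is the weighted composition operator of \<open>\<gamma>\<close>, conjugation turns multiplication by
  \<open>g\<close> into multiplication by \<open>1\<^sub>D \<cdot> (g \<circ> \<beta>)\<close> (for \<open>U* g U\<close>) or by \<open>g \<circ> \<gamma>\<close> (for \<open>U g U*\<close>). Since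
  \<open>frac \<circ> \<gamma> = \<alpha> \<circ> frac\<close>, the operator \<open>U*\<^sup>n a U\<^sup>n\<close> multiplies by \<open>s \<mapsto> a(x\<^sub>n(s))\<close>, where
  \<open>x\<^sub>0(s) = frac s, x\<^sub>1(s), \<dots>\<close> is a backward orbit of \<open>frac s\<close> under \<open>\<alpha>\<close>, which stops when the iterates
  of \<open>\<beta>\<close> leave \<open>D\<close>.

  These orbits lie in the compact space \<open>X\<close> of all infinite backward orbits and of the finite ones
  that end in \<open>[\<mu>, 1]\<close>, and the image of Lebesgue measure has full support in \<open>X\<close>. By the
  Stone--Weierstrass theorem the algebra \<open>\<B>\<close> is \<open>C(X)\<close>, so the characters are the points of \<open>X\<close>, and
  the map generated by \<open>U\<close> is the shift \<open>x \<mapsto> (\<alpha>(x\<^sub>0), x\<^sub>0, x\<^sub>1, \<dots>)\<close>. An orbit of length \<open>N + 1\<close> is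
  determined by its last point \<open>x\<^sub>N \<in> [\<mu>, 1]\<close>, which makes \<open>M\<^sub>N\<close> an arc. The arcs approach \<open>M\<^sub>\<infinity>\<close> by
  compactness and exhaust it because \<open>\<alpha>\<^sup>n[\<mu>, 1] = \<alpha>\<^sup>n[0, 1]\<close> for large \<open>n\<close>; thus \<open>M\<^sub>\<infinity>\<close> is a
  Hausdorff limit of arcs, and in particular connected.
\<close>

section \<open>Measure-theoretic and topological preliminaries\<close>

lemma borel_measurable_frac [measurable]: "(frac :: real \<Rightarrow> real) \<in> borel_measurable borel"
  unfolding frac_def[abs_def] by measurable

lemma frac_unit: "frac (t::real) \<in> {0..1}"
  using frac_lt_1[of t] by auto

lemma countable_AE_lborel: "countable (A::real set) \<Longrightarrow> AE t in lborel. t \<notin> A"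
  by (intro AE_not_in countable_imp_null_set_lborel)

lemma AE_frac_noteq: "AE t in lborel. frac t \<noteq> (c::real)"
proof -
  have "frac t = c \<Longrightarrow> t \<in> range (\<lambda>k. of_int k + c)" for t
    by (auto simp: frac_def image_iff intro!: exI[of _ "\<lfloor>t\<rfloor>"])
  then show ?thesis
    using countable_AE_lborel[of "range (\<lambda>k::int. of_int k + c)"]
    by (auto elim!: eventually_mono)
qed

text \<open>Countable additivity over the fibres of \<open>p\<close>, enumerated by
  \<open>int_decode\<close>. It serves to cut the line into the half cells on which
  \<open>\<gamma>\<close> is monotone and into the unit cells that receive them.\<close>

lemma nn_integral_int_partition:
  fixes f :: "real \<Rightarrow> ennreal" and p :: "real \<Rightarrow> int"
  assumes [measurable]: "f \<in> borel_measurable borel" "p \<in> borel \<rightarrow>\<^sub>M count_space UNIV"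
  shows "(\<integral>\<^sup>+t. f t \<partial>lborel) = (\<Sum>n. \<integral>\<^sup>+t. f t * indicator {t. p t = int_decode n} t \<partial>lborel)"
proof -
  have "(\<Sum>n. f t * indicator {t. p t = int_decode n} t) = f t" for t
  proof -
    have "(\<Sum>n. f t * indicator {t. p t = int_decode n} t)
        = (\<Sum>n\<in>{int_encode (p t)}. f t * indicator {t. p t = int_decode n} t)"
      by (rule suminf_finite) (auto simp: indicator_def)
    then show ?thesis by simp
  qed
  moreover have [measurable]: "{t. p t = int_decode n} \<in> sets borel" for n
    by measurable
  ultimately show ?thesis
    by (subst nn_integral_suminf[symmetric]) simp_all
qed

lemma blinfun_compose_assoc: "(R o\<^sub>L S) o\<^sub>L T = R o\<^sub>L (S o\<^sub>L T)"
  by (rule blinfun_eqI) simp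

lemma op_power_commute: "T o\<^sub>L op_power T n = op_power T n o\<^sub>L T"
proof (induct n)
  case 0
  show ?case by (rule blinfun_eqI) simp
next
  case (Suc n)
  then show ?case by (metis blinfun_compose_assoc op_power.simps(2))
qed

lemma tendsto_coordinatewise:
  fixes f :: "'b \<Rightarrow> 'i \<Rightarrow> 'a::topological_space"
  assumes "\<And>i. ((\<lambda>c. f c i) \<longlongrightarrow> l i) F"
  shows "(f \<longlongrightarrow> l) F"
proof -
  have "limitin (product_topology (\<lambda>i. euclidean) UNIV) f l F"
    using assms by (auto simp: limitin_componentwise)
  then show ?thesis by (simp add: euclidean_product_topology)
qed

lemma continuous_on_coord: "continuous_on A (\<lambda>x. x n)"
  by (rule continuous_on_subset[OF continuous_on_product_coordinates]) simp

lemma homeomorphism_imp_homeomorphic_maps: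
  "homeomorphism S T f g \<Longrightarrow> homeomorphic_maps (top_of_set S) (top_of_set T) f g"
  by (auto simp: homeomorphism_def homeomorphic_maps_def continuous_map_subtopology_eu)

text \<open>Real-valued \<open>INF\<close> and \<open>SUP\<close> are informative only for bounded
  families: \<open>nonneg\<close> bounds the inner infima from below, and \<open>ab\<close>,
  \<open>ba\<close> bound the outer suprema by \<open>e\<close>. The suprema of values below
  \<open>e\<close> may reach \<open>e\<close>, hence the weak inequality.\<close>

lemma hausdorff_distance_le:
  assumes "A \<noteq> {}" "B \<noteq> {}" and nonneg: "\<And>a b. 0 \<le> d a b"
    and ab: "\<And>a. a \<in> A \<Longrightarrow> \<exists>b\<in>B. d a b < e" and ba: "\<And>b. b \<in> B \<Longrightarrow> \<exists>a\<in>A. d a b < e"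
  shows "0 \<le> hausdorff_distance d A B \<and> hausdorff_distance d A B \<le> e"
proof -
  have 1: "(INF b\<in>B. d a b) \<le> e" "0 \<le> (INF b\<in>B. d a b)" if a: "a \<in> A" for a
  proof -
    obtain b where "b \<in> B" "d a b < e" using ab[OF a] by blast
    then show "(INF b\<in>B. d a b) \<le> e"
      using nonneg by (intro cINF_lower2[of _ _ b]) (auto intro!: bdd_belowI[of _ 0])
    show "0 \<le> (INF b\<in>B. d a b)" using assms(2) nonneg by (intro cINF_greatest) auto
  qed
  have 2: "(INF a\<in>A. d a b) \<le> e" if b: "b \<in> B" for b
  proof -
    obtain a where "a \<in> A" "d a b < e" using ba[OF b] by blast
    then show ?thesis
      using nonneg by (intro cINF_lower2[of _ _ a]) (auto intro!: bdd_belowI[of _ 0])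
  qed
  obtain a where a: "a \<in> A" using assms(1) by blast
  have "0 \<le> (SUP a\<in>A. INF b\<in>B. d a b)"
    by (rule cSUP_upper2[where x = a]) (auto intro!: bdd_aboveI[of _ e] 1 a)
  moreover have "(SUP a\<in>A. INF b\<in>B. d a b) \<le> e"
    using assms(1) 1 by (intro cSUP_least) auto
  moreover have "(SUP b\<in>B. INF a\<in>A. d a b) \<le> e"
    using assms(2) 2 by (intro cSUP_least) auto
  ultimately show ?thesis by (auto simp: hausdorff_distance_def)
qed

section \<open>The map \<open>\<gamma>\<close> and its inverse branch\<close>

locale logistic_parameter =
  fixes \<mu> :: real
  assumes mu_pos: "0 < \<mu>" and mu_less_1: "\<mu> < 1"
begin

abbreviation \<alpha> :: "real \<Rightarrow> real" where "\<alpha> \<equiv> logistic \<mu>"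

abbreviation \<gamma> :: "real \<Rightarrow> real" where "\<gamma> \<equiv> gam \<mu>"

text \<open>A left inverse of \<open>\<gamma>\<close>; it is a right inverse almost everywhere on the closure
  \<open>{y. frac y \<le> \<mu>}\<close> of the range of \<open>\<gamma>\<close>. The parity of \<open>\<lfloor>y\<rfloor>\<close> selects the branch.\<close>

definition \<beta> :: "real \<Rightarrow> real" where
  "\<beta> y = (if even \<lfloor>y\<rfloor> then of_int (\<lfloor>y\<rfloor> div 2) + (1 - sqrt (1 - frac y / \<mu>)) / 2
          else of_int (\<lfloor>y\<rfloor> div 2) + (1 + sqrt (1 - frac y / \<mu>)) / 2)"

text \<open>The absolute derivative of \<open>\<gamma>\<close> where \<open>frac t\<close> is
  neither 0 nor 1/2, in a closed form that is visibly measurable.\<close>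

definition weight :: "real \<Rightarrow> real" where
  "weight t = 4 * \<mu> * \<bar>1 - 2 * frac t\<bar>"

text \<open>Completing the square displays the maximum \<open>\<mu>\<close> at 1/2 and prepares the
  inversion of \<open>\<alpha>\<close> by a square root, as in \<open>\<beta>\<close>.\<close>

lemma logistic_mu_half: "\<alpha> x = \<mu> - \<mu> * (1 - 2 * x)\<^sup>2"
  by (simp add: logistic_def power2_eq_square algebra_simps)

lemma logistic_le_mu: "\<alpha> x \<le> \<mu>"
  using mu_pos by (simp add: logistic_mu_half)

lemma logistic_nonneg: "x \<in> {0..1} \<Longrightarrow> 0 \<le> \<alpha> x"
  using mu_pos by (simp add: logistic_def)

lemma logistic_unit: "x \<in> {0..1} \<Longrightarrow> \<alpha> x \<in> {0..1}"
  using logistic_nonneg[of x] logistic_le_mu[of x] mu_less_1 by auto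

lemma continuous_on_logistic [continuous_intros]:
  "continuous_on A f \<Longrightarrow> continuous_on A (\<lambda>x. \<alpha> (f x))"
  unfolding logistic_def by (intro continuous_intros)

lemma gam_alt: "\<gamma> t = \<alpha> (frac t) + (if frac t \<le> 1/2 then 2 * of_int \<lfloor>t\<rfloor> else 2 * of_int \<lfloor>t\<rfloor> + 1)"
  by (simp add: gam_def logistic_def)

text \<open>As \<open>\<mu> < 1\<close>, the logistic term stays in \<open>[0, 1)\<close> and never
  carries into the integer part, which therefore records both the cell of \<open>t\<close> and the
  branch.\<close>

lemma floor_gam: "\<lfloor>\<gamma> t\<rfloor> = (if frac t \<le> 1/2 then 2 * \<lfloor>t\<rfloor> else 2 * \<lfloor>t\<rfloor> + 1)"
proof -
  have "\<lfloor>\<alpha> (frac t) + of_int m\<rfloor> = m" for m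
    using logistic_nonneg[OF frac_unit, of t] logistic_le_mu[of "frac t"] mu_less_1
    by (intro floor_unique) auto
  from this[of "2 * \<lfloor>t\<rfloor>"] this[of "2 * \<lfloor>t\<rfloor> + 1"] show ?thesis
    by (simp add: gam_alt)
qed

lemma frac_gam: "frac (\<gamma> t) = \<alpha> (frac t)"
  unfolding frac_def[of "\<gamma> t"] floor_gam by (simp add: gam_alt)

text \<open>\<open>1 - \<alpha> x / \<mu>\<close> is the square of \<open>1 - 2 * x\<close>; the
  root loses only the sign, which the parity of the floor restores.\<close>

lemma beta_gam: "\<beta> (\<gamma> t) = t"
proof -
  have "1 - \<alpha> (frac t) / \<mu> = (1 - 2 * frac t)\<^sup>2"
    using mu_pos by (simp add: logistic_mu_half field_simps)
  then have "sqrt (1 - frac (\<gamma> t) / \<mu>) = \<bar>1 - 2 * frac t\<bar>"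
    by (simp add: frac_gam)
  then show ?thesis
    by (auto simp: \<beta>_def floor_gam frac_def field_simps split: if_splits)
qed

lemma logistic_frac_beta: assumes "frac y \<le> \<mu>" shows "\<alpha> (frac (\<beta> y)) = frac y"
proof -
  define r where "r = sqrt (1 - frac y / \<mu>)"
  have q: "0 \<le> 1 - frac y / \<mu>" "1 - frac y / \<mu> \<le> 1"
    using assms mu_pos by (auto simp: field_simps)
  then have r: "0 \<le> r" "r \<le> 1" "r\<^sup>2 = 1 - frac y / \<mu>"
    by (auto simp: r_def)
  have eq: "\<alpha> x = frac y" if "1 - 2 * x = r \<or> 1 - 2 * x = - r" for x
  proof -
    have "(1 - 2 * x)\<^sup>2 = 1 - frac y / \<mu>"
      using that r(3) by auto
    then show ?thesis
      using mu_pos by (simp add: logistic_mu_half field_simps)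
  qed
  consider "even \<lfloor>y\<rfloor>" | "odd \<lfloor>y\<rfloor>" "r < 1" | "odd \<lfloor>y\<rfloor>" "r = 1" using r by linarith
  then show ?thesis
  proof cases
    case 1
    then have "frac (\<beta> y) = (1 - r) / 2"
      using r by (auto simp: \<beta>_def r_def[symmetric] frac_unique_iff)
    then show ?thesis by (intro eq) simp
  next
    case 2
    then have "frac (\<beta> y) = (1 + r) / 2"
      using r by (auto simp: \<beta>_def r_def[symmetric] frac_unique_iff)
    then show ?thesis by (intro eq) simp
  next
    \<comment> \<open>Here \<open>frac y = 0\<close> on a right branch: \<open>\<beta> y\<close> is
      the integer at the right end of its cell, so its fractional part is 0 rather than 1. This is
      harmless because \<open>\<alpha>\<close> vanishes at both.\<close>
    case 3
    then have "frac (\<beta> y) = 0"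
      by (auto simp: \<beta>_def r_def[symmetric])
    then show ?thesis using 3 by (intro eq) simp
  qed
qed

text \<open>The excluded points really fail on odd cells: an odd integer goes to an integer that
  \<open>\<gamma>\<close> sends to the next cell, and \<open>frac y = \<mu>\<close> goes to a
  midpoint, which \<open>\<gamma>\<close> counts to the left branch. They form a null set.\<close>

lemma gam_beta:
  assumes "frac y \<le> \<mu>" "y \<notin> \<int>" "frac y \<noteq> \<mu>"
  shows "\<gamma> (\<beta> y) = y"
proof -
  define r where "r = sqrt (1 - frac y / \<mu>)"
  have "frac y > 0" using assms(2) by (simp add: frac_gt_0_iff)
  then have q: "0 < 1 - frac y / \<mu>" "1 - frac y / \<mu> < 1"
    using assms mu_pos by (auto simp: field_simps)
  then have r: "0 < r" "r < 1"
    by (auto simp: r_def)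
  have fl: "\<lfloor>\<beta> y\<rfloor> = \<lfloor>y\<rfloor> div 2"
    using r by (auto simp: \<beta>_def r_def[symmetric] floor_eq_iff field_simps)
  have fr: "frac (\<beta> y) \<le> 1/2 \<longleftrightarrow> even \<lfloor>y\<rfloor>"
    unfolding frac_def fl using r by (auto simp: \<beta>_def r_def[symmetric])
  have "\<lfloor>\<gamma> (\<beta> y)\<rfloor> = \<lfloor>y\<rfloor>"
    unfolding floor_gam fr fl by (simp add: odd_two_times_div_two_succ)
  moreover have "frac (\<gamma> (\<beta> y)) = frac y"
    using logistic_frac_beta[OF assms(1)] by (simp add: frac_gam)
  ultimately show ?thesis by (metis frac_def diff_add_cancel)
qed

section \<open>Measurability, Jacobian and change of variables for \<open>\<gamma>\<close>\<close>

lemma borel_measurable_gam [measurable]: "\<gamma> \<in> borel_measurable borel"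
  unfolding gam_def[abs_def] by measurable

lemma borel_measurable_beta [measurable]: "\<beta> \<in> borel_measurable borel"
  unfolding \<beta>_def[abs_def] by measurable

lemma borel_measurable_weight [measurable]: "weight \<in> borel_measurable borel"
  unfolding weight_def[abs_def] by measurable

lemma weight_nonneg: "0 \<le> weight t"
  using mu_pos by (simp add: weight_def)

text \<open>On each open half cell \<open>\<gamma>\<close> coincides with a quadratic polynomial,
  whose derivative can be read off.\<close>

lemma deriv_gam:
  assumes "frac t \<noteq> 0" "frac t \<noteq> 1/2"
  shows "\<bar>deriv \<gamma> t\<bar> = weight t"
proof -
  define k where "k = \<lfloor>t\<rfloor>"
  define c where "c = (if frac t \<le> 1/2 then 2 * real_of_int k else 2 * of_int k + 1)"
  define S where "S = (if frac t \<le> 1/2 then {real_of_int k <..< k + 1/2} else {k + 1/2 <..< k + 1})"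
  have t: "t \<in> S" "open S" using assms frac_lt_1[of t] frac_ge_0[of t]
    unfolding S_def k_def frac_def by (auto split: if_splits) linarith+
  have g: "4 * \<mu> * (x - k) * (1 - (x - k)) + c = \<gamma> x" if "x \<in> S" for x
  proof -
    have "\<lfloor>x\<rfloor> = k" using that by (auto simp: S_def floor_eq_iff split: if_splits)
    moreover from this have "frac x \<le> 1/2 \<longleftrightarrow> frac t \<le> 1/2"
      using that by (auto simp: S_def frac_def split: if_splits)
    ultimately show ?thesis by (simp add: gam_def c_def frac_def)
  qed
  have "((\<lambda>x. 4 * \<mu> * (x - k) * (1 - (x - k)) + c) has_real_derivative 4 * \<mu> * (1 - 2 * (t - k))) (at t)"
    by (auto intro!: derivative_eq_intros simp: algebra_simps)
  then have "(\<gamma> has_real_derivative 4 * \<mu> * (1 - 2 * (t - k))) (at t)"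
    by (rule has_field_derivative_transform_within_open[OF _ t(2,1) g])
  then have "deriv \<gamma> t = 4 * \<mu> * (1 - 2 * frac t)"
    by (simp add: DERIV_imp_deriv k_def frac_def)
  then show ?thesis using mu_pos by (simp add: weight_def abs_mult)
qed

lemma AE_deriv_gam: "AE t in lborel. \<bar>deriv \<gamma> t\<bar> = weight t"
  using AE_frac_noteq[of 0] AE_frac_noteq[of "1/2"]
  by eventually_elim (rule deriv_gam)

lemma nn_integral_left_branch:
  fixes h :: "real \<Rightarrow> ennreal"
  assumes [measurable]: "h \<in> borel_measurable borel"
  shows "(\<integral>\<^sup>+t. weight t * h (\<gamma> t) * indicator {t. of_int k \<le> t \<and> t < of_int k + 1/2} t \<partial>lborel)
       = (\<integral>\<^sup>+x. h x * indicator {2 * of_int k .. 2 * of_int k + \<mu>} x \<partial>lborel)"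
proof -
  \<comment> \<open>\<open>\<gamma>\<close> jumps at both ends of the half cell; this polynomial
    agrees with it on the half cell and is differentiable across the ends, as the substitution rule
    demands.\<close>
  define g where "g = (\<lambda>x::real. \<alpha> (x - k) + 2 * of_int k)"
  have g: "g k = 2 * of_int k" "g (k + 1/2) = 2 * of_int k + \<mu>"
    by (auto simp: g_def logistic_def)
  have "(\<integral>\<^sup>+x. h x * indicator {g k .. g (k + 1/2)} x \<partial>lborel)
     = (\<integral>\<^sup>+x. h (g x) * ennreal (4 * \<mu> * (1 - 2 * (x - k))) * indicator {of_int k..k + 1/2} x \<partial>lborel)"
  proof (rule nn_integral_substitution_aux[where g = g and g' = "\<lambda>x. 4 * \<mu> * (1 - 2 * (x - k))"])
    show "(g has_real_derivative 4 * \<mu> * (1 - 2 * (x - k))) (at x)" for x :: real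
      unfolding g_def logistic_def by (auto intro!: derivative_eq_intros simp: algebra_simps)
    show "0 \<le> 4 * \<mu> * (1 - 2 * (x - k))" if "x \<in> {of_int k..of_int k + 1/2}" for x :: real
      using mu_pos that by (intro mult_nonneg_nonneg) auto
  qed (auto intro!: continuous_intros)
  also have "\<dots> = (\<integral>\<^sup>+t. weight t * h (\<gamma> t) * indicator {t. of_int k \<le> t \<and> t < of_int k + 1/2} t \<partial>lborel)"
    using AE_frac_noteq[of "1/2"]
  proof (intro nn_integral_cong_AE, eventually_elim)
    case (elim x)
    show ?case
    proof (cases "x \<in> {of_int k..k + 1/2}")
      case True
      then have "\<lfloor>x\<rfloor> = k" by (auto simp: floor_eq_iff)
      then show ?thesis using True elim
        by (auto simp: frac_def weight_def gam_alt g_def mult.commute)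
    qed (auto simp: indicator_def)
  qed
  finally show ?thesis unfolding g by simp
qed

text \<open>The symmetry of \<open>\<alpha>\<close> under \<open>x \<mapsto> 1 - x\<close>, moved to
  the cell of \<open>k\<close>. It reduces the decreasing branch to the increasing one, raised by
  one cell.\<close>

lemma gam_reflect:
  assumes "of_int k < t" "t < of_int k + 1/2"
  shows "\<gamma> (of_int (2 * k + 1) - t) = \<gamma> t + 1" "weight (of_int (2 * k + 1) - t) = weight t"
proof -
  have "\<lfloor>t\<rfloor> = k" "\<lfloor>of_int (2 * k + 1) - t\<rfloor> = k"
    using assms by (auto simp: floor_eq_iff)
  then show "\<gamma> (of_int (2 * k + 1) - t) = \<gamma> t + 1" "weight (of_int (2 * k + 1) - t) = weight t"
    using assms by (auto simp: frac_def weight_def gam_alt logistic_def algebra_simps)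
qed

lemma nn_integral_right_branch:
  fixes h :: "real \<Rightarrow> ennreal"
  assumes [measurable]: "h \<in> borel_measurable borel"
  shows "(\<integral>\<^sup>+t. weight t * h (\<gamma> t) * indicator {t. of_int k + 1/2 \<le> t \<and> t < of_int k + 1} t \<partial>lborel)
       = (\<integral>\<^sup>+x. h x * indicator {2 * of_int k + 1 .. 2 * of_int k + 1 + \<mu>} x \<partial>lborel)"
proof -
  have "(\<integral>\<^sup>+t. weight t * h (\<gamma> t) * indicator {t. of_int k + 1/2 \<le> t \<and> t < of_int k + 1} t \<partial>lborel)
     = (\<integral>\<^sup>+t. weight (of_int (2 * k + 1) - t) * h (\<gamma> (of_int (2 * k + 1) - t)) *
           indicator {t. of_int k + 1/2 \<le> t \<and> t < of_int k + 1} (of_int (2 * k + 1) - t) \<partial>lborel)"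
    by (subst nn_integral_real_affine[of _ "-1" "of_int (2 * k + 1)"]) simp_all
  also have "\<dots> = (\<integral>\<^sup>+t. weight t * (h (\<gamma> t + 1)) * indicator {t. of_int k \<le> t \<and> t < of_int k + 1/2} t \<partial>lborel)"
    using AE_frac_noteq[of "1/2"] AE_frac_noteq[of 0]
  proof (intro nn_integral_cong_AE, eventually_elim)
    case (elim x)
    then have "x \<noteq> of_int k" "x \<noteq> of_int k + 1/2"
      by (auto simp: frac_def floor_eq_iff)
    then have "(of_int k + 1/2 \<le> of_int (2 * k + 1) - x \<and> of_int (2 * k + 1) - x < of_int k + 1)
      \<longleftrightarrow> (of_int k < x \<and> x < of_int k + 1/2)" "(of_int k \<le> x \<and> x < of_int k + 1/2) \<longleftrightarrow> (of_int k < x \<and> x < of_int k + 1/2)"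
      by auto
    then show ?case
      using gam_reflect[of k x] by (auto simp: indicator_def simp del: of_int_add of_int_mult)
  qed
  also have "\<dots> = (\<integral>\<^sup>+x. h (x + 1) * indicator {2 * of_int k .. 2 * of_int k + \<mu>} x \<partial>lborel)"
    by (rule nn_integral_left_branch) simp
  also have "\<dots> = (\<integral>\<^sup>+x. h (1 + x) * indicator {2 * of_int k + 1 .. 2 * of_int k + 1 + \<mu>} (1 + x) \<partial>lborel)"
    by (intro nn_integral_cong) (auto simp: indicator_def add.commute)
  also have "\<dots> = (\<integral>\<^sup>+x. h x * indicator {2 * of_int k + 1 .. 2 * of_int k + 1 + \<mu>} x \<partial>lborel)"
    by (subst (2) nn_integral_real_affine[of _ 1 1]) simp_all
  finally show ?thesis .
qed

lemma nn_integral_gam: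
  fixes h :: "real \<Rightarrow> ennreal"
  assumes [measurable]: "h \<in> borel_measurable borel"
  shows "(\<integral>\<^sup>+t. weight t * h (\<gamma> t) \<partial>lborel) = (\<integral>\<^sup>+x. indicator {x. frac x \<le> \<mu>} x * h x \<partial>lborel)"
proof -
  \<comment> \<open>Almost everywhere \<open>\<gamma>\<close> maps the half cell of number
    \<open>m\<close> into the unit cell of number \<open>m\<close>; even \<open>m\<close> are left
    branches, odd \<open>m\<close> right branches.\<close>
  have branch: "(\<integral>\<^sup>+t. weight t * h (\<gamma> t) * indicator {t. \<lfloor>2 * t\<rfloor> = m} t \<partial>lborel)
     = (\<integral>\<^sup>+x. indicator {x. frac x \<le> \<mu>} x * h x * indicator {x. \<lfloor>x\<rfloor> = m} x \<partial>lborel)" for m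
  proof (cases "even m")
    case True
    then obtain k where m: "m = 2 * k" by auto
    have "{t::real. \<lfloor>2 * t\<rfloor> = m} = {t. of_int k \<le> t \<and> t < of_int k + 1/2}"
      by (auto simp: m floor_eq_iff)
    moreover have "indicator {x. frac x \<le> \<mu>} x * h x * indicator {x. \<lfloor>x\<rfloor> = m} x
       = h x * indicator {2 * of_int k .. 2 * of_int k + \<mu>} x" for x
    proof (cases "\<lfloor>x\<rfloor> = m")
      case True
      then have "frac x = x - 2 * of_int k" "2 * of_int k \<le> x"
        unfolding frac_def m by linarith+
      then show ?thesis using True by (auto simp: indicator_def)
    next
      case False
      then show ?thesis using mu_less_1 by (auto simp: m indicator_def floor_eq_iff)
    qed
    ultimately show ?thesis
      by (simp add: nn_integral_left_branch)
  next
    case False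
    then obtain k where m: "m = 2 * k + 1" by (auto elim: oddE)
    have "{t::real. \<lfloor>2 * t\<rfloor> = m} = {t. of_int k + 1/2 \<le> t \<and> t < of_int k + 1}"
      by (auto simp: m floor_eq_iff)
    moreover have "indicator {x. frac x \<le> \<mu>} x * h x * indicator {x. \<lfloor>x\<rfloor> = m} x
       = h x * indicator {2 * of_int k + 1 .. 2 * of_int k + 1 + \<mu>} x" for x
    proof (cases "\<lfloor>x\<rfloor> = m")
      case True
      then have "frac x = x - (2 * of_int k + 1)" "2 * of_int k + 1 \<le> x"
        unfolding frac_def m by linarith+
      then show ?thesis using True by (auto simp: indicator_def)
    next
      case False
      then show ?thesis using mu_less_1 by (auto simp: m indicator_def floor_eq_iff)
    qed
    ultimately show ?thesis
      by (simp add: nn_integral_right_branch)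
  qed
  have "(\<integral>\<^sup>+t. weight t * h (\<gamma> t) \<partial>lborel)
     = (\<Sum>n. \<integral>\<^sup>+t. weight t * h (\<gamma> t) * indicator {t. \<lfloor>2 * t\<rfloor> = int_decode n} t \<partial>lborel)"
    by (rule nn_integral_int_partition) measurable
  also have "\<dots> = (\<integral>\<^sup>+x. indicator {x. frac x \<le> \<mu>} x * h x \<partial>lborel)"
    unfolding branch by (rule nn_integral_int_partition[symmetric]) measurable
  finally show ?thesis .
qed

text \<open>An identity of measures, so that almost-everywhere statements and complex integrals can
  be transported as well as nonnegative integrals.\<close>

lemma distr_gam:
  "distr (density lborel weight) borel \<gamma> = density lborel (indicator {x. frac x \<le> \<mu>})"
proof (rule measure_eqI)
  fix A assume "A \<in> sets (distr (density lborel weight) borel \<gamma>)"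
  then have [measurable]: "A \<in> sets borel" by simp
  show "emeasure (distr (density lborel weight) borel \<gamma>) A = emeasure (density lborel (indicator {x. frac x \<le> \<mu>})) A"
    using nn_integral_gam[of "indicator A"]
    by (simp add: emeasure_distr emeasure_density indicator_vimage[symmetric] indicator_def vimage_def)
qed simp

text \<open>By \<open>distr_gam\<close> the claim holds almost everywhere for the density
  \<open>weight\<close>, and this density vanishes only at the midpoints of cells, a null
  set.\<close>

lemma AE_gam:
  assumes [measurable]: "Measurable.pred borel P" and "AE x in lborel. frac x \<le> \<mu> \<longrightarrow> P x"
  shows "AE t in lborel. P (\<gamma> t)"
proof -
  have "AE x in distr (density lborel weight) borel \<gamma>. P x"
    unfolding distr_gam using assms(2) by (simp add: AE_density indicator_def)
  then have "AE t in density lborel weight. P (\<gamma> t)"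
    by (simp add: AE_distr_iff)
  then have "AE t in lborel. weight t > 0 \<longrightarrow> P (\<gamma> t)"
    by (simp add: AE_density)
  with AE_frac_noteq[of "1/2"] show ?thesis
    by eventually_elim (use mu_pos in \<open>auto simp: weight_def\<close>)
qed

end

section \<open>Multiplication operators and weighted composition operators\<close>

lemma L2_of_eq_iff:
  "sq_integrable f \<Longrightarrow> sq_integrable g \<Longrightarrow> L2_of f = L2_of g \<longleftrightarrow> (AE t in lborel. f t = g t)"
  using Quotient3_rel[OF Quotient3_L2, of f g] by (auto simp: eq_L2_def)

lemma L2_cases: obtains f where "sq_integrable f" "F = L2_of f"
  by (induct F rule: L2.abs_induct) (auto simp: eq_L2_def)

lemma L2_of_add: "sq_integrable f \<Longrightarrow> sq_integrable g \<Longrightarrow> L2_of f + L2_of g = L2_of (\<lambda>t. f t + g t)"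
  by (rule plus_L2.abs_eq) (auto simp: eq_L2_def)

lemma L2_of_scaleR: "sq_integrable f \<Longrightarrow> r *\<^sub>R L2_of f = L2_of (\<lambda>t. of_real r * f t)"
  by (rule scaleR_L2.abs_eq) (auto simp: eq_L2_def)

lemma L2_of_scaleC: "sq_integrable f \<Longrightarrow> scaleC_L2 c (L2_of f) = L2_of (\<lambda>t. c * f t)"
  by (rule scaleC_L2.abs_eq) (auto simp: eq_L2_def)

lemma cinner_L2_of:
  "sq_integrable f \<Longrightarrow> sq_integrable g \<Longrightarrow>
    cinner_L2 (L2_of f) (L2_of g) = (\<integral>t. f t * cnj (g t) \<partial>lborel)"
  by (rule cinner_L2.abs_eq) (auto simp: eq_L2_def)

lemma norm_L2_of:
  assumes "sq_integrable f"
  shows "ennreal ((norm (L2_of f))\<^sup>2) = (\<integral>\<^sup>+t. ennreal ((cmod (f t))\<^sup>2) \<partial>lborel)"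
proof -
  have "f t * cnj (f t) = complex_of_real ((cmod (f t))\<^sup>2)" for t
    by (simp add: complex_norm_square flip: of_real_power)
  then have "(norm (L2_of f))\<^sup>2 = (\<integral>t. (cmod (f t))\<^sup>2 \<partial>lborel)"
    using assms by (simp add: norm_eq_sqrt_inner inner_L2_def cinner_L2_of del: of_real_power)
  then show ?thesis
    using assms by (simp add: nn_integral_eq_integral sq_integrable_def)
qed

text \<open>The property that \<open>op_of\<close> selects by definite description, kept as a
  relation so that operators can be composed and compared on representatives.\<close>

definition represents :: "L2_op \<Rightarrow> ((real \<Rightarrow> complex) \<Rightarrow> (real \<Rightarrow> complex)) \<Rightarrow> bool" where
  "represents T \<Phi> \<longleftrightarrow>
     (\<forall>f. sq_integrable f \<longrightarrow> sq_integrable (\<Phi> f) \<and> blinfun_apply T (L2_of f) = L2_of (\<Phi> f))"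

lemma represents_op_of: "represents T \<Phi> \<Longrightarrow> op_of \<Phi> = T"
  by (rule op_of_eqI) (simp add: represents_def)

lemma represents_compose:
  "represents S \<Psi> \<Longrightarrow> represents T \<Phi> \<Longrightarrow> represents (S o\<^sub>L T) (\<lambda>f. \<Psi> (\<Phi> f))"
  by (simp add: represents_def)

lemma sq_integrable_cong_AE:
  assumes "sq_integrable f" "AE t in lborel. f t = g t" "g \<in> borel_measurable borel"
  shows "sq_integrable g"
proof -
  have "AE t in lborel. (cmod (f t))\<^sup>2 = (cmod (g t))\<^sup>2"
    using assms(2) by eventually_elim simp
  with assms show ?thesis
    unfolding sq_integrable_def
    by (subst integrable_cong_AE[where g = "\<lambda>t. (cmod (f t))\<^sup>2"]) (auto elim: eventually_mono)
qed

text \<open>Agreement almost everywhere with a Borel function does not make \<open>\<Psi> f\<close>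
  Borel, hence the third assumption. The lemma later exchanges \<open>weight\<close> for
  \<open>deriv\<close> in \<open>U\<close>.\<close>

lemma represents_cong:
  assumes "represents T \<Phi>"
    and "\<And>f. sq_integrable f \<Longrightarrow> AE t in lborel. \<Phi> f t = \<Psi> f t"
    and "\<And>f. sq_integrable f \<Longrightarrow> \<Psi> f \<in> borel_measurable borel"
  shows "represents T \<Psi>"
  unfolding represents_def
proof (intro allI impI)
  fix f assume f: "sq_integrable f"
  have \<Phi>: "sq_integrable (\<Phi> f)" "blinfun_apply T (L2_of f) = L2_of (\<Phi> f)"
    using assms(1) f by (auto simp: represents_def)
  have \<Psi>: "sq_integrable (\<Psi> f)"
    by (rule sq_integrable_cong_AE[OF \<Phi>(1) assms(2,3)[OF f]])
  then show "sq_integrable (\<Psi> f) \<and> blinfun_apply T (L2_of f) = L2_of (\<Psi> f)"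
    using L2_of_eq_iff[OF \<Phi>(1) \<Psi>] assms(2)[OF f] \<Phi>(2) by simp
qed

lemma represents_unique:
  assumes "represents S \<Psi>" "represents T \<Phi>"
    and "\<And>f. sq_integrable f \<Longrightarrow> AE t in lborel. \<Psi> f t = \<Phi> f t"
  shows "S = T"
proof (rule blinfun_eqI)
  fix F
  obtain f where f: "sq_integrable f" "F = L2_of f" by (rule L2_cases)
  have "sq_integrable (\<Psi> f)" "sq_integrable (\<Phi> f)"
    "blinfun_apply S F = L2_of (\<Psi> f)" "blinfun_apply T F = L2_of (\<Phi> f)"
    using assms(1,2) f by (auto simp: represents_def)
  then show "blinfun_apply S F = blinfun_apply T F"
    using L2_of_eq_iff assms(3)[OF f(1)] by simp
qed

section \<open>Weighted composition operators\<close>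

definition wcomp :: "(real \<Rightarrow> complex) \<Rightarrow> (real \<Rightarrow> real) \<Rightarrow> (real \<Rightarrow> complex) \<Rightarrow> (real \<Rightarrow> complex)" where
  "wcomp w \<tau> f = (\<lambda>t. w t * f (\<tau> t))"

text \<open>The measure with density the squared modulus of \<open>w\<close> has an image under
  \<open>\<tau>\<close> of at most \<open>K\<close> times Lebesgue measure. This one inequality
  yields square integrability, independence of the representative and the norm bound
  \<open>sqrt K\<close>.\<close>

definition wcomp_bound :: "real \<Rightarrow> (real \<Rightarrow> complex) \<Rightarrow> (real \<Rightarrow> real) \<Rightarrow> bool" where
  "wcomp_bound K w \<tau> \<longleftrightarrow> 0 \<le> K \<and> w \<in> borel_measurable borel \<and> \<tau> \<in> borel_measurable borel \<and>
     (\<forall>h. h \<in> borel_measurable borel \<longrightarrow>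
        (\<integral>\<^sup>+t. ennreal ((cmod (w t))\<^sup>2) * h (\<tau> t) \<partial>lborel) \<le> ennreal K * (\<integral>\<^sup>+t. h t \<partial>lborel))"

lemma nn_integral_wcomp:
  assumes "wcomp_bound K w \<tau>" and [measurable]: "f \<in> borel_measurable borel"
  shows "(\<integral>\<^sup>+t. ennreal ((cmod (wcomp w \<tau> f t))\<^sup>2) \<partial>lborel) \<le> ennreal K * (\<integral>\<^sup>+t. ennreal ((cmod (f t))\<^sup>2) \<partial>lborel)"
proof -
  have "(\<integral>\<^sup>+t. ennreal ((cmod (w t))\<^sup>2) * ennreal ((cmod (f (\<tau> t)))\<^sup>2) \<partial>lborel)
     \<le> ennreal K * (\<integral>\<^sup>+t. ennreal ((cmod (f t))\<^sup>2) \<partial>lborel)"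
    using assms(1) unfolding wcomp_bound_def by (elim conjE allE[of _ "\<lambda>t. ennreal ((cmod (f t))\<^sup>2)"]) simp
  then show ?thesis
    by (simp add: wcomp_def norm_mult power_mult_distrib ennreal_mult')
qed

lemma sq_integrable_iff:
  "sq_integrable f \<longleftrightarrow> f \<in> borel_measurable borel \<and> (\<integral>\<^sup>+t. ennreal ((cmod (f t))\<^sup>2) \<partial>lborel) < \<infinity>"
  by (auto simp: sq_integrable_def integrable_iff_bounded)

lemma sq_integrable_wcomp:
  assumes "wcomp_bound K w \<tau>" "sq_integrable f"
  shows "sq_integrable (wcomp w \<tau> f)"
proof -
  have [measurable]: "w \<in> borel_measurable borel" "\<tau> \<in> borel_measurable borel" "f \<in> borel_measurable borel"
    using assms by (auto simp: wcomp_bound_def sq_integrable_def)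
  have "(\<integral>\<^sup>+t. ennreal ((cmod (wcomp w \<tau> f t))\<^sup>2) \<partial>lborel) < \<infinity>"
    using assms(2) by (intro le_less_trans[OF nn_integral_wcomp[OF assms(1), of f]])
      (auto simp: sq_integrable_iff ennreal_mult_less_top)
  then show ?thesis
    by (simp add: sq_integrable_iff) (simp add: wcomp_def)
qed

text \<open>The bound is applied to the difference of \<open>f\<close> and \<open>g\<close>, whose
  square integral is zero.\<close>

lemma wcomp_AE_eq:
  assumes "wcomp_bound K w \<tau>" "sq_integrable f" "sq_integrable g" "AE t in lborel. f t = g t"
  shows "AE t in lborel. wcomp w \<tau> f t = wcomp w \<tau> g t"
proof -
  have [measurable]: "w \<in> borel_measurable borel" "\<tau> \<in> borel_measurable borel"
    "f \<in> borel_measurable borel" "g \<in> borel_measurable borel"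
    using assms by (auto simp: wcomp_bound_def sq_integrable_def)
  let ?d = "\<lambda>t. f t - g t"
  have "(\<integral>\<^sup>+t. ennreal ((cmod (?d t))\<^sup>2) \<partial>lborel) = 0"
    using assms(4) by (subst nn_integral_0_iff_AE) (auto elim!: eventually_mono)
  then have "(\<integral>\<^sup>+t. ennreal ((cmod (wcomp w \<tau> ?d t))\<^sup>2) \<partial>lborel) = 0"
    using nn_integral_wcomp[OF assms(1), of ?d] by simp
  moreover have "(\<lambda>t. ennreal ((cmod (wcomp w \<tau> ?d t))\<^sup>2)) \<in> borel_measurable lborel"
    unfolding wcomp_def by measurable
  ultimately have "AE t in lborel. ennreal ((cmod (wcomp w \<tau> ?d t))\<^sup>2) = 0"
    by (simp add: nn_integral_0_iff_AE)
  then show ?thesis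
    by eventually_elim (auto simp: wcomp_def algebra_simps)
qed

lemma norm_L2_of_wcomp:
  assumes "wcomp_bound K w \<tau>" "sq_integrable f"
  shows "norm (L2_of (wcomp w \<tau> f)) \<le> norm (L2_of f) * sqrt K"
proof -
  have K: "0 \<le> K" using assms(1) by (simp add: wcomp_bound_def)
  have "ennreal ((norm (L2_of (wcomp w \<tau> f)))\<^sup>2) \<le> ennreal K * ennreal ((norm (L2_of f))\<^sup>2)"
    unfolding norm_L2_of[OF sq_integrable_wcomp[OF assms]] norm_L2_of[OF assms(2)]
    using assms by (intro nn_integral_wcomp) (auto simp: sq_integrable_def)
  then have "(norm (L2_of (wcomp w \<tau> f)))\<^sup>2 \<le> (norm (L2_of f) * sqrt K)\<^sup>2"
    using K by (simp add: ennreal_mult'[symmetric] power_mult_distrib mult.commute)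
  then show ?thesis
    by (rule power2_le_imp_le) (use K in simp)
qed

lemma rep_L2: "sq_integrable (rep_L2 F)" "L2_of (rep_L2 F) = F"
  using Quotient3_rep_reflp[OF Quotient3_L2, of F] Quotient3_abs_rep[OF Quotient3_L2, of F]
  by (auto simp: eq_L2_def)

text \<open>The common source of \<open>U\<close>, of its adjoint and of the multiplication
  operators. The operator acts on the chosen representative \<open>rep_L2 F\<close>; by
  \<open>wcomp_AE_eq\<close> the choice does not matter, and linearity follows.\<close>

lemma wcomp_operator:
  assumes "wcomp_bound K w \<tau>"
  obtains T where "T \<in> bounded_operators" "represents T (wcomp w \<tau>)" "norm T \<le> sqrt K"
proof -
  define T where "T = (\<lambda>F. L2_of (wcomp w \<tau> (rep_L2 F)))"
  have T: "T (L2_of f) = L2_of (wcomp w \<tau> f)" if "sq_integrable f" for f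
    using that rep_L2[of "L2_of f"] assms unfolding T_def
    by (subst L2_of_eq_iff) (auto intro!: sq_integrable_wcomp wcomp_AE_eq simp: L2_of_eq_iff[symmetric])
  have bl: "bounded_linear T"
  proof (rule bounded_linear_intro[where K = "sqrt K"])
    fix F G :: L2 and r :: real
    obtain f where f: "sq_integrable f" "F = L2_of f" by (rule L2_cases)
    obtain g where g: "sq_integrable g" "G = L2_of g" by (rule L2_cases)
    show "T (F + G) = T F + T G"
      using f g assms
      by (simp add: T L2_of_add sq_integrable_add sq_integrable_wcomp) (simp add: wcomp_def algebra_simps)
    show "T (r *\<^sub>R F) = r *\<^sub>R T F"
      using f assms
      by (simp add: T L2_of_scaleR sq_integrable_cmult sq_integrable_wcomp) (simp add: wcomp_def algebra_simps)
    show "norm (T F) \<le> norm F * sqrt K"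
      using f assms by (simp add: T norm_L2_of_wcomp)
  qed
  have ap: "blinfun_apply (Blinfun T) = T" by (rule bounded_linear_Blinfun_apply[OF bl])
  have "T (scaleC_L2 c F) = scaleC_L2 c (T F)" for c F
  proof -
    obtain f where f: "sq_integrable f" "F = L2_of f" by (rule L2_cases)
    then show ?thesis
      using assms
      by (simp add: T L2_of_scaleC sq_integrable_cmult sq_integrable_wcomp) (simp add: wcomp_def algebra_simps)
  qed
  then have "Blinfun T \<in> bounded_operators"
    by (simp add: bounded_operators_def ap)
  moreover have "represents (Blinfun T) (wcomp w \<tau>)"
    using assms by (auto simp: represents_def ap T intro: sq_integrable_wcomp)
  moreover have "norm (Blinfun T) \<le> sqrt K"
  proof (rule norm_blinfun_bound)
    show "0 \<le> sqrt K" using assms by (simp add: wcomp_bound_def)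
    fix F
    obtain f where f: "sq_integrable f" "F = L2_of f" by (rule L2_cases)
    then show "norm (blinfun_apply (Blinfun T) F) \<le> sqrt K * norm F"
      using norm_L2_of_wcomp[OF assms f(1)] by (simp add: ap T mult.commute)
  qed
  ultimately show thesis by (rule that)
qed

section \<open>Bounded multiplication operators\<close>

definition bmeas :: "(real \<Rightarrow> complex) \<Rightarrow> bool" where
  "bmeas g \<longleftrightarrow> g \<in> borel_measurable borel \<and> bounded (range g)"

lemma bmeas_measurable [measurable_dest]: "bmeas g \<Longrightarrow> g \<in> borel_measurable borel"
  by (simp add: bmeas_def)

lemma bmeasI: "g \<in> borel_measurable borel \<Longrightarrow> (\<And>t. cmod (g t) \<le> K) \<Longrightarrow> bmeas g"
  by (auto simp: bmeas_def bounded_iff)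

lemma bmeasE:
  assumes "bmeas g"
  obtains K where "g \<in> borel_measurable borel" "0 \<le> K" "\<And>t. cmod (g t) \<le> K"
  using assms unfolding bmeas_def bounded_iff by (metis norm_ge_zero order_trans rangeI)

lemma wcomp_bound_mult:
  assumes "g \<in> borel_measurable borel" "\<And>t. cmod (g t) \<le> K"
  shows "wcomp_bound (K\<^sup>2) g (\<lambda>t. t)"
  unfolding wcomp_bound_def
proof (intro conjI allI impI)
  fix h :: "real \<Rightarrow> ennreal" assume [measurable]: "h \<in> borel_measurable borel"
  have "(\<integral>\<^sup>+t. ennreal ((cmod (g t))\<^sup>2) * h t \<partial>lborel) \<le> (\<integral>\<^sup>+t. ennreal (K\<^sup>2) * h t \<partial>lborel)"
    using assms by (intro nn_integral_mono mult_right_mono ennreal_leI power_mono) auto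
  then show "(\<integral>\<^sup>+t. ennreal ((cmod (g t))\<^sup>2) * h t \<partial>lborel) \<le> ennreal (K\<^sup>2) * (\<integral>\<^sup>+t. h t \<partial>lborel)"
    by (simp add: nn_integral_cmult)
qed (use assms in auto)

lemma mult_op_bounded:
  assumes "g \<in> borel_measurable borel" "\<And>t. cmod (g t) \<le> K"
  shows "mult_op g \<in> bounded_operators" "represents (mult_op g) (\<lambda>f t. g t * f t)"
    "norm (mult_op g) \<le> K"
proof -
  have "0 \<le> K" using assms(2)[of 0] norm_ge_zero order_trans by blast
  moreover obtain T where T: "T \<in> bounded_operators" "represents T (wcomp g (\<lambda>t. t))" "norm T \<le> sqrt (K\<^sup>2)"
    by (rule wcomp_operator[OF wcomp_bound_mult[OF assms]])
  moreover have "wcomp g (\<lambda>t. t) = (\<lambda>f t. g t * f t)" by (simp add: wcomp_def fun_eq_iff)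
  ultimately show "mult_op g \<in> bounded_operators" "represents (mult_op g) (\<lambda>f t. g t * f t)"
    "norm (mult_op g) \<le> K"
    unfolding mult_op_def by (auto simp: represents_op_of)
qed

lemma represents_mult_op: "bmeas g \<Longrightarrow> represents (mult_op g) (\<lambda>f t. g t * f t)"
  by (erule bmeasE, rule mult_op_bounded)

lemma mult_op_bounded_operators: "bmeas g \<Longrightarrow> mult_op g \<in> bounded_operators"
  by (erule bmeasE, rule mult_op_bounded)

lemma mult_op_eqI:
  "represents T (\<lambda>f t. g t * f t) \<Longrightarrow> T = mult_op g"
  unfolding mult_op_def by (simp add: represents_op_of)

lemma bmeas_cnj: "bmeas g \<Longrightarrow> bmeas (\<lambda>t. cnj (g t))"
  by (elim bmeasE, rule bmeasI) (auto intro: borel_measurable_cnj)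

lemma mult_op_add:
  assumes "bmeas f" "bmeas g" shows "mult_op f + mult_op g = mult_op (\<lambda>t. f t + g t)"
proof (rule mult_op_eqI)
  have "sq_integrable (\<lambda>t. f t * h t)" "sq_integrable (\<lambda>t. g t * h t)" if "sq_integrable h" for h
    using that represents_mult_op[OF assms(1)] represents_mult_op[OF assms(2)] by (auto simp: represents_def)
  then show "represents (mult_op f + mult_op g) (\<lambda>h t. (f t + g t) * h t)"
    using represents_mult_op[OF assms(1)] represents_mult_op[OF assms(2)]
    by (auto simp: represents_def plus_blinfun.rep_eq L2_of_add ring_distribs sq_integrable_add)
qed

lemma mult_op_compose:
  assumes "bmeas f" "bmeas g" shows "mult_op f o\<^sub>L mult_op g = mult_op (\<lambda>t. f t * g t)"
  by (rule mult_op_eqI)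
    (use represents_compose[OF represents_mult_op[OF assms(1)] represents_mult_op[OF assms(2)]]
      in \<open>simp add: mult.assoc\<close>)

lemma mult_op_scaleC:
  assumes "bmeas g" shows "scaleC_op c (mult_op g) = mult_op (\<lambda>t. c * g t)"
proof (rule mult_op_eqI)
  show "represents (scaleC_op c (mult_op g)) (\<lambda>h t. c * g t * h t)"
    using represents_mult_op[OF assms] sq_integrable_cmult[where c = c]
    by (auto simp: represents_def scaleC_op_def bounded_linear_Blinfun_apply[OF bounded_linear_scaleC_L2]
      L2_of_scaleC mult.assoc)
qed

lemma mult_op_zero: "mult_op (\<lambda>t. 0) = 0"
  by (rule mult_op_eqI[symmetric]) (auto simp: represents_def zero_L2.abs_eq sq_integrable_zero)

text \<open>Since \<open>adj\<close> is a definite description, it is computed by exhibiting a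
  candidate and checking the integral identity on representatives.\<close>

lemma adj_represents:
  assumes "represents T \<Phi>" "represents S \<Psi>"
    and "\<And>f g. sq_integrable f \<Longrightarrow> sq_integrable g \<Longrightarrow>
      (\<integral>t. \<Phi> f t * cnj (g t) \<partial>lborel) = (\<integral>t. f t * cnj (\<Psi> g t) \<partial>lborel)"
  shows "adj T = S"
proof (rule adj_eqI)
  fix F G
  obtain f where f: "sq_integrable f" "F = L2_of f" by (rule L2_cases)
  obtain g where g: "sq_integrable g" "G = L2_of g" by (rule L2_cases)
  show "cinner_L2 (blinfun_apply T F) G = cinner_L2 F (blinfun_apply S G)"
    using f g assms by (simp add: represents_def cinner_L2_of)
qed

lemma adj_mult_op: assumes "bmeas g" shows "adj (mult_op g) = mult_op (\<lambda>t. cnj (g t))"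
  by (rule adj_represents[OF represents_mult_op[OF assms] represents_mult_op[OF bmeas_cnj[OF assms]]])
    (simp add: ac_simps)

text \<open>The operator is tested on the indicator of a piece of \<open>A\<close>, whose norm it
  enlarges at least by the factor \<open>c\<close>.\<close>

lemma norm_mult_op_ge:
  assumes "bmeas g" and [measurable]: "A \<in> sets borel" and "emeasure lborel A \<noteq> 0"
    and "\<And>t. t \<in> A \<Longrightarrow> c \<le> cmod (g t)" "0 \<le> c"
  shows "c \<le> norm (mult_op g)"
proof -
  note [measurable] = bmeas_measurable[OF assms(1)]
  \<comment> \<open>\<open>A\<close> may have infinite measure. Some bounded window still carries
    positive measure, as countably many null pieces cannot make up \<open>A\<close>.\<close>
  obtain n :: nat where n: "emeasure lborel (A \<inter> {-real n..real n}) \<noteq> 0"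
  proof (rule ccontr)
    assume "\<not> thesis"
    then have "A \<inter> {-real n..real n} \<in> null_sets lborel" for n using that by (auto simp: null_sets_def)
    then have "(\<Union>n. A \<inter> {-real n..real n}) \<in> null_sets lborel" by (rule null_sets_UN)
    moreover have "(\<Union>n. A \<inter> {-real n..real n}) = A"
    proof -
      have "\<exists>n. - real n \<le> x \<and> x \<le> real n" for x
        using real_arch_simple[of "\<bar>x\<bar>"] by (auto simp: abs_le_iff minus_le_iff)
      then show ?thesis by auto
    qed
    ultimately show False using assms(3) by (auto simp: null_sets_def)
  qed
  define f :: "real \<Rightarrow> complex" where "f = indicator (A \<inter> {-real n..real n})"
  have nnf: "(\<integral>\<^sup>+t. ennreal ((cmod (f t))\<^sup>2) \<partial>lborel) = emeasure lborel (A \<inter> {-real n..real n})"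
  proof -
    have "ennreal ((cmod (f t))\<^sup>2) = indicator (A \<inter> {-real n..real n}) t" for t
      by (simp add: f_def indicator_def)
    then show ?thesis by simp
  qed
  have "emeasure lborel (A \<inter> {-real n..real n}) < \<infinity>"
    by (rule le_less_trans[OF emeasure_mono[of _ "{-real n..real n}"]]) auto
  moreover have "f \<in> borel_measurable borel"
    unfolding f_def by measurable
  ultimately have f: "sq_integrable f"
    by (simp add: sq_integrable_iff nnf)
  have pos: "norm (L2_of f) > 0"
    using norm_L2_of[OF f] n nnf by auto
  have gf: "sq_integrable (\<lambda>t. g t * f t)" and ap: "blinfun_apply (mult_op g) (L2_of f) = L2_of (\<lambda>t. g t * f t)"
    using f represents_mult_op[OF assms(1)] by (auto simp: represents_def)
  have "ennreal ((c * norm (L2_of f))\<^sup>2) = (\<integral>\<^sup>+t. ennreal (c\<^sup>2) * ennreal ((cmod (f t))\<^sup>2) \<partial>lborel)"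
    using f by (subst nn_integral_cmult) (auto simp: norm_L2_of[symmetric] power_mult_distrib ennreal_mult' sq_integrable_def)
  also have "\<dots> \<le> (\<integral>\<^sup>+t. ennreal ((cmod (g t * f t))\<^sup>2) \<partial>lborel)"
  proof (rule nn_integral_mono)
    fix t
    have "c\<^sup>2 * (cmod (f t))\<^sup>2 \<le> (cmod (g t * f t))\<^sup>2"
      using power_mono[OF assms(4), of t 2] assms(5) by (auto simp: f_def indicator_def)
    then show "ennreal (c\<^sup>2) * ennreal ((cmod (f t))\<^sup>2) \<le> ennreal ((cmod (g t * f t))\<^sup>2)"
      by (simp add: ennreal_mult'[symmetric])
  qed
  also have "\<dots> = ennreal ((norm (L2_of (\<lambda>t. g t * f t)))\<^sup>2)"
    using gf by (simp add: norm_L2_of)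
  finally have "(c * norm (L2_of f))\<^sup>2 \<le> (norm (L2_of (\<lambda>t. g t * f t)))\<^sup>2"
    by simp
  then have "c * norm (L2_of f) \<le> norm (L2_of (\<lambda>t. g t * f t))"
    by (rule power2_le_imp_le) simp
  also have "\<dots> \<le> norm (mult_op g) * norm (L2_of f)"
    using norm_blinfun[of "mult_op g" "L2_of f"] by (simp add: ap)
  finally show ?thesis using pos by simp
qed

context logistic_parameter
begin

section \<open>The operator \<open>U\<close> and its adjoint\<close>

definition root_weight :: "real \<Rightarrow> complex" where
  "root_weight t = complex_of_real (sqrt (weight t))"

text \<open>The square root of the Jacobian of \<open>\<beta>\<close> over the range of
  \<open>\<gamma>\<close>. Where \<open>\<beta> s\<close> is the midpoint of a cell, division by
  zero gives the value 0.\<close>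

definition dual_weight :: "real \<Rightarrow> complex" where
  "dual_weight s = (if frac s \<le> \<mu> then 1 / root_weight (\<beta> s) else 0)"

lemma borel_measurable_root_weight [measurable]: "root_weight \<in> borel_measurable borel"
  unfolding root_weight_def[abs_def] by measurable

lemma borel_measurable_dual_weight [measurable]: "dual_weight \<in> borel_measurable borel"
  unfolding dual_weight_def[abs_def] by measurable

lemma cmod_root_weight: "(cmod (root_weight t))\<^sup>2 = weight t"
  by (simp add: root_weight_def weight_nonneg)

lemma root_weight_eq_0_iff: "root_weight t = 0 \<longleftrightarrow> frac t = 1/2"
  using mu_pos by (auto simp: root_weight_def weight_def)

text \<open>Changing variables leaves only the mass over \<open>{x. frac x \<le> \<mu>}\<close>, so
  \<open>U\<close> is a contraction.\<close>

lemma wcomp_bound_U: "wcomp_bound 1 root_weight \<gamma>"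
  unfolding wcomp_bound_def
proof (intro conjI allI impI)
  fix h :: "real \<Rightarrow> ennreal" assume [measurable]: "h \<in> borel_measurable borel"
  have "(\<integral>\<^sup>+t. ennreal ((cmod (root_weight t))\<^sup>2) * h (\<gamma> t) \<partial>lborel)
      = (\<integral>\<^sup>+x. indicator {x. frac x \<le> \<mu>} x * h x \<partial>lborel)"
    unfolding cmod_root_weight by (rule nn_integral_gam) simp
  also have "\<dots> \<le> (\<integral>\<^sup>+x. h x \<partial>lborel)"
    by (intro nn_integral_mono) (auto simp: indicator_def)
  finally show "(\<integral>\<^sup>+t. ennreal ((cmod (root_weight t))\<^sup>2) * h (\<gamma> t) \<partial>lborel) \<le> ennreal 1 * (\<integral>\<^sup>+t. h t \<partial>lborel)"
    by simp
qed auto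

lemma wcomp_bound_adj_U: "wcomp_bound 1 dual_weight \<beta>"
  unfolding wcomp_bound_def
proof (intro conjI allI impI)
  fix h :: "real \<Rightarrow> ennreal" assume [measurable]: "h \<in> borel_measurable borel"
  have "(\<integral>\<^sup>+t. ennreal ((cmod (dual_weight t))\<^sup>2) * h (\<beta> t) \<partial>lborel)
      = (\<integral>\<^sup>+x. indicator {x. frac x \<le> \<mu>} x * (ennreal (1 / weight (\<beta> x)) * h (\<beta> x)) \<partial>lborel)"
    by (intro nn_integral_cong)
      (auto simp: dual_weight_def norm_divide power_divide cmod_root_weight indicator_def)
  also have "\<dots> = (\<integral>\<^sup>+t. weight t * (ennreal (1 / weight t) * h t) \<partial>lborel)"
    by (subst nn_integral_gam[symmetric]) (simp_all add: beta_gam)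
  also have "\<dots> \<le> (\<integral>\<^sup>+x. h x \<partial>lborel)"
  proof (intro nn_integral_mono)
    fix t
    \<comment> \<open>At midpoints \<open>weight t\<close> and \<open>1 / weight t\<close> are both
      0, so the product drops from 1 to 0.\<close>
    have "ennreal (weight t) * ennreal (1 / weight t) \<le> 1"
      by (cases "weight t = 0") (auto simp: ennreal_mult'[symmetric] weight_nonneg)
    then show "ennreal (weight t) * (ennreal (1 / weight t) * h t) \<le> h t"
      using mult_right_mono[of "ennreal (weight t) * ennreal (1 / weight t)" 1 "h t"] by (simp add: mult.assoc)
  qed
  finally show "(\<integral>\<^sup>+t. ennreal ((cmod (dual_weight t))\<^sup>2) * h (\<beta> t) \<partial>lborel) \<le> ennreal 1 * (\<integral>\<^sup>+t. h t \<partial>lborel)"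
    by simp
qed auto

lemma represents_U: "represents (U_op \<mu>) (wcomp root_weight \<gamma>)"
proof -
  obtain T where T: "represents T (wcomp root_weight \<gamma>)"
    by (rule wcomp_operator[OF wcomp_bound_U])
  have "represents T (\<lambda>f t. complex_of_real (sqrt \<bar>deriv \<gamma> t\<bar>) * f (\<gamma> t))"
  proof (rule represents_cong[OF T])
    fix f :: "real \<Rightarrow> complex" assume "sq_integrable f"
    then have [measurable]: "f \<in> borel_measurable borel" by (simp add: sq_integrable_def)
    show "AE t in lborel. wcomp root_weight \<gamma> f t = complex_of_real (sqrt \<bar>deriv \<gamma> t\<bar>) * f (\<gamma> t)"
      using AE_deriv_gam by eventually_elim (simp add: wcomp_def root_weight_def)
    \<comment> \<open>For measurability with \<open>deriv\<close> in place of \<open>weight\<close>: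
      the two differ at most on a countable set, named \<open>C\<close> below, whatever values
      \<open>deriv\<close> takes there.\<close>
    have *: "(\<lambda>t. complex_of_real (sqrt \<bar>deriv \<gamma> t\<bar>) * f (\<gamma> t)) =
       (\<lambda>t. if frac t = 0 \<or> frac t = 1/2 then complex_of_real (sqrt \<bar>deriv \<gamma> t\<bar>) * f (\<gamma> t)
         else root_weight t * f (\<gamma> t))"
      by (auto simp: fun_eq_iff deriv_gam root_weight_def)
    define C :: "real set" where "C = (\<Union>k::int. {of_int k, of_int k + 1/2})"
    have C: "frac t = 0 \<or> frac t = 1/2 \<longleftrightarrow> t \<in> C" for t
    proof
      assume "frac t = 0 \<or> frac t = 1/2"
      then show "t \<in> C" by (auto simp: C_def frac_def intro!: exI[of _ "\<lfloor>t\<rfloor>"])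
    next
      assume "t \<in> C"
      then obtain k :: int where "t = of_int k \<or> t = of_int k + 1/2" by (auto simp: C_def)
      then have "\<lfloor>t\<rfloor> = k" by (auto simp: floor_eq_iff)
      then show "frac t = 0 \<or> frac t = 1/2"
        using \<open>t = of_int k \<or> t = of_int k + 1/2\<close> by (auto simp: frac_def)
    qed
    have "countable C" unfolding C_def by auto
    then show "(\<lambda>t. complex_of_real (sqrt \<bar>deriv \<gamma> t\<bar>) * f (\<gamma> t)) \<in> borel_measurable borel"
      unfolding * C
      by (rule measurable_discrete_difference[where X = C and f = "\<lambda>t. root_weight t * f (\<gamma> t)", rotated]) simp_all
  qed
  then show ?thesis
    using T unfolding U_op_def by (simp add: represents_op_of)
qed

definition V_op :: L2_op where
  "V_op = op_of (wcomp dual_weight \<beta>)"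

lemma represents_V: "represents V_op (wcomp dual_weight \<beta>)"
proof -
  obtain T where "represents T (wcomp dual_weight \<beta>)"
    by (rule wcomp_operator[OF wcomp_bound_adj_U])
  then show ?thesis
    unfolding V_op_def by (simp add: represents_op_of)
qed

lemma integral_gam:
  fixes h :: "real \<Rightarrow> complex"
  assumes [measurable]: "h \<in> borel_measurable borel"
  shows "(\<integral>t. weight t *\<^sub>R h (\<gamma> t) \<partial>lborel) = (\<integral>x. indicator {x. frac x \<le> \<mu>} x *\<^sub>R h x \<partial>lborel)"
proof -
  have "(\<integral>t. weight t *\<^sub>R h (\<gamma> t) \<partial>lborel) = (\<integral>t. h (\<gamma> t) \<partial>density lborel (\<lambda>t. ennreal (weight t)))"
    by (subst integral_density) (auto simp: weight_nonneg)
  also have "\<dots> = (\<integral>x. h x \<partial>distr (density lborel weight) borel \<gamma>)"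
    by (subst integral_distr) auto
  also have "\<dots> = (\<integral>x. h x \<partial>density lborel (\<lambda>x. ennreal (indicator {x. frac x \<le> \<mu>} x)))"
    unfolding distr_gam by (intro arg_cong[where f = "\<lambda>M. integral\<^sup>L M h"]) (simp add: ennreal_indicator)
  also have "\<dots> = (\<integral>x. indicator {x. frac x \<le> \<mu>} x *\<^sub>R h x \<partial>lborel)"
    by (subst integral_density) auto
  finally show ?thesis .
qed

lemma adj_U: "adj (U_op \<mu>) = V_op"
proof (rule adj_represents[OF represents_U represents_V])
  fix f g :: "real \<Rightarrow> complex" assume "sq_integrable f" "sq_integrable g"
  then have [measurable]: "f \<in> borel_measurable borel" "g \<in> borel_measurable borel"
    "(\<lambda>t. cnj (g (\<beta> t))) \<in> borel_measurable borel"
    by (auto simp: sq_integrable_def intro!: borel_measurable_cnj)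
  \<comment> \<open>Chosen so that the two inner products become the two sides of
    \<open>integral_gam\<close>: \<open>beta_gam\<close> turns
    \<open>g (\<beta> (\<gamma> t))\<close> into \<open>g t\<close>, and the quotient cancels one of
    the two root factors in the full weight.\<close>
  define h where "h = (\<lambda>y. f y * cnj (g (\<beta> y)) / root_weight (\<beta> y))"
  have [measurable]: "h \<in> borel_measurable borel"
    unfolding h_def by measurable
  have "wcomp root_weight \<gamma> f t * cnj (g t) = weight t *\<^sub>R h (\<gamma> t)" for t
  proof -
    have "root_weight t * root_weight t = complex_of_real (weight t)"
      by (simp add: root_weight_def weight_nonneg flip: of_real_mult)
    then show ?thesis
      by (cases "root_weight t = 0")
        (auto simp: h_def beta_gam wcomp_def scaleR_conv_of_real field_simps)
  qed
  moreover have "indicator {x. frac x \<le> \<mu>} t *\<^sub>R h t = f t * cnj (wcomp dual_weight \<beta> g t)" for t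
    by (auto simp: h_def wcomp_def dual_weight_def indicator_def root_weight_def)
  ultimately show "(\<integral>t. wcomp root_weight \<gamma> f t * cnj (g t) \<partial>lborel) = (\<integral>t. f t * cnj (wcomp dual_weight \<beta> g t) \<partial>lborel)"
    using integral_gam[of h] by simp
qed

lemma bmeas_beta:
  assumes "bmeas g" shows "bmeas (\<lambda>s. if frac s \<le> \<mu> then g (\<beta> s) else 0)"
proof (rule bmeasE[OF assms])
  fix K assume [measurable]: "g \<in> borel_measurable borel" and K: "0 \<le> K" "\<And>t. cmod (g t) \<le> K"
  show ?thesis
  proof (rule bmeasI)
    show "cmod (if frac s \<le> \<mu> then g (\<beta> s) else 0) \<le> K" for s
      using K by simp
  qed measurable
qed

lemma bmeas_gam:
  assumes "bmeas g" shows "bmeas (\<lambda>s. g (\<gamma> s))"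
proof (rule bmeasE[OF assms])
  fix K assume "g \<in> borel_measurable borel" "\<And>t. cmod (g t) \<le> K"
  then show ?thesis
    by (intro bmeasI[of _ K] measurable_compose[OF borel_measurable_gam])
qed

text \<open>The two root weights cancel and \<open>\<gamma> (\<beta> s) = s\<close>, except where
  \<open>frac s\<close> is 0 or \<open>\<mu>\<close>. The cut-off reflects that
  \<open>\<beta>\<close> inverts \<open>\<gamma>\<close> only over the range of
  \<open>\<gamma>\<close>.\<close>

lemma V_mult_op_U:
  assumes "bmeas g"
  shows "V_op o\<^sub>L mult_op g o\<^sub>L U_op \<mu> = mult_op (\<lambda>s. if frac s \<le> \<mu> then g (\<beta> s) else 0)"
proof (rule represents_unique)
  show "represents (V_op o\<^sub>L mult_op g o\<^sub>L U_op \<mu>)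
      (\<lambda>f. wcomp dual_weight \<beta> (\<lambda>t. g t * wcomp root_weight \<gamma> f t))"
    by (rule represents_compose[OF represents_compose[OF represents_V represents_mult_op[OF assms]] represents_U])
  show "represents (mult_op (\<lambda>s. if frac s \<le> \<mu> then g (\<beta> s) else 0))
      (\<lambda>f s. (if frac s \<le> \<mu> then g (\<beta> s) else 0) * f s)"
    by (rule represents_mult_op[OF bmeas_beta[OF assms]])
  fix f :: "real \<Rightarrow> complex"
  show "AE s in lborel. wcomp dual_weight \<beta> (\<lambda>t. g t * wcomp root_weight \<gamma> f t) s
      = (if frac s \<le> \<mu> then g (\<beta> s) else 0) * f s"
    using AE_frac_noteq[of 0] AE_frac_noteq[of \<mu>]
  proof eventually_elim
    case (elim s)
    show ?case
    proof (cases "frac s \<le> \<mu>")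
      case True
      then have "\<gamma> (\<beta> s) = s" using elim by (intro gam_beta) auto
      moreover have "root_weight (\<beta> s) \<noteq> 0"
      proof
        assume "root_weight (\<beta> s) = 0"
        then have "\<alpha> (1/2) = frac s"
          using logistic_frac_beta[OF True] unfolding root_weight_eq_0_iff by metis
        then show False using elim by (simp add: logistic_def)
      qed
      ultimately show ?thesis using True by (simp add: wcomp_def dual_weight_def)
    qed (simp add: wcomp_def dual_weight_def)
  qed
qed

text \<open>There is no cut-off, since \<open>\<gamma> t\<close> always has fractional part at most
  \<open>\<mu>\<close>. This formula governs \<open>alpha_tilde\<close>.\<close>

lemma U_mult_op_V:
  assumes "bmeas g"
  shows "U_op \<mu> o\<^sub>L mult_op g o\<^sub>L V_op = mult_op (\<lambda>t. g (\<gamma> t))"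
proof (rule represents_unique)
  show "represents (U_op \<mu> o\<^sub>L mult_op g o\<^sub>L V_op)
      (\<lambda>f. wcomp root_weight \<gamma> (\<lambda>t. g t * wcomp dual_weight \<beta> f t))"
    by (rule represents_compose[OF represents_compose[OF represents_U represents_mult_op[OF assms]] represents_V])
  show "represents (mult_op (\<lambda>t. g (\<gamma> t))) (\<lambda>f t. g (\<gamma> t) * f t)"
    by (rule represents_mult_op[OF bmeas_gam[OF assms]])
  fix f :: "real \<Rightarrow> complex"
  show "AE t in lborel. wcomp root_weight \<gamma> (\<lambda>t. g t * wcomp dual_weight \<beta> f t) t = g (\<gamma> t) * f t"
    using AE_frac_noteq[of "1/2"]
    by eventually_elim
      (simp add: wcomp_def dual_weight_def frac_gam logistic_le_mu beta_gam root_weight_eq_0_iff)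
qed

text \<open>\<open>op_power\<close> adds its new factor on the left, as wanted for the adjoint; for
  \<open>U\<close> the factor has to be commuted to the right.\<close>

lemma conj_U_Suc: "conj_U \<mu> (Suc n) T = V_op o\<^sub>L conj_U \<mu> n T o\<^sub>L U_op \<mu>"
  by (simp add: conj_U_def adj_U op_power_commute[of "U_op \<mu>"] blinfun_compose_assoc)

lemma conj_U_0: "conj_U \<mu> 0 T = T"
  by (rule blinfun_eqI) (simp add: conj_U_def)

section \<open>Backward orbits\<close>

text \<open>The backward orbit of \<open>frac s\<close> under \<open>\<alpha>\<close>, along the branches selected by \<open>s\<close>;
  the value \<open>-1\<close> stands for the zero functional.\<close>

primrec back_coord :: "nat \<Rightarrow> real \<Rightarrow> real" where
  "back_coord 0 = frac"
| "back_coord (Suc n) = (\<lambda>s. if frac s \<le> \<mu> then back_coord n (\<beta> s) else -1)"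

definition back_orbit :: "real \<Rightarrow> nat \<Rightarrow> real" where
  "back_orbit s = (\<lambda>n. back_coord n s)"

lemma borel_measurable_back_coord [measurable]: "back_coord n \<in> borel_measurable borel"
  by (induct n) simp_all

lemma borel_measurable_back_orbit [measurable]: "back_orbit \<in> borel_measurable borel"
  by (rule measurable_coordinatewise_then_product) (simp add: back_orbit_def)

lemma back_coord_unit: "back_coord n s \<in> {0..<1} \<union> {-1}"
  by (induct n arbitrary: s) (auto simp: frac_lt_1)

lemma back_coord_gam: "back_coord (Suc n) (\<gamma> t) = back_coord n t"
  by (simp add: frac_gam logistic_le_mu beta_gam)

text \<open>Conjugation precomposes with \<open>\<beta>\<close> and cuts off, which is exactly the
  recursion of \<open>back_coord\<close>, starting from \<open>frac\<close> at index 0. Both claims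
  share one induction because \<open>V_mult_op_U\<close> needs the boundedness at stage
  \<open>n\<close>.\<close>

lemma conj_U_mult_op:
  assumes "bmeas (\<lambda>t. G (frac t))"
  shows "conj_U \<mu> n (mult_op (\<lambda>t. G (frac t)))
      = mult_op (\<lambda>s. if back_coord n s = -1 then 0 else G (back_coord n s))"
    and "bmeas (\<lambda>s. if back_coord n s = -1 then 0 else G (back_coord n s))"
proof (induct n)
  case 0
  have "frac s \<noteq> -1" for s :: real using frac_ge_0[of s] by linarith
  with assms show "conj_U \<mu> 0 (mult_op (\<lambda>t. G (frac t)))
      = mult_op (\<lambda>s. if back_coord 0 s = -1 then 0 else G (back_coord 0 s))"
    and "bmeas (\<lambda>s. if back_coord 0 s = -1 then 0 else G (back_coord 0 s))"
    by (simp_all add: conj_U_0)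
next
  case (Suc n)
  have "(\<lambda>s. if back_coord (Suc n) s = -1 then 0 else G (back_coord (Suc n) s))
    = (\<lambda>s. if frac s \<le> \<mu> then if back_coord n (\<beta> s) = -1 then 0 else G (back_coord n (\<beta> s)) else 0)"
    by (auto simp: fun_eq_iff)
  with V_mult_op_U[OF Suc(2)] bmeas_beta[OF Suc(2)] Suc(1)
  show "conj_U \<mu> (Suc n) (mult_op (\<lambda>t. G (frac t)))
      = mult_op (\<lambda>s. if back_coord (Suc n) s = -1 then 0 else G (back_coord (Suc n) s))"
    and "bmeas (\<lambda>s. if back_coord (Suc n) s = -1 then 0 else G (back_coord (Suc n) s))"
    by (simp_all only: conj_U_Suc)
qed

section \<open>Iterates of the logistic map\<close>

lemma funpow_logistic_unit: "x \<in> {0..1} \<Longrightarrow> (\<alpha> ^^ n) x \<in> {0..1}"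
  by (induct n) (simp_all add: logistic_unit del: atLeastAtMost_iff)

lemma continuous_on_funpow_logistic [continuous_intros]:
  "continuous_on A f \<Longrightarrow> continuous_on A (\<lambda>x. (\<alpha> ^^ n) (f x))"
  by (induct n) (simp_all add: continuous_on_logistic)

lemma logistic_IVT:
  assumes "\<alpha> a \<le> z" "z \<le> \<alpha> b" "0 \<le> a" "a \<le> b" "b \<le> 1"
  obtains y where "a \<le> y" "y \<le> b" "\<alpha> y = z"
  using IVT'[of \<alpha> a z b] assms continuous_on_logistic[OF continuous_on_id, of "{a..b}"] by auto

text \<open>For \<open>\<mu> > 1/2\<close> the map \<open>\<alpha>\<close> expands \<open>[0, 1/2]\<close> at least by the factor \<open>2\<mu>\<close> away from \<open>0\<close>,
  so the images of \<open>[0, c]\<close> grow until they cover \<open>[0, 1/2]\<close>.\<close>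

lemma funpow_logistic_covers_half:
  assumes "1/2 < \<mu>" "0 \<le> c" "0 \<le> z" "z \<le> 1/2" "z \<le> (2 * \<mu>) ^ n * c"
  shows "\<exists>y\<in>{0..c}. (\<alpha> ^^ n) y = z"
  using assms(3-5)
proof (induct n arbitrary: z)
  case 0
  then show ?case using assms(2) by auto
next
  case (Suc n)
  have "\<alpha> 0 \<le> z" "z \<le> \<alpha> (1/2)" using Suc assms(1) by (auto simp: logistic_def)
  then obtain w where w: "0 \<le> w" "w \<le> 1/2" "\<alpha> w = z"
    using logistic_IVT[of 0 z "1/2"] by auto
  have "2 * \<mu> * w \<le> z"
  proof -
    have "0 \<le> 2 * \<mu> * w * (1 - 2 * w)" using w mu_pos by simp
    also have "\<dots> = \<alpha> w - 2 * \<mu> * w" by (simp add: logistic_def algebra_simps)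
    finally show ?thesis using w by simp
  qed
  also have "z \<le> 2 * \<mu> * ((2 * \<mu>) ^ n * c)" using Suc by (simp add: mult.assoc)
  finally have "w \<le> (2 * \<mu>) ^ n * c" using mu_pos by simp
  then obtain y where "y \<in> {0..c}" "(\<alpha> ^^ n) y = w" using Suc(1)[of w] w by auto
  then show ?case using w by auto
qed

text \<open>For \<open>\<mu> \<le> 1/2\<close>, reflection in 1/2 takes the points below 1/2 into
  \<open>{\<mu>..1}\<close>. For larger \<open>\<mu>\<close>, the interval \<open>{\<mu>..1}\<close>
  is mapped onto \<open>[0, \<alpha> \<mu>]\<close>, whose iterated images come to cover
  \<open>[0, 1/2]\<close>, and the latter has the same image under \<open>\<alpha>\<close> as the
  whole unit interval.\<close>

lemma funpow_logistic_eventually_onto: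
  obtains n where "\<And>x. x \<in> {0..1} \<Longrightarrow> \<exists>y\<in>{\<mu>..1}. (\<alpha> ^^ n) y = (\<alpha> ^^ n) x"
proof (cases "\<mu> \<le> 1/2")
  case True
  have "\<exists>y\<in>{\<mu>..1}. (\<alpha> ^^ 1) y = (\<alpha> ^^ 1) x" if "x \<in> {0..1}" for x
  proof (cases "x \<ge> 1/2")
    case False
    then show ?thesis using True that
      by (intro bexI[of _ "1 - x"]) (auto simp: logistic_def algebra_simps)
  qed (use True that in \<open>auto intro!: bexI[of _ x]\<close>)
  then show thesis by (rule that)
next
  case False
  define c where "c = \<alpha> \<mu>"
  have c: "0 < c" using mu_pos mu_less_1 by (simp add: c_def logistic_def)
  obtain n where n: "1 / (2 * c) < (2 * \<mu>) ^ n"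
    using real_arch_pow[of "2 * \<mu>" "1 / (2 * c)"] False by auto
  \<comment> \<open>Two iterations beyond \<open>n\<close>: the first leads from
    \<open>{\<mu>..1}\<close> to \<open>[0, c]\<close>, the last from \<open>[0, 1/2]\<close> to
    \<open>[0, \<mu>]\<close>.\<close>
  have "\<exists>y\<in>{\<mu>..1}. (\<alpha> ^^ (n + 2)) y = (\<alpha> ^^ (n + 2)) x" if x: "x \<in> {0..1}" for x
  proof -
    define z where "z = (\<alpha> ^^ (n + 2)) x"
    have "z = \<alpha> ((\<alpha> ^^ (n + 1)) x)" by (simp add: z_def)
    then have z: "0 \<le> z" "z \<le> \<mu>"
      using logistic_nonneg[OF funpow_logistic_unit[OF x, of "n + 1"]] logistic_le_mu by auto
    then obtain w where w: "0 \<le> w" "w \<le> 1/2" "\<alpha> w = z"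
      using logistic_IVT[of 0 z "1/2"] by (auto simp: logistic_def)
    have "w \<le> (2 * \<mu>) ^ n * c"
    proof -
      have "1/2 < (2 * \<mu>) ^ n * c" using n c by (simp add: field_simps)
      then show ?thesis using w by simp
    qed
    then obtain v where v: "0 \<le> v" "v \<le> c" "(\<alpha> ^^ n) v = w"
      using funpow_logistic_covers_half[of c w n] w c False by auto
    have "\<exists>y\<ge>\<mu>. y \<le> 1 \<and> \<alpha> y = v"
      by (rule IVT2') (use v mu_less_1 in \<open>auto simp: c_def logistic_def intro!: continuous_intros\<close>)
    then obtain y where y: "\<mu> \<le> y" "y \<le> 1" "\<alpha> y = v" by auto
    have "(\<alpha> ^^ (n + 2)) y = \<alpha> ((\<alpha> ^^ n) (\<alpha> y))"
      by (simp add: funpow_swap1[of \<alpha> n y])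
    then show ?thesis
      using y v w by (intro bexI[of _ y]) (auto simp: z_def)
  qed
  then show thesis by (rule that)
qed

text \<open>The pairs of consecutive coordinates: a backward orbit can stop only above \<open>\<mu>\<close>, because
  \<open>\<gamma>\<close> has range \<open>{y. frac y \<le> \<mu>}\<close> up to a null set.\<close>

definition links :: "(real \<times> real) set" where
  "links = ({-1} \<union> {\<mu>..1}) \<times> {-1} \<union> (\<lambda>b. (\<alpha> b, b)) ` {0..1}"

text \<open>The coordinate model of the maximal ideal space: \<open>-1\<close> stands for the zero functional.\<close>

definition model :: "(nat \<Rightarrow> real) set" where
  "model = {x. x 0 \<in> {0..1} \<and> (\<forall>n. (x n, x (Suc n)) \<in> links)}"

definition model_fin :: "nat \<Rightarrow> (nat \<Rightarrow> real) set" where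
  "model_fin N = {x \<in> model. x N \<noteq> -1 \<and> x (Suc N) = -1}"

definition model_inf :: "(nat \<Rightarrow> real) set" where
  "model_inf = {x \<in> model. \<forall>n. x n \<noteq> -1}"

definition arc_point :: "nat \<Rightarrow> real \<Rightarrow> nat \<Rightarrow> real" where
  "arc_point N y = (\<lambda>i. if i \<le> N then (\<alpha> ^^ (N - i)) y else -1)"

lemma linksI: "b \<in> {0..1} \<Longrightarrow> \<alpha> b = a \<Longrightarrow> (a, b) \<in> links"
  by (auto simp: links_def)

lemma links_zero: "a = -1 \<or> a \<in> {\<mu>..1} \<Longrightarrow> (a, -1) \<in> links"
  by (auto simp: links_def)

lemma linksE:
  assumes "(a, b) \<in> links"
  obtains "a = -1" "b = -1" | "a \<in> {\<mu>..1}" "b = -1" | "b \<in> {0..1}" "a \<in> {0..1}" "\<alpha> b = a"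
  using assms logistic_unit unfolding links_def by blast

lemma closed_links: "closed links"
proof -
  have "compact ((\<lambda>b. (\<alpha> b, b)) ` {0..1})"
    by (intro compact_continuous_image continuous_intros compact_Icc)
  then show ?thesis
    unfolding links_def by (intro closed_Un closed_Times compact_imp_closed) auto
qed

lemma model_links: "x \<in> model \<Longrightarrow> (x n, x (Suc n)) \<in> links"
  by (simp add: model_def)

lemma model_coord: assumes "x \<in> model" shows "x n \<in> {0..1} \<union> {-1}"
proof (cases n)
  case 0
  then show ?thesis using assms by (simp add: model_def)
next
  case (Suc k)
  then show ?thesis using model_links[OF assms, of k] by (blast elim: linksE)
qed

lemma model_Suc: "x \<in> model \<Longrightarrow> x (Suc n) \<noteq> -1 \<Longrightarrow> x n \<noteq> -1 \<and> \<alpha> (x (Suc n)) = x n"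
  using model_links[of x n] by (auto elim: linksE)

lemma model_zero_mono: assumes "x \<in> model" "x n = -1" "n \<le> m" shows "x m = -1"
  using assms(3)
proof (induct m rule: dec_induct)
  case (step m)
  then show ?case using model_Suc[OF assms(1), of m] by blast
qed (rule assms(2))

lemma model_0: "x \<in> model \<Longrightarrow> x 0 \<in> {0..1}"
  by (simp add: model_def)

lemma model_funpow: "x \<in> model \<Longrightarrow> x (k + n) \<noteq> -1 \<Longrightarrow> (\<alpha> ^^ n) (x (k + n)) = x k"
proof (induct n)
  case (Suc n)
  have "x (k + n) \<noteq> -1" "\<alpha> (x (Suc (k + n))) = x (k + n)"
    using model_Suc[of x "k + n"] Suc.prems by auto
  then show ?case
    using Suc by (simp add: funpow_Suc_right del: funpow.simps)
qed simp

text \<open>Tychonoff: closed conditions on consecutive coordinates, inside a cube of copies of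
  \<open>[-1, 1]\<close>.\<close>

lemma compact_model: "compact model"
proof -
  have "closed model"
  proof -
    have "closed {x::nat \<Rightarrow> real. x 0 \<in> {0..1}}"
      using closed_vimage[of "{0..1}" "\<lambda>x::nat \<Rightarrow> real. x 0"] by (simp add: vimage_def)
    moreover have "closed {x::nat \<Rightarrow> real. (x n, x (Suc n)) \<in> links}" for n
      using closed_vimage[OF closed_links, of "\<lambda>x. (x n, x (Suc n))"]
      by (simp add: vimage_def continuous_on_Pair)
    ultimately have "closed ({x::nat \<Rightarrow> real. x 0 \<in> {0..1}} \<inter> (\<Inter>n. {x. (x n, x (Suc n)) \<in> links}))"
      by (intro closed_Int closed_INT) auto
    also have "{x::nat \<Rightarrow> real. x 0 \<in> {0..1}} \<inter> (\<Inter>n. {x. (x n, x (Suc n)) \<in> links}) = model"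
      by (auto simp: model_def)
    finally show ?thesis .
  qed
  moreover have "compactin (product_topology (\<lambda>i::nat. euclidean) UNIV) (PiE UNIV (\<lambda>i. {-1..1::real}))"
    by (subst compactin_PiE) auto
  then have "compact (PiE UNIV (\<lambda>i::nat. {-1..1::real}))"
    by (simp add: euclidean_product_topology)
  moreover have "model \<subseteq> PiE UNIV (\<lambda>i::nat. {-1..1::real})"
  proof
    fix x assume "x \<in> model"
    from model_coord[OF this] have "x i \<in> {-1..1}" for i by (force dest: spec[of _ i])
    then show "x \<in> PiE UNIV (\<lambda>i::nat. {-1..1::real})" by auto
  qed
  ultimately show ?thesis
    by (metis compact_Int_closed inf.absorb_iff2)
qed

text \<open>Going on yields a link by \<open>logistic_frac_beta\<close>. Stopping means
  \<open>frac s > \<mu>\<close>, which is the source of the links from \<open>{\<mu>..1}\<close> to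
  -1.\<close>

lemma back_orbit_model: "back_orbit s \<in> model"
proof -
  have "(back_coord n s, back_coord (Suc n) s) \<in> links" for n
  proof (induct n arbitrary: s)
    case 0
    show ?case
    proof (cases "frac s \<le> \<mu>")
      case True
      then show ?thesis by (simp add: linksI[OF frac_unit] logistic_frac_beta)
    next
      case False
      then show ?thesis using frac_lt_1[of s] by (auto intro!: links_zero)
    qed
  next
    case (Suc n)
    show ?case using Suc[of "\<beta> s"] links_zero[of "-1"] by simp
  qed
  then show ?thesis using frac_lt_1[of s] by (auto simp: model_def back_orbit_def)
qed

lemma model_union: "model = (\<Union>N. model_fin N) \<union> model_inf"
proof -
  have "\<exists>N. x \<in> model_fin N" if x: "x \<in> model" "x \<notin> model_inf" for x
  proof -
    \<comment> \<open>The first index with the marker -1. It is positive because \<open>x 0\<close>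
      lies in the unit interval, so the orbit ends at its predecessor.\<close>
    define M where "M = (LEAST n. x n = -1)"
    have M: "x M = -1"
      unfolding M_def by (rule LeastI_ex[of "\<lambda>n. x n = -1"]) (use x in \<open>auto simp: model_inf_def\<close>)
    then obtain N where N: "M = Suc N" using model_0[OF x(1)] by (cases M) auto
    then have "x N \<noteq> -1" using not_less_Least[of N "\<lambda>n. x n = -1"] by (auto simp: M_def)
    then show ?thesis using x M N by (auto simp: model_fin_def)
  qed
  then show ?thesis by (auto simp: model_fin_def model_inf_def)
qed

lemma model_inf_inverse_limit: "model_inf = inverse_limit {0..1} (\<lambda>_. \<alpha>)"
proof (intro equalityI subsetI)
  fix x assume x: "x \<in> model_inf"
  then have "x n \<in> {0..1}" for n using model_coord[of x n] by (auto simp: model_inf_def)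
  then show "x \<in> inverse_limit {0..1} (\<lambda>_. \<alpha>)"
    using x model_Suc[of x] by (auto simp: inverse_limit_def model_inf_def)
next
  fix x assume x: "x \<in> inverse_limit {0..1} (\<lambda>_. \<alpha>)"
  then have "x n \<in> {0..1}" "\<alpha> (x (Suc n)) = x n" for n by (auto simp: inverse_limit_def)
  moreover from this(1) have "x n \<noteq> -1" for n by (metis atLeastAtMost_iff neg_0_le_iff_le not_one_le_zero)
  ultimately show "x \<in> model_inf"
    by (auto simp: model_inf_def model_def intro!: linksI simp del: atLeastAtMost_iff)
qed

section \<open>The finite orbits as arcs\<close>

lemma arc_point_in_model_fin: assumes "y \<in> {\<mu>..1}" shows "arc_point N y \<in> model_fin N"
proof -
  have y: "y \<in> {0..1}" using assms mu_pos by auto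
  have "(arc_point N y n, arc_point N y (Suc n)) \<in> links" for n
  proof -
    consider "Suc n \<le> N" | "n = N" | "N < n" by linarith
    then show ?thesis
    proof cases
      case 1
      then have "N - n = Suc (N - Suc n)" by simp
      then show ?thesis using 1 by (auto simp: arc_point_def intro!: linksI funpow_logistic_unit[OF y] simp del: atLeastAtMost_iff)
    qed (use assms in \<open>auto simp: arc_point_def intro!: links_zero\<close>)
  qed
  then show ?thesis
    using assms mu_pos funpow_logistic_unit[OF y, of N]
    by (auto simp: model_fin_def model_def arc_point_def)
qed

lemma model_fin_arc_point:
  assumes "x \<in> model_fin N" shows "x N \<in> {\<mu>..1}" "arc_point N (x N) = x"
proof -
  have x: "x \<in> model" "x N \<noteq> -1" "x (Suc N) = -1" using assms by (auto simp: model_fin_def)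
  show "x N \<in> {\<mu>..1}"
    using model_links[OF x(1), of N] x by (auto elim: linksE)
  show "arc_point N (x N) = x"
  proof
    fix i
    show "arc_point N (x N) i = x i"
      using model_funpow[OF x(1), of i "N - i"] x(2) model_zero_mono[OF x(1,3), of i]
      by (auto simp: arc_point_def)
  qed
qed

lemma continuous_on_arc_point: "continuous_on A (arc_point N)"
proof (rule continuous_on_coordinatewise_then_product)
  show "continuous_on A (\<lambda>y. arc_point N y i)" for i
    by (cases "i \<le> N") (auto simp: arc_point_def intro!: continuous_intros)
qed

lemma model_fin_image: "model_fin N = arc_point N ` {\<mu>..1}"
  using arc_point_in_model_fin model_fin_arc_point by (metis (no_types) image_iff subsetI subset_antisym)

lemma connected_model_fin: "connected (model_fin N)"
  unfolding model_fin_image by (intro connected_continuous_image continuous_on_arc_point) simp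

text \<open>Coordinate \<open>N\<close> recovers the parameter, so a compact interval is mapped
  injectively and continuously; \<open>\<mu> < 1\<close> keeps that interval nondegenerate.\<close>

lemma is_arc_model_fin: "is_arc (top_of_set (model_fin N))"
proof -
  have "inj_on (arc_point N) {\<mu>..1}"
    by (rule inj_onI) (auto simp: arc_point_def dest: fun_cong[of _ _ N])
  then have "{\<mu>..1} homeomorphic model_fin N"
    using continuous_on_arc_point by (intro homeomorphic_compact) (auto simp: model_fin_image)
  then have "model_fin N homeomorphic {\<mu>..1}"
    using homeomorphic_sym by blast
  also have "{\<mu>..1} homeomorphic {0..1::real}"
    using homeomorphic_closed_intervals_real[of \<mu> 1 0 1] mu_less_1 by auto
  finally show ?thesis
    unfolding is_arc_def homeomorphic_def homeomorphic_space_def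
    using homeomorphism_imp_homeomorphic_maps by blast
qed

section \<open>The shift on the space of backward orbits\<close>

definition shift :: "(nat \<Rightarrow> real) \<Rightarrow> nat \<Rightarrow> real" where
  "shift x = induced_map \<alpha> x"

lemma shift_simps [simp]: "shift x 0 = \<alpha> (x 0)" "shift x (Suc n) = x n"
  by (simp_all add: shift_def induced_map_def)

lemma continuous_on_shift: "continuous_on A shift"
proof (rule continuous_on_coordinatewise_then_product)
  have c: "continuous_on A (\<lambda>x. x n)" for n :: nat
    by (rule continuous_on_subset[OF continuous_on_product_coordinates]) simp
  show "continuous_on A (\<lambda>x. shift x n)" for n
    by (cases n) (auto intro!: continuous_intros c)
qed

lemma shift_model: assumes "x \<in> model" shows "shift x \<in> model"
proof -
  have "(shift x n, shift x (Suc n)) \<in> links" for n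
    by (cases n) (auto intro!: linksI model_0[OF assms] model_links[OF assms] simp del: atLeastAtMost_iff)
  then show ?thesis
    using logistic_unit[OF model_0[OF assms]] by (simp add: model_def)
qed

text \<open>Dropping the first coordinate inverts \<open>shift\<close>, the lost value being
  \<open>\<alpha> (x 1)\<close>. The condition on \<open>x 1\<close> prevents the tail from starting
  with the marker.\<close>

lemma tail_model: assumes "x \<in> model" "x 1 \<noteq> -1" shows "(\<lambda>n. x (Suc n)) \<in> model" "shift (\<lambda>n. x (Suc n)) = x"
proof -
  show "(\<lambda>n. x (Suc n)) \<in> model"
    using model_links[OF assms(1)] model_coord[OF assms(1), of 1] assms(2) by (auto simp: model_def)
  show "shift (\<lambda>n. x (Suc n)) = x"
  proof
    fix n show "shift (\<lambda>n. x (Suc n)) n = x n"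
      using model_Suc[OF assms(1), of 0] assms(2) by (cases n) auto
  qed
qed

lemma shift_model_fin: "shift ` model_fin N = model_fin (N + 1)"
proof (intro equalityI subsetI)
  fix y assume "y \<in> shift ` model_fin N"
  then show "y \<in> model_fin (N + 1)" by (auto simp: model_fin_def shift_model)
next
  fix y assume y: "y \<in> model_fin (N + 1)"
  then have "y 1 \<noteq> -1" using model_zero_mono[of y 1 "N + 1"] by (auto simp: model_fin_def)
  then show "y \<in> shift ` model_fin N"
    using y tail_model[of y] by (intro image_eqI[of _ _ "\<lambda>n. y (Suc n)"]) (auto simp: model_fin_def)
qed

lemma shift_model_inf: "shift ` model_inf = model_inf"
proof (intro equalityI subsetI)
  fix y assume "y \<in> shift ` model_inf"
  then obtain x where x: "x \<in> model" "\<And>n. x n \<noteq> -1" "y = shift x" by (auto simp: model_inf_def)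
  have "shift x n \<noteq> -1" for n
    using x(2) logistic_nonneg[OF model_0[OF x(1)]] by (cases n) auto
  then show "y \<in> model_inf" using x by (simp add: model_inf_def shift_model)
next
  fix y assume "y \<in> model_inf"
  then show "y \<in> shift ` model_inf"
    using tail_model[of y] by (intro image_eqI[of _ _ "\<lambda>n. y (Suc n)"]) (auto simp: model_inf_def)
qed

section \<open>The arcs approach the inverse limit\<close>

lemma closed_model_inf: "closed model_inf"
proof -
  have "closed {x::nat \<Rightarrow> real. 0 \<le> x n}" for n
    using closed_vimage[of "{0..}" "\<lambda>x::nat \<Rightarrow> real. x n"] by (simp add: vimage_def)
  then have "closed (model \<inter> (\<Inter>n. {x. 0 \<le> x n}))"
    using compact_model by (intro closed_Int closed_INT compact_imp_closed) auto
  moreover have "model_inf = model \<inter> (\<Inter>n. {x. 0 \<le> x n})"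
  proof -
    have "x n \<noteq> -1 \<longleftrightarrow> 0 \<le> x n" if "x \<in> model" for x n
      using model_coord[OF that, of n] by auto
    then show ?thesis by (auto simp: model_inf_def)
  qed
  ultimately show ?thesis by simp
qed

lemma compact_model_inf: "compact model_inf"
  using compact_Int_closed[OF compact_model closed_model_inf]
  by (simp add: model_inf_def Int_absorb1 Collect_subset)

text \<open>Outside \<open>W\<close> every orbit stops. The open sets of orbits stopped by time
  \<open>n\<close> cover this compact rest, so finitely many suffice and the stopping times there
  are bounded; an orbit in \<open>model_fin N\<close> is still running at time
  \<open>N\<close>.\<close>

lemma model_fin_eventually_near:
  assumes "open W" "model_inf \<subseteq> W"
  shows "eventually (\<lambda>N. model_fin N \<subseteq> W) sequentially"
proof -
  define Z where "Z n = {x::nat \<Rightarrow> real. x n < 0}" for n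
  have "open (Z n)" for n
    using open_vimage[of "{..<0}" "\<lambda>x::nat \<Rightarrow> real. x n"] by (simp add: vimage_def Z_def)
  moreover have "compact (model - W)"
    using compact_diff[OF compact_model assms(1)] .
  moreover have cover: "model - W \<subseteq> (\<Union>n\<in>UNIV. Z n)"
  proof
    fix x assume "x \<in> model - W"
    then have "x \<in> model" "x \<notin> model_inf" using assms by auto
    then obtain n where "x n = -1" by (auto simp: model_inf_def)
    then have "x \<in> Z n" by (simp add: Z_def)
    then show "x \<in> (\<Union>n\<in>UNIV. Z n)" by blast
  qed
  ultimately obtain C where C: "finite C" "model - W \<subseteq> (\<Union>n\<in>C. Z n)"
    using compactE_image[of "model - W" UNIV Z] by metis
  have m: "n \<le> Max C" if "n \<in> C" for n
    using Max_ge[OF C(1) that] .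
  have "model_fin N \<subseteq> W" if "N \<ge> Max C" for N
  proof (rule ccontr)
    assume "\<not> model_fin N \<subseteq> W"
    then obtain x where x: "x \<in> model_fin N" "x \<notin> W" by auto
    then have xm: "x \<in> model" by (simp add: model_fin_def)
    then obtain n where n: "n \<in> C" "x n < 0" using x C(2) by (auto simp: Z_def)
    then have "x n = -1" using model_coord[OF xm, of n] by auto
    then have "x N = -1" using model_zero_mono[OF xm, of n N] m[OF n(1)] that by auto
    then show False using x by (simp add: model_fin_def)
  qed
  then show ?thesis by (auto simp: eventually_sequentially)
qed

text \<open>For each \<open>N\<close> an end point in \<open>{\<mu>..1}\<close> is chosen with the
  same \<open>k\<close>-fold image as \<open>x N\<close>. The finite orbit ending there agrees with
  \<open>x\<close> up to index \<open>N - k\<close>.\<close>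

lemma model_inf_approximable:
  assumes "x \<in> model_inf"
  obtains y where "\<And>N. y N \<in> model_fin N" "y \<longlonglongrightarrow> x"
proof -
  obtain k where k: "\<And>x. x \<in> {0..1} \<Longrightarrow> \<exists>y\<in>{\<mu>..1}. (\<alpha> ^^ k) y = (\<alpha> ^^ k) x"
    using funpow_logistic_eventually_onto by blast
  have x: "x \<in> model" "\<And>n. x n \<noteq> -1" using assms by (auto simp: model_inf_def)
  then have "x n \<in> {0..1}" for n using model_coord[of x n] by auto
  then have "\<forall>N. \<exists>z. z \<in> {\<mu>..1} \<and> (\<alpha> ^^ k) z = (\<alpha> ^^ k) (x N)" using k by blast
  then obtain z where z: "\<And>N. z N \<in> {\<mu>..1}" "\<And>N. (\<alpha> ^^ k) (z N) = (\<alpha> ^^ k) (x N)" by metis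
  have eq: "arc_point N (z N) i = x i" if "i + k \<le> N" for i N
  proof -
    define j where "j = N - (i + k)"
    have N: "N = i + (j + k)" using that by (simp add: j_def)
    have "(\<alpha> ^^ (j + k)) (z N) = (\<alpha> ^^ (j + k)) (x N)"
      unfolding funpow_add comp_def z(2) ..
    also have "\<dots> = x i"
      unfolding N by (rule model_funpow[OF x])
    finally show ?thesis unfolding arc_point_def N by simp
  qed
  have "(\<lambda>N. arc_point N (z N) i) \<longlonglongrightarrow> x i" for i
    by (rule tendsto_eventually) (use eq[of i] in \<open>auto simp: eventually_sequentially\<close>)
  then have "(\<lambda>N. arc_point N (z N)) \<longlonglongrightarrow> x"
    by (rule tendsto_coordinatewise)
  then show thesis
    by (rule that[OF arc_point_in_model_fin[OF z(1)]])
qed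

lemma model_fin_eventually_meets:
  assumes "open W" "x \<in> W" "x \<in> model_inf"
  shows "eventually (\<lambda>N. model_fin N \<inter> W \<noteq> {}) sequentially"
proof -
  obtain y where y: "\<And>N. y N \<in> model_fin N" "y \<longlonglongrightarrow> x"
    by (rule model_inf_approximable[OF assms(3)]) blast
  then show ?thesis
    using topological_tendstoD[OF y(2) assms(1,2)] by (auto elim!: eventually_mono)
qed

lemma model_inf_nonempty: "model_inf \<noteq> {}"
  unfolding model_inf_inverse_limit inverse_limit_def
  by (auto simp: logistic_def intro!: exI[of _ "\<lambda>_. 0"])

text \<open>Disjoint open sets separating \<open>model_inf\<close> would, for large
  \<open>N\<close>, cover the connected arc \<open>model_fin N\<close> and both meet it.\<close>

lemma connected_model_inf: "connected model_inf"
  unfolding connected_closed_set[OF closed_model_inf]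
proof
  assume "\<exists>A B. closed A \<and> closed B \<and> A \<noteq> {} \<and> B \<noteq> {} \<and> A \<union> B = model_inf \<and> A \<inter> B = {}"
  then obtain A B where AB: "closed A" "closed B" "A \<noteq> {}" "B \<noteq> {}" "A \<union> B = model_inf" "A \<inter> B = {}"
    by blast
  obtain U V where UV: "open U" "open V" "A \<subseteq> U" "B \<subseteq> V" "U \<inter> V = {}"
    using t4_space[OF AB(1,2,6)] by blast
  obtain a b where ab: "a \<in> A" "b \<in> B" using AB by blast
  have "eventually (\<lambda>N. model_fin N \<subseteq> U \<union> V) sequentially"
    using UV AB by (intro model_fin_eventually_near) auto
  moreover have "eventually (\<lambda>N. model_fin N \<inter> U \<noteq> {}) sequentially"
    using UV AB ab by (intro model_fin_eventually_meets) auto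
  moreover have "eventually (\<lambda>N. model_fin N \<inter> V \<noteq> {}) sequentially"
    using UV AB ab by (intro model_fin_eventually_meets[where x = b]) auto
  ultimately have "eventually (\<lambda>N. model_fin N \<subseteq> U \<union> V \<and> model_fin N \<inter> U \<noteq> {} \<and> model_fin N \<inter> V \<noteq> {}) sequentially"
    by eventually_elim blast
  then obtain N where "model_fin N \<subseteq> U \<union> V" "model_fin N \<inter> U \<noteq> {}" "model_fin N \<inter> V \<noteq> {}"
    using eventually_happens by fastforce
  then show False
    using connectedD[OF connected_model_fin[of N] UV(1,2)] UV(5) by blast
qed

lemma model_closure: "model \<subseteq> closure (\<Union>N. model_fin N)"
proof
  fix x assume "x \<in> model"
  then consider N where "x \<in> model_fin N" | "x \<in> model_inf" using model_union by auto
  then show "x \<in> closure (\<Union>N. model_fin N)"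
  proof cases
    case 1
    then show ?thesis using closure_subset[of "\<Union>N. model_fin N"] by blast
  next
    case 2
    show ?thesis
      unfolding closure_iff_nhds_not_empty
    proof (intro allI impI)
      fix A V assume "x \<in> V" "V \<subseteq> A" "open V"
      then have "eventually (\<lambda>N. model_fin N \<inter> V \<noteq> {}) sequentially"
        using 2 by (intro model_fin_eventually_meets)
      then obtain N where "model_fin N \<inter> V \<noteq> {}" using eventually_happens by fastforce
      then show "(\<Union>N. model_fin N) \<inter> A \<noteq> {}" using \<open>V \<subseteq> A\<close> by blast
    qed
  qed
qed

section \<open>Full support of the backward orbits\<close>

lemma back_orbit_gam: "back_orbit (\<gamma> t) = shift (back_orbit t)"
proof
  fix n
  show "back_orbit (\<gamma> t) n = shift (back_orbit t) n"
    using back_coord_gam[of _ t] by (cases n) (simp_all add: back_orbit_def frac_gam)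
qed

lemma shift_arc_point: "shift (arc_point N y) = arc_point (Suc N) y"
proof
  fix n
  show "shift (arc_point N y) n = arc_point (Suc N) y n"
    by (cases n) (simp_all add: arc_point_def)
qed

text \<open>Above \<open>\<mu>\<close> the backward orbit stops at once, and every application of
  \<open>\<gamma>\<close> prepends one point.\<close>

lemma back_orbit_funpow_gam:
  assumes "\<mu> < y" "y < 1"
  shows "back_orbit ((\<gamma> ^^ N) y) = arc_point N y"
proof (induct N)
  case 0
  have "frac y = y" using assms mu_pos by (simp add: frac_eq)
  then have "back_orbit y n = arc_point 0 y n" for n
    using assms by (cases n) (simp_all add: back_orbit_def arc_point_def)
  then show ?case by auto
next
  case (Suc N)
  then show ?case by (simp add: back_orbit_gam shift_arc_point)
qed

lemma AE_funpow_gam: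
  assumes [measurable]: "Measurable.pred borel P" and "AE x in lborel. P x"
  shows "AE t in lborel. P ((\<gamma> ^^ N) t)"
proof (induct N)
  case (Suc N)
  have [measurable]: "(\<gamma> ^^ N) \<in> borel_measurable borel"
    by (induct N) (simp_all add: measurable_comp comp_def)
  have "AE t in lborel. P ((\<gamma> ^^ N) (\<gamma> t))"
    by (rule AE_gam[of "\<lambda>t. P ((\<gamma> ^^ N) t)"]) (use Suc in auto)
  then show ?case by (simp add: funpow_swap1)
qed (use assms in simp)

text \<open>If \<open>{s. back_orbit s \<in> V}\<close> were a null set, then so would be its preimages under the iterates
  of \<open>\<gamma>\<close>. But \<open>V\<close> meets some arc \<open>model_fin N\<close>, and the points of this arc other than its end
  points are the backward orbits of \<open>(\<gamma> ^^ N) y\<close> with \<open>y \<in> (\<mu>, 1)\<close>.\<close>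

lemma back_orbit_full_support:
  assumes "open V" "V \<inter> model \<noteq> {}"
  shows "emeasure lborel {s. back_orbit s \<in> V} \<noteq> 0"
proof
  have [measurable]: "V \<in> sets borel" using assms(1) by simp
  assume "emeasure lborel {s. back_orbit s \<in> V} = 0"
  moreover have "{s. back_orbit s \<in> V} \<in> sets borel" by measurable
  ultimately have ae: "AE s in lborel. back_orbit s \<notin> V"
    by (intro AE_I[of _ _ "{s. back_orbit s \<in> V}"]) auto
  obtain x where "x \<in> V" "x \<in> model" using assms by blast
  then have "(\<Union>N. model_fin N) \<inter> V \<noteq> {}"
    using model_closure open_Int_closure_eq_empty[OF assms(1), of "\<Union>N. model_fin N"] by blast
  then obtain N y where y: "y \<in> V" "y \<in> model_fin N" by blast
  define I where "I = {z. arc_point N z \<in> V} \<inter> {\<mu><..<1}"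
  have o: "open {z. arc_point N z \<in> V}"
    using open_vimage[OF assms(1) continuous_on_arc_point[of UNIV N]] by (simp add: vimage_def)
  then have "open I" unfolding I_def by auto
  moreover have "I \<noteq> {}"
  proof -
    have "y N \<in> closure {\<mu><..<1}"
      using model_fin_arc_point(1)[OF y(2)] mu_less_1 by (simp add: closure_greaterThanLessThan)
    moreover have "y N \<in> {z. arc_point N z \<in> V}" using model_fin_arc_point(2)[OF y(2)] y by simp
    ultimately show ?thesis
      using open_Int_closure_eq_empty[OF o, of "{\<mu><..<1}"] unfolding I_def by blast
  qed
  ultimately have "\<not> negligible I" by (rule open_not_negligible)
  moreover have "AE t in lborel. back_orbit ((\<gamma> ^^ N) t) \<notin> V"
    by (rule AE_funpow_gam[OF _ ae]) measurable
  then have "AE t in lborel. t \<notin> I"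
    by eventually_elim (auto simp: I_def back_orbit_funpow_gam)
  then have "I \<in> null_sets lborel"
    using \<open>open I\<close> by (subst AE_iff_null_sets) auto
  then have "negligible I"
    by (simp add: negligible_iff_null_sets null_sets_completionI)
  ultimately show False by blast
qed

end

section \<open>The algebra \<open>\<B>\<^sub>\<lambda>\<close> as an algebra of continuous functions\<close>

lemma symbol_add_int: assumes "symbol a" shows "a (t + of_int k) = a t"
proof (induct k rule: int_induct[of _ 0])
  case (step1 i)
  then show ?case using assms unfolding symbol_def by (metis add.assoc of_int_1 of_int_add)
next
  case (step2 i)
  have "a (t + of_int (i - 1) + 1) = a (t + of_int (i - 1))" using assms unfolding symbol_def by blast
  then show ?case using step2 by simp
qed simp

lemma symbol_frac: "symbol a \<Longrightarrow> a (frac t) = a t"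
  using symbol_add_int[of a "frac t" "\<lfloor>t\<rfloor>"] by (simp add: frac_def)

lemma continuous_on_symbol_value:
  assumes "symbol a" shows "continuous_on {0..1} (symbol_value a)"
proof -
  obtain l where l: "(a \<longlongrightarrow> l) (at_left 1)" and c: "continuous_on {0..<1} a"
    using assms by (auto simp: symbol_def)
  have sv: "symbol_value a = (\<lambda>x. if x < 1 then a x else l)"
    using tendsto_Lim[OF _ l] by (auto simp: symbol_value_def fun_eq_iff)
  show ?thesis
    unfolding continuous_on_def
  proof
    fix x :: real assume x: "x \<in> {0..1}"
    show "(symbol_value a \<longlongrightarrow> symbol_value a x) (at x within {0..1})"
    proof (cases "x < 1")
      case True
      have "at x within {0..1} = at x within {0..<1}"
        by (rule at_within_nhd[of x "{..<1}"]) (use True in auto)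
      moreover have "(a \<longlongrightarrow> a x) (at x within {0..<1})"
        using c x True by (auto simp: continuous_on_def)
      then have "(symbol_value a \<longlongrightarrow> a x) (at x within {0..<1})"
        by (rule Lim_transform_eventually) (auto simp: sv eventually_at_filter)
      ultimately show ?thesis using True by (simp add: sv)
    next
      case False
      then have x: "x = 1" using x by simp
      have "(symbol_value a \<longlongrightarrow> l) (at_left 1)"
        by (rule Lim_transform_eventually[OF l]) (auto simp: sv eventually_at_filter)
      then show ?thesis by (simp add: x at_within_Icc_at_left sv)
    qed
  qed
qed

lemma symbol_const: "symbol (\<lambda>_. c)"
  by (auto simp: symbol_def intro!: exI[of _ c])

lemma frac_at_left_1: "((\<lambda>t::real. frac t) \<longlongrightarrow> 1) (at_left 1)"
proof -
  have "eventually (\<lambda>t::real. t = frac t) (at_left 1)"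
    unfolding eventually_at_left_field by (rule exI[of _ 0]) (auto simp: frac_eq)
  then show ?thesis
    by (rule Lim_transform_eventually[rotated]) (rule tendsto_ident_at)
qed

text \<open>The test symbols: \<open>c = 0\<close> reads off a point of the interval, while
  \<open>c = 1\<close> stays away from 0 and so also distinguishes points from the zero
  functional.\<close>

lemma symbol_frac_plus: "symbol (\<lambda>t. c + complex_of_real (frac t))"
  unfolding symbol_def
proof (intro conjI allI)
  show "c + complex_of_real (frac (t + 1)) = c + complex_of_real (frac t)" for t
    by (simp add: frac_def)
  have "continuous_on {0..<1} (\<lambda>t. c + complex_of_real t)" by (intro continuous_intros)
  then show "continuous_on {0..<1} (\<lambda>t. c + complex_of_real (frac t))"
    by (rule continuous_on_eq) (simp add: frac_eq)
  show "\<exists>l. ((\<lambda>t. c + complex_of_real (frac t)) \<longlongrightarrow> l) (at_left 1)"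
    by (rule exI[of _ "c + complex_of_real 1"]) (intro tendsto_intros frac_at_left_1)
qed

lemma symbol_value_frac_plus:
  assumes "x \<in> {0..1}" shows "symbol_value (\<lambda>t. c + complex_of_real (frac t)) x = c + complex_of_real x"
proof (cases "x < 1")
  case True
  then show ?thesis using assms by (simp add: symbol_value_def frac_eq)
next
  case False
  have "((\<lambda>t. c + complex_of_real (frac t)) \<longlongrightarrow> c + complex_of_real 1) (at_left 1)"
    by (intro tendsto_intros frac_at_left_1)
  then show ?thesis
    using False assms by (simp add: symbol_value_def tendsto_Lim)
qed

lemma symbol_value_const: "symbol_value (\<lambda>_. c) x = c"
  by (simp add: symbol_value_def tendsto_Lim)

lemma borel_measurable_symbol:
  assumes "symbol a" shows "a \<in> borel_measurable borel"
proof -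
  have "symbol_value a \<in> borel_measurable (restrict_space borel {0..1})"
    by (rule borel_measurable_continuous_on_restrict[OF continuous_on_symbol_value[OF assms]])
  moreover have "frac \<in> borel \<rightarrow>\<^sub>M restrict_space borel {0..1::real}"
  proof (rule measurable_restrict_space2)
    show "(frac :: real \<Rightarrow> real) \<in> borel_measurable borel" by measurable
  qed (auto simp: frac_lt_1 less_imp_le)
  ultimately have "(\<lambda>t. symbol_value a (frac t)) \<in> borel_measurable borel"
    by (rule measurable_compose[rotated])
  moreover have "symbol_value a (frac t) = a t" for t
    by (simp add: symbol_value_def frac_lt_1 symbol_frac[OF assms])
  ultimately show ?thesis by simp
qed

lemma bmeas_symbol: assumes "symbol a" shows "bmeas a"
proof -
  have "bounded (symbol_value a ` {0..1})"
    by (intro compact_imp_bounded compact_continuous_image continuous_on_symbol_value assms compact_Icc)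
  then obtain K where K: "\<forall>x\<in>{0..1}. cmod (symbol_value a x) \<le> K"
    by (auto simp: bounded_iff)
  have "cmod (a t) \<le> K" for t
    using K[rule_format, of "frac t"] frac_lt_1[of t] symbol_frac[OF assms, of t]
    by (simp add: symbol_value_def)
  then show ?thesis by (rule bmeasI[OF borel_measurable_symbol[OF assms]])
qed

context logistic_parameter
begin

section \<open>Continuous functions on the model as multiplication operators\<close>

definition pull :: "((nat \<Rightarrow> real) \<Rightarrow> complex) \<Rightarrow> L2_op" where
  "pull F = mult_op (\<lambda>s. F (back_orbit s))"

text \<open>\<open>F\<close> is controlled on \<open>model\<close> only, so measurability goes
  through \<open>back_orbit\<close> as a map into the restricted space; compactness supplies the
  bound.\<close>

lemma bmeas_pull: assumes "continuous_on model F" shows "bmeas (\<lambda>s. F (back_orbit s))"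
proof -
  have "F \<in> borel_measurable (restrict_space borel model)"
    by (rule borel_measurable_continuous_on_restrict[OF assms])
  moreover have "back_orbit \<in> borel \<rightarrow>\<^sub>M restrict_space borel model"
    by (rule measurable_restrict_space2) (auto simp: back_orbit_model)
  ultimately have m: "(\<lambda>s. F (back_orbit s)) \<in> borel_measurable borel"
    by (rule measurable_compose[rotated])
  have "bounded (F ` model)"
    by (intro compact_imp_bounded compact_continuous_image assms compact_model)
  then obtain K where "\<And>x. x \<in> model \<Longrightarrow> cmod (F x) \<le> K"
    by (auto simp: bounded_iff)
  then show ?thesis by (intro bmeasI[OF m, of K]) (simp add: back_orbit_model)
qed

lemma norm_pull_le:
  assumes "continuous_on model F" "\<And>x. x \<in> model \<Longrightarrow> cmod (F x) \<le> K"
  shows "norm (pull F) \<le> K"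
  unfolding pull_def
  by (rule mult_op_bounded(3)) (use bmeas_pull[OF assms(1)] assms(2)[OF back_orbit_model] in \<open>auto simp: bmeas_def\<close>)

text \<open>Together with \<open>norm_pull_le\<close> this makes \<open>pull\<close> isometric. Near
  \<open>x\<close> the modulus of \<open>F\<close> exceeds any \<open>c\<close> below its value at
  \<open>x\<close>, and by full support this happens on a set of positive measure.\<close>

lemma norm_pull_ge:
  assumes F: "continuous_on model F" and x: "x \<in> model"
  shows "cmod (F x) \<le> norm (pull F)"
proof (rule dense_le)
  fix c assume c: "c < cmod (F x)"
  show "c \<le> norm (pull F)"
  proof (cases "0 \<le> c")
    case True
    have "continuous_on model (\<lambda>x. cmod (F x))" using F by (intro continuous_intros)
    then obtain V where V: "open V" "V \<inter> model = (\<lambda>x. cmod (F x)) -` {c<..} \<inter> model"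
      using continuous_on_open_invariant[of model "\<lambda>x. cmod (F x)"] open_greaterThan[of c] by blast
    have "x \<in> V \<inter> model" unfolding V(2) using c x by simp
    then have ne: "emeasure lborel {s. back_orbit s \<in> V} \<noteq> 0"
      by (intro back_orbit_full_support V(1)) blast
    have [measurable]: "V \<in> sets borel" using V(1) by simp
    have ms: "{s. back_orbit s \<in> V} \<in> sets borel" by measurable
    show ?thesis
      unfolding pull_def
    proof (rule norm_mult_op_ge[OF bmeas_pull[OF F] ms ne _ True])
      fix s assume "s \<in> {s. back_orbit s \<in> V}"
      then have "back_orbit s \<in> V \<inter> model" using back_orbit_model by simp
      then show "c \<le> cmod (F (back_orbit s))" unfolding V(2) by simp
    qed
  next
    case False
    then show ?thesis using norm_ge_zero[of "pull F"] by linarith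
  qed
qed

lemma pull_add: "continuous_on model F \<Longrightarrow> continuous_on model G \<Longrightarrow> pull F + pull G = pull (\<lambda>x. F x + G x)"
  unfolding pull_def by (rule mult_op_add[OF bmeas_pull bmeas_pull])

lemma pull_compose: "continuous_on model F \<Longrightarrow> continuous_on model G \<Longrightarrow> pull F o\<^sub>L pull G = pull (\<lambda>x. F x * G x)"
  unfolding pull_def by (rule mult_op_compose[OF bmeas_pull bmeas_pull])

lemma pull_scaleC: "continuous_on model F \<Longrightarrow> scaleC_op c (pull F) = pull (\<lambda>x. c * F x)"
  unfolding pull_def by (rule mult_op_scaleC[OF bmeas_pull])

lemma pull_adj: "continuous_on model F \<Longrightarrow> adj (pull F) = pull (\<lambda>x. cnj (F x))"
  unfolding pull_def by (rule adj_mult_op[OF bmeas_pull])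

lemma pull_diff:
  assumes "continuous_on model F" "continuous_on model G"
  shows "pull F - pull G = pull (\<lambda>x. F x - G x)"
proof -
  have "pull (\<lambda>x. F x - G x) + pull G = pull (\<lambda>x. (F x - G x) + G x)"
    by (rule pull_add) (use assms in \<open>auto intro: continuous_intros\<close>)
  then show ?thesis by (simp add: algebra_simps)
qed

lemma pull_cong: "(\<And>x. x \<in> model \<Longrightarrow> F x = G x) \<Longrightarrow> pull F = pull G"
  by (simp add: pull_def back_orbit_model)

lemma pull_inject:
  assumes "continuous_on model F" "continuous_on model G" "pull F = pull G" "x \<in> model"
  shows "F x = G x"
proof -
  have "cmod (F x - G x) \<le> norm (pull (\<lambda>x. F x - G x))"
    by (rule norm_pull_ge) (use assms in \<open>auto intro: continuous_intros\<close>)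
  also have "pull (\<lambda>x. F x - G x) = pull F - pull G"
    by (rule pull_diff[OF assms(1,2), symmetric])
  finally show ?thesis using assms(3) by simp
qed

definition pulls :: "L2_op set" where
  "pulls = pull ` {F. continuous_on model F}"

text \<open>Isometry turns a norm-Cauchy sequence of operators into a uniformly Cauchy sequence of
  functions, whose limit is continuous.\<close>

lemma closed_pulls: "closed pulls"
  unfolding closed_sequential_limits
proof (intro allI impI)
  fix T L assume "(\<forall>n. T n \<in> pulls) \<and> T \<longlonglongrightarrow> L"
  then have T: "\<And>n. T n \<in> pulls" "T \<longlonglongrightarrow> L" by auto
  then have "\<forall>n. \<exists>F. continuous_on model F \<and> T n = pull F" by (auto simp: pulls_def)
  then obtain F where F: "\<And>n. continuous_on model (F n)" "\<And>n. T n = pull (F n)" by metis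
  have diff: "continuous_on model (\<lambda>x. F m x - F n x)" for m n
    using F by (intro continuous_intros)
  have "uniformly_Cauchy_on model F"
  proof (rule uniformly_Cauchy_onI)
    fix e :: real assume "e > 0"
    then obtain M where M: "\<forall>m\<ge>M. \<forall>n\<ge>M. norm (T m - T n) < e"
      using LIMSEQ_imp_Cauchy[OF T(2)] by (auto simp: Cauchy_iff)
    have "dist (F m x) (F n x) < e" if "x \<in> model" "m \<ge> M" "n \<ge> M" for x m n
      using norm_pull_ge[OF diff[of m n] that(1)] M[rule_format, OF that(2,3)]
      by (simp add: F(2) pull_diff F(1) dist_norm)
    then show "\<exists>M. \<forall>x\<in>model. \<forall>m\<ge>M. \<forall>n\<ge>M. dist (F m x) (F n x) < e" by blast
  qed
  then have "uniformly_convergent_on model F"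
    by (simp add: Cauchy_uniformly_convergent)
  then obtain G where G: "uniform_limit model F G sequentially"
    by (auto simp: uniformly_convergent_on_def)
  have cG: "continuous_on model G"
    by (rule uniform_limit_theorem[OF _ G]) (use F in auto)
  have "T \<longlonglongrightarrow> pull G"
  proof (rule metric_LIMSEQ_I)
    fix e :: real assume "e > 0"
    then obtain M where M: "\<forall>n\<ge>M. \<forall>x\<in>model. dist (F n x) (G x) < e / 2"
      using uniform_limitD[OF G, of "e/2"] by (auto simp: eventually_sequentially)
    have "dist (T n) (pull G) < e" if "n \<ge> M" for n
    proof -
      have "norm (pull (\<lambda>x. F n x - G x)) \<le> e / 2"
        by (rule norm_pull_le)
          (use M[rule_format, OF that] F cG in \<open>auto intro!: continuous_intros simp: dist_norm less_imp_le\<close>)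
      then show ?thesis using \<open>e > 0\<close> by (simp add: dist_norm F(2) pull_diff F(1) cG)
    qed
    then show "\<exists>no. \<forall>n\<ge>no. dist (T n) (pull G) < e" by blast
  qed
  then have "L = pull G" using T(2) LIMSEQ_unique by blast
  then show "L \<in> pulls" using cG by (auto simp: pulls_def)
qed

lemma pullsI: "continuous_on model F \<Longrightarrow> pull F \<in> pulls"
  by (simp add: pulls_def)

lemma cstar_subalgebra_pulls: "cstar_subalgebra pulls"
  unfolding cstar_subalgebra_def
proof (intro conjI ballI allI closed_pulls)
  show "pulls \<subseteq> bounded_operators"
    using mult_op_bounded_operators[OF bmeas_pull] by (auto simp: pulls_def pull_def)
  have "pull (\<lambda>x. 0) = 0" by (simp add: pull_def mult_op_zero)
  then show "0 \<in> pulls" using pullsI[of "\<lambda>x. 0"] by simp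
  fix S T assume "S \<in> pulls" "T \<in> pulls"
  then obtain F G where "continuous_on model F" "S = pull F" "continuous_on model G" "T = pull G"
    by (auto simp: pulls_def)
  then show "S + T \<in> pulls" "S o\<^sub>L T \<in> pulls"
    by (auto simp: pull_add pull_compose intro!: pullsI continuous_intros)
next
  fix T c assume "T \<in> pulls"
  then obtain F where "continuous_on model F" "T = pull F" by (auto simp: pulls_def)
  then show "scaleC_op c T \<in> pulls" "adj T \<in> pulls"
    by (auto simp: pull_scaleC pull_adj intro!: pullsI continuous_intros)
qed

definition coord_symbol :: "nat \<Rightarrow> (real \<Rightarrow> complex) \<Rightarrow> (nat \<Rightarrow> real) \<Rightarrow> complex" where
  "coord_symbol n a x = (if x n = -1 then 0 else symbol_value a (x n))"

text \<open>The marker -1 is isolated from the unit interval, so the value 0 assigned to it causes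
  no discontinuity.\<close>

lemma continuous_on_coord_symbol:
  assumes "symbol a" shows "continuous_on model (coord_symbol n a)"
proof -
  define h where "h y = (if y = -1 then 0 else symbol_value a y)" for y
  have "continuous_on {0..1} h"
    by (rule continuous_on_eq[OF continuous_on_symbol_value[OF assms]]) (auto simp: h_def)
  then have "continuous_on ({0..1} \<union> {-1}) h"
    by (intro continuous_on_closed_Un) auto
  then have "continuous_on model (\<lambda>x. h (x n))"
  proof (rule continuous_on_compose2)
    show "(\<lambda>x. x n) ` model \<subseteq> {0..1} \<union> {-1}" using model_coord[of _ n] by blast
  qed (auto intro: continuous_on_subset[OF continuous_on_product_coordinates])
  then show ?thesis by (simp add: h_def coord_symbol_def[abs_def])
qed

lemma conj_U_symbol:
  assumes "symbol a" shows "conj_U \<mu> n (mult_op a) = pull (coord_symbol n a)"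
proof -
  have a: "(\<lambda>t. a (frac t)) = a" using symbol_frac[OF assms] by auto
  have "(if back_coord n s = -1 then 0 else a (back_coord n s)) = coord_symbol n a (back_orbit s)" for s
    using back_coord_unit[of n s] by (auto simp: coord_symbol_def symbol_value_def back_orbit_def)
  then show ?thesis
    using conj_U_mult_op(1)[of a n] bmeas_symbol[OF assms] by (simp add: a pull_def)
qed

lemma generators_pull: "(\<Union>n. conj_U \<mu> n ` alg_A) = {pull (coord_symbol n a) | n a. symbol a}"
proof -
  have "conj_U \<mu> n ` alg_A = {pull (coord_symbol n a) | a. symbol a}" for n
    unfolding alg_A_def image_image by (auto simp: conj_U_symbol image_iff)
  then show ?thesis by auto
qed

text \<open>Stone-Weierstrass is applied to the real functions whose operators lie in
  \<open>B\<close>; complex functions are split into real and imaginary parts.\<close>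

lemma pull_in_cstar_subalgebra:
  assumes B: "cstar_subalgebra B" "(\<Union>n. conj_U \<mu> n ` alg_A) \<subseteq> B" and F: "continuous_on model F"
  shows "pull F \<in> B"
proof -
  have B_add: "\<And>S T. S \<in> B \<Longrightarrow> T \<in> B \<Longrightarrow> S + T \<in> B"
    and B_mult: "\<And>S T. S \<in> B \<Longrightarrow> T \<in> B \<Longrightarrow> S o\<^sub>L T \<in> B"
    and B_scale: "\<And>c T. T \<in> B \<Longrightarrow> scaleC_op c T \<in> B"
    and B_closed: "closed B"
    using B(1) by (auto simp: cstar_subalgebra_def)
  have gen: "pull (coord_symbol n a) \<in> B" if "symbol a" for n a
    using B(2) that unfolding generators_pull by blast
  define R where "R = {f. continuous_on model f \<and> pull (\<lambda>x. complex_of_real (f x)) \<in> B}"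
  have const: "pull (\<lambda>x. c) \<in> B" for c
  proof -
    \<comment> \<open>Constants come from index 0, the one coordinate that never carries the marker;
      at later indices a constant symbol vanishes on the stopped orbits.\<close>
    have "pull (coord_symbol 0 (\<lambda>_. c)) = pull (\<lambda>x. c)"
      by (rule pull_cong) (use model_0 in \<open>force simp: coord_symbol_def symbol_value_const\<close>)
    then show ?thesis using gen[OF symbol_const] by metis
  qed
  interpret function_ring_on R model
  proof
    show "compact model" by (rule compact_model)
    show "f \<in> R \<Longrightarrow> continuous_on model f" for f by (simp add: R_def)
    have cof: "continuous_on model (\<lambda>x. complex_of_real (f x))" if "f \<in> R" for f
      using that by (auto simp: R_def intro!: continuous_intros)
    show "(\<lambda>x. f x + g x) \<in> R" if "f \<in> R" "g \<in> R" for f g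
    proof -
      have "pull (\<lambda>x. complex_of_real (f x)) + pull (\<lambda>x. complex_of_real (g x)) \<in> B"
        using that by (intro B_add) (auto simp: R_def)
      then show ?thesis
        using that by (simp add: pull_add[OF cof cof]) (auto simp: R_def intro!: continuous_intros)
    qed
    show "(\<lambda>x. f x * g x) \<in> R" if "f \<in> R" "g \<in> R" for f g
    proof -
      have "pull (\<lambda>x. complex_of_real (f x)) o\<^sub>L pull (\<lambda>x. complex_of_real (g x)) \<in> B"
        using that by (intro B_mult) (auto simp: R_def)
      then show ?thesis
        using that by (simp add: pull_compose[OF cof cof]) (auto simp: R_def intro!: continuous_intros)
    qed
    show "(\<lambda>_. c) \<in> R" for c using const by (simp add: R_def)
    fix x y assume xy: "x \<in> model" "y \<in> model" "x \<noteq> y"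
    then obtain n where n: "x n \<noteq> y n" by auto
    \<comment> \<open>The offset 1 separates a coordinate equal to 0 from a stopped orbit, where the
      function is 0.\<close>
    define f where "f z = (if z n = -1 then 0 else 1 + z n)" for z :: "nat \<Rightarrow> real"
    have f: "complex_of_real (f z) = coord_symbol n (\<lambda>t. 1 + complex_of_real (frac t)) z" if "z \<in> model" for z
      using model_coord[OF that, of n] symbol_value_frac_plus[of "z n" 1]
      by (auto simp: f_def coord_symbol_def)
    have "continuous_on model (\<lambda>z. complex_of_real (f z))"
      by (rule continuous_on_eq[OF continuous_on_coord_symbol[OF symbol_frac_plus[of 1], of n]]) (simp add: f)
    then have "continuous_on model (\<lambda>z. Re (complex_of_real (f z)))"
      by (rule continuous_on_Re)
    moreover have "pull (\<lambda>z. complex_of_real (f z)) \<in> B"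
      using gen[OF symbol_frac_plus[of 1], of n] pull_cong[OF f] by simp
    ultimately have "f \<in> R" by (simp add: R_def)
    moreover have "f x \<noteq> f y"
      using n model_coord[OF xy(1), of n] model_coord[OF xy(2), of n] by (auto simp: f_def)
    ultimately show "\<exists>f\<in>R. f x \<noteq> f y" by blast
  qed
  have real: "pull (\<lambda>x. complex_of_real (f x)) \<in> B" if f: "continuous_on model f" for f
  proof -
    have cf: "continuous_on model (\<lambda>x. complex_of_real (f x))" using f by (intro continuous_intros)
    have "pull (\<lambda>x. complex_of_real (f x)) \<in> closure B"
      unfolding closure_approachable
    proof (intro allI impI)
      fix e :: real assume "e > 0"
      then obtain g where g: "g \<in> R" "\<And>x. x \<in> model \<Longrightarrow> \<bar>f x - g x\<bar> < e / 2"
        using Stone_Weierstrass_basic[OF f, of "e/2"] by auto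
      have cg: "continuous_on model (\<lambda>x. complex_of_real (g x))"
        using g(1) by (auto simp: R_def intro!: continuous_intros)
      have "norm (pull (\<lambda>x. complex_of_real (g x) - complex_of_real (f x))) \<le> e / 2"
      proof (rule norm_pull_le)
        fix x assume "x \<in> model"
        then show "cmod (complex_of_real (g x) - complex_of_real (f x)) \<le> e / 2"
          using g(2)[of x] by (simp add: norm_of_real abs_minus_commute flip: of_real_diff)
      qed (intro continuous_intros cf cg)
      then have "dist (pull (\<lambda>x. complex_of_real (g x))) (pull (\<lambda>x. complex_of_real (f x))) < e"
        using \<open>e > 0\<close> by (simp add: dist_norm pull_diff[OF cg cf])
      then show "\<exists>y\<in>B. dist y (pull (\<lambda>x. complex_of_real (f x))) < e"
        using g(1) by (auto simp: R_def)
    qed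
    then show ?thesis using B_closed by simp
  qed
  have cR: "continuous_on model (\<lambda>x. complex_of_real (Re (F x)))" "continuous_on model (\<lambda>x. complex_of_real (Im (F x)))"
    using F by (auto intro!: continuous_intros)
  have "pull (\<lambda>x. complex_of_real (Re (F x))) + scaleC_op \<i> (pull (\<lambda>x. complex_of_real (Im (F x)))) \<in> B"
    using F by (intro B_add B_scale real continuous_intros)
  also have "pull (\<lambda>x. complex_of_real (Re (F x))) + scaleC_op \<i> (pull (\<lambda>x. complex_of_real (Im (F x)))) = pull F"
    using cR by (simp add: pull_scaleC pull_add continuous_on_mult_left complex_eq[symmetric])
  finally show ?thesis .
qed

lemma alg_B_eq_pulls: "alg_B \<mu> = pulls"
proof
  show "alg_B \<mu> \<subseteq> pulls"
    unfolding alg_B_def cstar_generated_def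
  proof (intro Inter_lower CollectI conjI cstar_subalgebra_pulls)
    show "(\<Union>n. conj_U \<mu> n ` alg_A) \<subseteq> pulls"
      unfolding generators_pull by (auto intro: pullsI continuous_on_coord_symbol)
  qed
  show "pulls \<subseteq> alg_B \<mu>"
    unfolding alg_B_def cstar_generated_def pulls_def
    using pull_in_cstar_subalgebra by blast
qed

section \<open>Characters\<close>

text \<open>By \<open>pull_inject\<close> the choice of \<open>F\<close> does not affect its values
  on \<open>model\<close>; the value 0 outside \<open>pulls\<close> follows the convention of
  \<open>characters\<close>.\<close>

definition eval_char :: "(nat \<Rightarrow> real) \<Rightarrow> L2_op \<Rightarrow> complex" where
  "eval_char x = (\<lambda>T. if T \<in> pulls then (SOME F. continuous_on model F \<and> T = pull F) x else 0)"

lemma eval_char_pull: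
  assumes "x \<in> model" "continuous_on model F"
  shows "eval_char x (pull F) = F x"
proof -
  define G where "G = (SOME G. continuous_on model G \<and> pull F = pull G)"
  have "continuous_on model G \<and> pull F = pull G"
    unfolding G_def by (rule someI[of _ F]) (use assms in simp)
  then have "G x = F x"
    using pull_inject[of G F x] assms by auto
  then show ?thesis using assms by (simp add: eval_char_def pullsI G_def)
qed

lemma pullsE:
  assumes "T \<in> pulls" obtains F where "continuous_on model F" "T = pull F"
  using assms by (auto simp: pulls_def)

lemma eval_char_max_ideals:
  assumes x: "x \<in> model" shows "eval_char x \<in> max_ideals \<mu>"
  unfolding max_ideals_def characters_def alg_B_eq_pulls
proof (intro CollectI conjI allI ballI impI)
  show "eval_char x T = 0" if "T \<notin> pulls" for T using that by (simp add: eval_char_def)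
  have "eval_char x (pull (\<lambda>_. 1)) = 1" by (simp add: eval_char_pull x)
  then show "\<exists>T\<in>pulls. eval_char x T \<noteq> 0"
    using pullsI[of "\<lambda>_. 1"] by (intro bexI[of _ "pull (\<lambda>_. 1)"]) auto
  fix S T assume "S \<in> pulls" "T \<in> pulls"
  then obtain F G where "continuous_on model F" "S = pull F" "continuous_on model G" "T = pull G"
    by (auto elim!: pullsE)
  then show "eval_char x (S + T) = eval_char x S + eval_char x T"
    "eval_char x (S o\<^sub>L T) = eval_char x S * eval_char x T"
    using x by (simp_all add: pull_add pull_compose eval_char_pull continuous_on_add continuous_on_mult)
next
  fix T c assume "T \<in> pulls"
  then obtain F where "continuous_on model F" "T = pull F" by (auto elim!: pullsE)
  then show "eval_char x (scaleC_op c T) = c * eval_char x T"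
    using x by (simp add: pull_scaleC eval_char_pull continuous_on_mult_left)
qed

text \<open>If no evaluation agreed with \<open>\<xi>\<close>, then by compactness some finite sum \<open>\<Sum>|F\<^sub>i|\<^sup>2\<close> with all
  \<open>F\<^sub>i\<close> in the kernel of \<open>\<xi>\<close> would be positive, hence invertible.\<close>

lemma max_ideals_eval_char:
  assumes "\<xi> \<in> max_ideals \<mu>" obtains x where "x \<in> model" "\<xi> = eval_char x"
proof -
  note ch = assms[unfolded max_ideals_def characters_def alg_B_eq_pulls mem_Collect_eq]
  define e where "e F = \<xi> (pull F)" for F
  have add: "e (\<lambda>x. F x + G x) = e F + e G" if "continuous_on model F" "continuous_on model G" for F G
    using ch that by (simp add: e_def pull_add[symmetric] pullsI)
  have mult: "e (\<lambda>x. F x * G x) = e F * e G" if "continuous_on model F" "continuous_on model G" for F G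
    using ch that by (simp add: e_def pull_compose[symmetric] pullsI)
  have scale: "e (\<lambda>x. c * F x) = c * e F" if "continuous_on model F" for F c
    using ch that by (simp add: e_def pull_scaleC[symmetric] pullsI)
  have one: "e (\<lambda>_. 1) = 1"
  proof -
    obtain F where F: "continuous_on model F" "e F \<noteq> 0"
      using ch by (auto simp: e_def pulls_def)
    then show ?thesis using mult[of "\<lambda>_. 1" F] by simp
  qed
  have "\<exists>x\<in>model. \<forall>F. continuous_on model F \<longrightarrow> e F = F x"
  proof (rule ccontr)
    assume "\<not> ?thesis"
    then have "\<forall>x\<in>model. \<exists>F. continuous_on model F \<and> e F \<noteq> F x" by blast
    then obtain F where F: "\<And>x. x \<in> model \<Longrightarrow> continuous_on model (F x)" "\<And>x. x \<in> model \<Longrightarrow> e (F x) \<noteq> F x x"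
      by metis
    \<comment> \<open>Subtracting the constant \<open>e (F x)\<close> moves \<open>F x\<close> into
      the kernel of \<open>e\<close>, and the result does not vanish at \<open>x\<close>. The factor
      1 allows \<open>scale\<close> and \<open>one\<close> to evaluate the constant.\<close>
    define G where "G x y = F x y + (- e (F x)) * 1" for x y
    have G: "continuous_on model (G x)" "e (G x) = 0" "G x x \<noteq> 0" if "x \<in> model" for x
    proof -
      show "continuous_on model (G x)" unfolding G_def using F(1)[OF that] by (intro continuous_intros)
      have "e (\<lambda>y. F x y + (- e (F x)) * 1) = e (F x) + e (\<lambda>y. (- e (F x)) * 1)"
        by (rule add) (auto intro: F(1)[OF that])
      also have "e (\<lambda>y. (- e (F x)) * 1) = (- e (F x)) * 1"
        by (subst scale) (auto simp: one)
      finally show "e (G x) = 0" by (simp add: G_def[abs_def])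
      show "G x x \<noteq> 0" using F(2)[OF that] by (simp add: G_def)
    qed
    have "\<exists>W. open W \<and> W \<inter> model = {y \<in> model. G x y \<noteq> 0}" if x: "x \<in> model" for x
    proof -
      obtain W where "open W" "W \<inter> model = G x -` (- {0}) \<inter> model"
        using continuous_on_open_invariant[of model "G x"] G(1)[OF x] open_Compl[of "{0::complex}"]
        by (metis closed_singleton)
      then show ?thesis by (intro exI[of _ W]) auto
    qed
    then obtain W where W: "\<And>x. x \<in> model \<Longrightarrow> open (W x)" "\<And>x. x \<in> model \<Longrightarrow> W x \<inter> model = {y \<in> model. G x y \<noteq> 0}"
      by metis
    have "model \<subseteq> (\<Union>x\<in>model. W x)"
    proof
      fix x assume x: "x \<in> model"
      then have "x \<in> W x \<inter> model" unfolding W(2)[OF x] using G(3) by simp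
      then show "x \<in> (\<Union>x\<in>model. W x)" using x by blast
    qed
    then obtain C where C: "C \<subseteq> model" "finite C" "model \<subseteq> (\<Union>x\<in>C. W x)"
      using compactE_image[OF compact_model, of model W] W(1) by metis
    define H where "H D y = (\<Sum>x\<in>D. cnj (G x y) * G x y)" for D y
    have H: "continuous_on model (H D) \<and> e (H D) = 0" if "finite D" "D \<subseteq> model" for D
      using that
    proof (induct D rule: finite_induct)
      case empty
      have "e (\<lambda>y. 0 * 1) = 0" by (subst scale) auto
      then show ?case by (simp add: H_def[abs_def])
    next
      case (insert a D)
      then have a: "a \<in> model" and D: "continuous_on model (H D)" "e (H D) = 0" by auto
      have c: "continuous_on model (\<lambda>y. cnj (G a y))" using G(1)[OF a] by (intro continuous_intros)
      have "H (insert a D) = (\<lambda>y. cnj (G a y) * G a y + H D y)"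
        using insert by (simp add: H_def fun_eq_iff)
      moreover have "e (\<lambda>y. cnj (G a y) * G a y + H D y) = e (\<lambda>y. cnj (G a y) * G a y) + e (H D)"
        by (rule add) (use c G(1)[OF a] D in \<open>auto intro: continuous_intros\<close>)
      moreover have "e (\<lambda>y. cnj (G a y) * G a y) = 0"
        using mult[OF c G(1)[OF a]] G(2)[OF a] by simp
      ultimately show ?case
        using G(1)[OF a] D by (auto intro!: continuous_intros)
    qed
    have Hnz: "H C y \<noteq> 0" if y: "y \<in> model" for y
    proof -
      obtain x where x: "x \<in> C" "y \<in> W x" using C(3) y by blast
      then have "G x y \<noteq> 0" using W(2)[of x] C(1) y by blast
      have "H C y = complex_of_real (\<Sum>x\<in>C. (cmod (G x y))\<^sup>2)"
        by (simp add: H_def complex_norm_square mult.commute del: of_real_power)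
      moreover have "(\<Sum>x\<in>C. (cmod (G x y))\<^sup>2) > 0"
        using x(1) \<open>G x y \<noteq> 0\<close> by (intro sum_pos2[OF C(2)]) auto
      ultimately show ?thesis by (metis less_irrefl of_real_eq_0_iff)
    qed
    have cH: "continuous_on model (H C)" "e (H C) = 0" using H[OF C(2,1)] by auto
    have ci: "continuous_on model (\<lambda>y. inverse (H C y))" using cH(1) Hnz by (intro continuous_on_inverse) auto
    have "e (\<lambda>y. H C y * inverse (H C y)) = 0"
      using mult[OF cH(1) ci] cH(2) by simp
    moreover have "pull (\<lambda>y. H C y * inverse (H C y)) = pull (\<lambda>_. 1)"
      by (rule pull_cong) (simp add: Hnz)
    ultimately show False using one by (simp add: e_def)
  qed
  then obtain x where x: "x \<in> model" "\<And>F. continuous_on model F \<Longrightarrow> \<xi> (pull F) = F x"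
    by (auto simp: e_def)
  have "\<xi> T = eval_char x T" for T
  proof (cases "T \<in> pulls")
    case True
    then obtain F where "continuous_on model F" "T = pull F" by (rule pullsE)
    then show ?thesis using x by (simp add: eval_char_pull)
  next
    case False
    then show ?thesis using ch by (simp add: eval_char_def)
  qed
  then show thesis using x(1) by (intro that[of x]) auto
qed

lemma max_ideals_image: "max_ideals \<mu> = eval_char ` model"
  using eval_char_max_ideals max_ideals_eval_char by (metis (no_types, lifting) image_iff subsetI subset_antisym)

section \<open>The model is homeomorphic to the maximal ideal space\<close>

definition decode :: "(L2_op \<Rightarrow> complex) \<Rightarrow> nat \<Rightarrow> real" where
  "decode \<xi> n = Re (\<xi> (pull (\<lambda>x. complex_of_real (x n))))"

lemma decode_eval_char: assumes "x \<in> model" shows "decode (eval_char x) = x"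
proof
  fix n
  have "continuous_on model (\<lambda>x. complex_of_real (x n))"
    by (intro continuous_intros continuous_on_coord)
  then show "decode (eval_char x) n = x n"
    using assms by (simp add: decode_def eval_char_pull)
qed

text \<open>Each coordinate is the real part of the value at one fixed operator, which is continuous
  in the product topology. In contrast to \<open>coords\<close>, the marker is read off too.\<close>

lemma continuous_on_decode: "continuous_on A decode"
  unfolding decode_def[abs_def]
  by (rule continuous_on_coordinatewise_then_product) (intro continuous_on_Re continuous_on_coord)

lemma continuous_on_eval_char: "continuous_on model eval_char"
proof (rule continuous_on_coordinatewise_then_product)
  fix T
  show "continuous_on model (\<lambda>x. eval_char x T)"
  proof (cases "T \<in> pulls")
    case True
    then obtain F where F: "continuous_on model F" "T = pull F" by (rule pullsE)
    then show ?thesis by (intro continuous_on_eq[OF F(1)]) (simp add: eval_char_pull)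
  qed (simp add: eval_char_def)
qed

lemma homeomorphism_eval_char:
  assumes "S \<subseteq> model" shows "homeomorphism S (eval_char ` S) eval_char decode"
  using assms decode_eval_char
  by (intro homeomorphismI continuous_on_decode continuous_on_subset[OF continuous_on_eval_char]) auto

lemma component_eval_char:
  assumes "x \<in> model" "symbol a"
  shows "component \<mu> (eval_char x) n (mult_op a) = coord_symbol n a x"
  using assms by (simp add: component_def conj_U_symbol eval_char_pull continuous_on_coord_symbol)

lemma is_zero_functional_eval_char:
  assumes "x \<in> model"
  shows "is_zero_functional (component \<mu> (eval_char x) n) \<longleftrightarrow> x n = -1"
proof
  assume "is_zero_functional (component \<mu> (eval_char x) n)"
  then have "component \<mu> (eval_char x) n (mult_op (\<lambda>_. 1)) = 0"
    using symbol_const[of 1] by (auto simp: is_zero_functional_def alg_A_def)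
  then show "x n = -1"
    by (simp add: component_eval_char[OF assms symbol_const] coord_symbol_def symbol_value_const split: if_splits)
next
  assume "x n = -1"
  then show "is_zero_functional (component \<mu> (eval_char x) n)"
    using assms by (auto simp: is_zero_functional_def alg_A_def component_eval_char coord_symbol_def)
qed

lemma is_point_eval_char:
  assumes "x \<in> model" "x n \<noteq> -1"
  shows "is_point (component \<mu> (eval_char x) n) y \<longleftrightarrow> y = x n"
proof
  have xn: "x n \<in> {0..1}" using model_coord[OF assms(1), of n] assms(2) by auto
  show "is_point (component \<mu> (eval_char x) n) y" if "y = x n"
    using xn assms that by (auto simp: is_point_def component_eval_char coord_symbol_def)
  assume y: "is_point (component \<mu> (eval_char x) n) y"
  then have "component \<mu> (eval_char x) n (mult_op (\<lambda>t. 0 + complex_of_real (frac t)))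
      = symbol_value (\<lambda>t. 0 + complex_of_real (frac t)) y"
    using symbol_frac_plus[of 0] unfolding is_point_def by blast
  then show "y = x n"
    using y xn unfolding component_eval_char[OF assms(1) symbol_frac_plus]
    by (simp add: coord_symbol_def assms(2) symbol_value_frac_plus[of _ 0, simplified] is_point_def)
qed

lemma coords_eval_char: "x \<in> model \<Longrightarrow> x n \<noteq> -1 \<Longrightarrow> coords \<mu> (eval_char x) n = x n"
  unfolding coords_def by (rule the_equality) (simp_all add: is_point_eval_char)

lemma M_fin_image: "M_fin \<mu> N = eval_char ` model_fin N"
  by (auto simp: M_fin_def model_fin_def max_ideals_image is_zero_functional_eval_char)

lemma M_inf_image: "M_inf \<mu> = eval_char ` model_inf"
  by (auto simp: M_inf_def model_inf_def max_ideals_image is_zero_functional_eval_char)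

text \<open>By \<open>U_mult_op_V\<close> conjugation precomposes with \<open>\<gamma>\<close>,
  which acts on backward orbits as \<open>shift\<close>.\<close>

lemma alpha_tilde_eval_char:
  assumes x: "x \<in> model" shows "alpha_tilde \<mu> (eval_char x) = eval_char (shift x)"
proof
  fix T
  show "alpha_tilde \<mu> (eval_char x) T = eval_char (shift x) T"
  proof (cases "T \<in> pulls")
    case True
    then obtain F where F: "continuous_on model F" "T = pull F" by (rule pullsE)
    have "U_op \<mu> o\<^sub>L T o\<^sub>L adj (U_op \<mu>) = mult_op (\<lambda>t. F (back_orbit (\<gamma> t)))"
      unfolding F(2) pull_def adj_U by (rule U_mult_op_V[OF bmeas_pull[OF F(1)]])
    also have "\<dots> = pull (\<lambda>y. F (shift y))"
      by (simp add: pull_def back_orbit_gam)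
    finally have "U_op \<mu> o\<^sub>L T o\<^sub>L adj (U_op \<mu>) = pull (\<lambda>y. F (shift y))" .
    moreover have "continuous_on model (\<lambda>y. F (shift y))"
      by (rule continuous_on_compose2[OF F(1) continuous_on_shift]) (auto intro: shift_model)
    ultimately show ?thesis
      using True F x by (simp add: alpha_tilde_def alg_B_eq_pulls eval_char_pull shift_model)
  next
    case False
    then show ?thesis by (simp add: alpha_tilde_def alg_B_eq_pulls eval_char_def)
  qed
qed

section \<open>Convergence in the Hausdorff metric\<close>

text \<open>\<open>D\<close> stands for a metric pulled back to \<open>model\<close>, known only
  through its laws and its relatively open balls. One half uses the \<open>e\<close>-neighbourhood
  of \<open>model_inf\<close>, the other a finite net in it.\<close>

lemma model_fin_Hausdorff_close:
  fixes D :: "(nat \<Rightarrow> real) \<Rightarrow> (nat \<Rightarrow> real) \<Rightarrow> real"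
  assumes sym: "\<And>x y. D x y = D y x"
    and tri: "\<And>x y z. x \<in> model \<Longrightarrow> y \<in> model \<Longrightarrow> z \<in> model \<Longrightarrow> D x z \<le> D x y + D y z"
    and zero: "\<And>x. x \<in> model \<Longrightarrow> D x x = 0"
    and ball: "\<And>x r. x \<in> model \<Longrightarrow> \<exists>W. open W \<and> W \<inter> model = {y \<in> model. D x y < r}"
    and e: "e > 0"
  shows "eventually (\<lambda>N. (\<forall>a\<in>model_fin N. \<exists>b\<in>model_inf. D a b < e) \<and>
      (\<forall>b\<in>model_inf. \<exists>a\<in>model_fin N. D a b < e)) sequentially"
proof -
  have inf: "x \<in> model" if "x \<in> model_inf" for x using that by (simp add: model_inf_def)
  have fin: "x \<in> model" if "x \<in> model_fin N" for x N using that by (simp add: model_fin_def)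
  define W where "W x r = (SOME W. open W \<and> W \<inter> model = {y \<in> model. D x y < r})" for x r
  have W: "open (W x r)" "W x r \<inter> model = {y \<in> model. D x y < r}" if "x \<in> model" for x r
    using someI_ex[OF ball[OF that, of r]] by (simp_all add: W_def)
  have self: "x \<in> W x r" if "x \<in> model" "r > 0" for x r
  proof -
    have "x \<in> W x r \<inter> model" unfolding W(2)[OF that(1)] using that zero by simp
    then show ?thesis by simp
  qed
  have "eventually (\<lambda>N. model_fin N \<subseteq> (\<Union>b\<in>model_inf. W b e)) sequentially"
    using e by (intro model_fin_eventually_near open_UN ballI W(1)) (auto intro: inf self)
  then have 1: "eventually (\<lambda>N. \<forall>a\<in>model_fin N. \<exists>b\<in>model_inf. D a b < e) sequentially"
  proof eventually_elim
    case (elim N)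
    show ?case
    proof
      fix a assume a: "a \<in> model_fin N"
      then obtain b where b: "b \<in> model_inf" "a \<in> W b e" using elim by blast
      then have "a \<in> W b e \<inter> model" using fin[OF a] by simp
      then have "D b a < e" unfolding W(2)[OF inf[OF b(1)]] by simp
      then show "\<exists>b\<in>model_inf. D a b < e" using b(1) sym[of b a] by auto
    qed
  qed
  have cover: "model_inf \<subseteq> (\<Union>b\<in>model_inf. W b (e/2))"
  proof
    fix b assume b: "b \<in> model_inf"
    then have "b \<in> W b (e/2)" using e by (intro self inf) auto
    then show "b \<in> (\<Union>b\<in>model_inf. W b (e/2))" using b by blast
  qed
  \<comment> \<open>Finitely many centres make the estimate uniform in \<open>b\<close>; with radius
    \<open>e/2\<close>, points near a common centre are closer than \<open>e\<close> to each
    other.\<close>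
  obtain C where C: "C \<subseteq> model_inf" "finite C" "model_inf \<subseteq> (\<Union>b\<in>C. W b (e/2))"
    by (rule compactE_image[OF compact_model_inf _ cover], rule W(1), erule inf) blast
  have "eventually (\<lambda>N. \<forall>c\<in>C. model_fin N \<inter> W c (e/2) \<noteq> {}) sequentially"
  proof (intro eventually_ball_finite C(2) ballI)
    fix c assume "c \<in> C"
    then have c: "c \<in> model_inf" using C(1) by blast
    show "eventually (\<lambda>N. model_fin N \<inter> W c (e/2) \<noteq> {}) sequentially"
      by (rule model_fin_eventually_meets[OF W(1) self c]) (use inf[OF c] e in auto)
  qed
  then have 2: "eventually (\<lambda>N. \<forall>b\<in>model_inf. \<exists>a\<in>model_fin N. D a b < e) sequentially"
  proof eventually_elim
    case (elim N)
    show ?case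
    proof
      fix b assume b: "b \<in> model_inf"
      then obtain c where c: "c \<in> C" "b \<in> W c (e/2)" using C(3) by blast
      have cm: "c \<in> model" using c(1) C(1) inf by blast
      obtain a where a: "a \<in> model_fin N" "a \<in> W c (e/2)" using elim c(1) by blast
      have "b \<in> W c (e/2) \<inter> model" "a \<in> W c (e/2) \<inter> model" using a b c inf fin by auto
      then have "D c b < e/2" "D c a < e/2" unfolding W(2)[OF cm] by auto
      then have "D a b < e"
        using tri[OF fin[OF a(1)] cm inf[OF b]] sym[of a c] by linarith
      then show "\<exists>a\<in>model_fin N. D a b < e" using a(1) by blast
    qed
  qed
  from 1 2 show ?thesis by eventually_elim blast
qed

lemma model_fin_nonempty: "model_fin N \<noteq> {}"
  using arc_point_in_model_fin[of \<mu> N] mu_less_1 by auto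

lemma model_fin_subset: "model_fin N \<subseteq> model" and model_inf_subset: "model_inf \<subseteq> model"
  by (auto simp: model_fin_def model_inf_def)

text \<open>The metric \<open>d\<close> enters only through the topology it induces: continuity of
  \<open>eval_char\<close> makes its balls relatively open in \<open>model\<close>.\<close>

lemma hausdorff_M_fin:
  assumes "Metric_space (max_ideals \<mu>) d"
    and top: "Metric_space.mtopology (max_ideals \<mu>) d = top_of_set (max_ideals \<mu>)"
  shows "(\<lambda>N. hausdorff_distance d (M_fin \<mu> N) (M_inf \<mu>)) \<longlonglongrightarrow> 0"
proof (rule metric_LIMSEQ_I)
  interpret Metric_space "max_ideals \<mu>" d by fact
  fix e :: real assume e: "e > 0"
  define D where "D x y = d (eval_char x) (eval_char y)" for x y
  \<comment> \<open>Half of \<open>e\<close>, because \<open>hausdorff_distance_le\<close> returns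
    only a weak inequality.\<close>
  have "eventually (\<lambda>N. (\<forall>a\<in>model_fin N. \<exists>b\<in>model_inf. D a b < e/2) \<and>
      (\<forall>b\<in>model_inf. \<exists>a\<in>model_fin N. D a b < e/2)) sequentially"
  proof (rule model_fin_Hausdorff_close)
    show "D x y = D y x" for x y unfolding D_def by (rule commute)
    show "D x z \<le> D x y + D y z" if "x \<in> model" "y \<in> model" "z \<in> model" for x y z
      unfolding D_def using that by (intro triangle eval_char_max_ideals)
    show "D x x = 0" if "x \<in> model" for x
      unfolding D_def using that by (simp add: eval_char_max_ideals)
    show "e / 2 > 0" using e by simp
    fix x r assume x: "x \<in> model"
    have "openin (top_of_set (max_ideals \<mu>)) (mball (eval_char x) r)"
      using openin_mball top by metis
    moreover have "continuous_map (top_of_set model) (top_of_set (max_ideals \<mu>)) eval_char"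
      using continuous_on_eval_char eval_char_max_ideals by simp
    ultimately have "openin (top_of_set model) {y \<in> topspace (top_of_set model). eval_char y \<in> mball (eval_char x) r}"
      by (rule openin_continuous_map_preimage[rotated])
    moreover have "{y \<in> topspace (top_of_set model). eval_char y \<in> mball (eval_char x) r} = {y \<in> model. D x y < r}"
      using x eval_char_max_ideals by (auto simp: D_def)
    ultimately show "\<exists>W. open W \<and> W \<inter> model = {y \<in> model. D x y < r}"
      unfolding openin_open by (metis inf_commute)
  qed
  then have "eventually (\<lambda>N. dist (hausdorff_distance d (M_fin \<mu> N) (M_inf \<mu>)) 0 < e) sequentially"
  proof eventually_elim
    case (elim N)
    have "0 \<le> hausdorff_distance d (M_fin \<mu> N) (M_inf \<mu>) \<and> hausdorff_distance d (M_fin \<mu> N) (M_inf \<mu>) \<le> e/2"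
      by (rule hausdorff_distance_le)
        (use elim model_fin_nonempty model_inf_nonempty in \<open>auto simp: M_fin_image M_inf_image D_def\<close>)
    then show ?case using e by (simp add: dist_real_def)
  qed
  then show "\<exists>no. \<forall>n\<ge>no. dist (hausdorff_distance d (M_fin \<mu> n) (M_inf \<mu>)) 0 < e"
    by (simp add: eventually_sequentially)
qed

section \<open>Transport from the model to the characters\<close>

lemma homeomorphic_maps_eval_char:
  "S \<subseteq> model \<Longrightarrow> homeomorphic_maps (top_of_set S) (top_of_set (eval_char ` S)) eval_char decode"
  by (intro homeomorphism_imp_homeomorphic_maps homeomorphism_eval_char)

lemma homeomorphic_space_eval_char:
  "S \<subseteq> model \<Longrightarrow> top_of_set (eval_char ` S) homeomorphic_space top_of_set S"
  using homeomorphic_maps_eval_char homeomorphic_maps_sym unfolding homeomorphic_space_def by blast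

lemma metrizable_eval_char: "S \<subseteq> model \<Longrightarrow> metrizable_space (top_of_set (eval_char ` S))"
  using homeomorphic_metrizable_space[OF homeomorphic_space_eval_char]
    metrizable_space_subtopology[OF metrizable_space_euclidean] by blast

text \<open>\<open>eval_char\<close> conjugates the map to \<open>shift\<close>, whose inverse drops
  the first coordinate. The resulting composite agrees with \<open>alpha_tilde \<mu>\<close> on the
  given characters.\<close>

lemma homeomorphic_map_alpha_tilde:
  assumes "S \<subseteq> model"
  shows "homeomorphic_map (top_of_set (eval_char ` S)) (top_of_set (eval_char ` shift ` S)) (alpha_tilde \<mu>)"
proof -
  have "homeomorphism S (shift ` S) shift (\<lambda>x n. x (Suc n))"
    by (intro homeomorphismI continuous_on_shift continuous_on_coordinatewise_then_product continuous_on_coord)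
      (auto simp: fun_eq_iff shift_simps(2))
  then have s: "homeomorphic_map (top_of_set S) (top_of_set (shift ` S)) shift"
    using homeomorphism_imp_homeomorphic_maps homeomorphic_maps_imp_map by blast
  have d: "homeomorphic_map (top_of_set (eval_char ` S)) (top_of_set S) decode"
    using homeomorphic_maps_eval_char[OF assms] homeomorphic_maps_sym homeomorphic_maps_imp_map by blast
  have "shift ` S \<subseteq> model" using assms shift_model by blast
  then have c: "homeomorphic_map (top_of_set (shift ` S)) (top_of_set (eval_char ` shift ` S)) eval_char"
    by (intro homeomorphic_maps_imp_map[OF homeomorphic_maps_eval_char])
  have "homeomorphic_map (top_of_set (eval_char ` S)) (top_of_set (eval_char ` shift ` S)) (eval_char \<circ> (shift \<circ> decode))"
    by (rule homeomorphic_map_compose[OF homeomorphic_map_compose[OF d s] c])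
  then show ?thesis
    by (rule homeomorphic_map_eq) (use assms in \<open>auto simp: decode_eval_char alpha_tilde_eval_char subset_iff\<close>)
qed

lemma coords_M_inf: "x \<in> model_inf \<Longrightarrow> coords \<mu> (eval_char x) = x"
  by (auto simp: fun_eq_iff coords_eval_char model_inf_def)

end

theorem theorem3p4:
  fixes \<mu> :: real
  assumes "0 < \<mu>" and "\<mu> < 1"
  shows
    "(\<forall>\<xi>\<in>max_ideals \<mu>. \<forall>n. is_zero_functional (component \<mu> \<xi> n) \<or>
        is_point (component \<mu> \<xi> n) (coords \<mu> \<xi> n)) \<and>
     snake_like (top_of_set (M_inf \<mu>)) \<and>
     homeomorphic_map (top_of_set (M_inf \<mu>))
       (top_of_set (inverse_limit {0..1} (\<lambda>_. logistic \<mu>))) (coords \<mu>) \<and>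
     (\<forall>N. is_arc (top_of_set (M_fin \<mu> N))) \<and>
     metrizable_space (top_of_set (max_ideals \<mu>)) \<and>
     (\<forall>d. Metric_space (max_ideals \<mu>) d \<and>
        Metric_space.mtopology (max_ideals \<mu>) d = top_of_set (max_ideals \<mu>) \<longrightarrow>
        (\<lambda>N. hausdorff_distance d (M_fin \<mu> N) (M_inf \<mu>)) \<longlonglongrightarrow> 0) \<and>
     max_ideals \<mu> = (\<Union>N. M_fin \<mu> N) \<union> M_inf \<mu> \<and>
     max_ideals \<mu> = top_of_set (max_ideals \<mu>) closure_of (\<Union>N. M_fin \<mu> N) \<and>
     (\<forall>N. homeomorphic_map (top_of_set (M_fin \<mu> N)) (top_of_set (M_fin \<mu> (N + 1)))
        (alpha_tilde \<mu>)) \<and>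
     homeomorphic_map (top_of_set (M_inf \<mu>)) (top_of_set (M_inf \<mu>)) (alpha_tilde \<mu>) \<and>
     (\<forall>\<xi>\<in>M_inf \<mu>. coords \<mu> (alpha_tilde \<mu> \<xi>) = induced_map (logistic \<mu>) (coords \<mu> \<xi>))"
proof -
  interpret logistic_parameter \<mu> by standard fact+
  have hom_inf: "top_of_set (M_inf \<mu>) homeomorphic_space top_of_set model_inf"
    unfolding M_inf_image by (rule homeomorphic_space_eval_char[OF model_inf_subset])
  show ?thesis
  proof (intro conjI ballI allI impI)
    show "is_zero_functional (component \<mu> \<xi> n) \<or> is_point (component \<mu> \<xi> n) (coords \<mu> \<xi> n)"
      if "\<xi> \<in> max_ideals \<mu>" for \<xi> n
      using that unfolding max_ideals_image
      by (metis is_zero_functional_eval_char is_point_eval_char coords_eval_char imageE)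
    have "continuum (top_of_set (M_inf \<mu>))"
      unfolding continuum_def
    proof (intro conjI)
      have "connected_space (top_of_set model_inf)"
        using connectedin_subtopology[of euclidean model_inf model_inf] connectedin_topspace[of "top_of_set model_inf"]
          connected_model_inf by simp
      then show "connected_space (top_of_set (M_inf \<mu>))"
        using homeomorphic_connected_space[OF hom_inf] by simp
      have "compact_space (top_of_set model_inf)"
        using compact_model_inf by (intro compact_space_subtopology) simp
      then show "compact_space (top_of_set (M_inf \<mu>))"
        using homeomorphic_compact_space[OF hom_inf] by simp
      show "metrizable_space (top_of_set (M_inf \<mu>))"
        unfolding M_inf_image by (rule metrizable_eval_char[OF model_inf_subset])
    qed
    then show "snake_like (top_of_set (M_inf \<mu>))"
      unfolding snake_like_def
      using hom_inf logistic_unit continuous_on_logistic[OF continuous_on_id]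
      by (auto simp: model_inf_inverse_limit image_subset_iff intro!: exI[of _ "\<lambda>_. logistic \<mu>"] simp del: atLeastAtMost_iff)
    \<comment> \<open>The homeomorphism is available for \<open>decode\<close>, which coincides with
      \<open>coords\<close> on \<open>M_inf\<close> because no coordinate there is the
      marker.\<close>
    have "homeomorphic_map (top_of_set (M_inf \<mu>)) (top_of_set model_inf) decode"
      unfolding M_inf_image
      using homeomorphic_maps_eval_char[OF model_inf_subset] homeomorphic_maps_sym homeomorphic_maps_imp_map by blast
    then show "homeomorphic_map (top_of_set (M_inf \<mu>))
       (top_of_set (inverse_limit {0..1} (\<lambda>_. logistic \<mu>))) (coords \<mu>)"
      unfolding model_inf_inverse_limit[symmetric]
      by (rule homeomorphic_map_eq)
        (use model_inf_subset in \<open>auto simp: M_inf_image decode_eval_char coords_M_inf subset_iff\<close>)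
    show "is_arc (top_of_set (M_fin \<mu> N))" for N
      using homeomorphic_space_trans[OF homeomorphic_space_eval_char[OF model_fin_subset]] is_arc_model_fin
      unfolding is_arc_def M_fin_image by blast
    show "metrizable_space (top_of_set (max_ideals \<mu>))"
      unfolding max_ideals_image by (rule metrizable_eval_char) simp
    show "(\<lambda>N. hausdorff_distance d (M_fin \<mu> N) (M_inf \<mu>)) \<longlonglongrightarrow> 0"
      if "Metric_space (max_ideals \<mu>) d \<and>
        Metric_space.mtopology (max_ideals \<mu>) d = top_of_set (max_ideals \<mu>)" for d
      using that hausdorff_M_fin by blast
    show "max_ideals \<mu> = (\<Union>N. M_fin \<mu> N) \<union> M_inf \<mu>"
      unfolding max_ideals_image M_fin_image M_inf_image by (subst model_union) (simp add: image_Un image_UN)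
    \<comment> \<open>The closure is computed in the model and then carried over, since
      homeomorphisms commute with closures.\<close>
    have "top_of_set model closure_of (\<Union>N. model_fin N) = model"
      using model_closure model_fin_subset by (subst closure_of_subtopology) (auto simp: Int_absorb1 UN_least)
    then show "max_ideals \<mu> = top_of_set (max_ideals \<mu>) closure_of (\<Union>N. M_fin \<mu> N)"
      using homeomorphic_map_closure_of[OF homeomorphic_maps_imp_map[OF homeomorphic_maps_eval_char[OF order_refl]],
          of "\<Union>N. model_fin N"] model_fin_subset
      by (simp add: max_ideals_image M_fin_image image_UN UN_least)
    show "homeomorphic_map (top_of_set (M_fin \<mu> N)) (top_of_set (M_fin \<mu> (N + 1))) (alpha_tilde \<mu>)" for N
      using homeomorphic_map_alpha_tilde[OF model_fin_subset, of N]
      unfolding M_fin_image shift_model_fin .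
    show "homeomorphic_map (top_of_set (M_inf \<mu>)) (top_of_set (M_inf \<mu>)) (alpha_tilde \<mu>)"
      using homeomorphic_map_alpha_tilde[OF model_inf_subset]
      unfolding M_inf_image shift_model_inf .
    show "coords \<mu> (alpha_tilde \<mu> \<xi>) = induced_map (logistic \<mu>) (coords \<mu> \<xi>)" if xi: "\<xi> \<in> M_inf \<mu>" for \<xi>
    proof -
      obtain x where x: "x \<in> model_inf" "\<xi> = eval_char x" using xi unfolding M_inf_image by blast
      then have "shift x \<in> model_inf" "x \<in> model" using shift_model_inf model_inf_subset by auto
      then show ?thesis using x by (simp add: alpha_tilde_eval_char coords_M_inf shift_def)
    qed
  qed
qed

end
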